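(* Let $0<q<1$, $n\ge1$, $L\ge1$, let $\theta^1,\dots,\theta^L$ be positive integers, and let $\boldsymbol\lambda=(\lambda_0,\dots,\lambda_{n-1})$ be parameters. With the notation of the context, define $U(\boldsymbol\lambda):=U_{n-1}(\lambda_{n-1})\cdots U_0(\lambda_0)$ and let $M_{U(\boldsymbol\lambda)}$ be the matrix of its action on $V^{(n)}_{\theta^1}\otimes\cdots\otimes V^{(n)}_{\theta^L}$ in the basis $\{v_{\boldsymbol\xi}\}$. Let $\mathcal L$ be the generator of the $n$-species ASEP$(q,\boldsymbol\theta)$. (i) The function $D$ given by $$D:=G^{-1}M_{U(\boldsymbol\lambda)}G^{-1}B^2$$ is a self-duality function for the $n$-species ASEP$(q,\boldsymbol\theta)$, and the entries are orthogonal with respect to the reversible measures (given by the diagonal matrix $G^2B^{-2}$), in the sense that $$D^TG^2B^{-2}D=G^{-2}B^2.$$ (ii) More generally, let $A$ be a quantity which is conserved under the dynamics; in other words, $A$ is a diagonal matrix such that $\mathcal LA=A\mathcal L$. Then the function $D_A$ given by $$D_A:=AG^{-1}M_{U(\boldsymbol\lambda)}G^{-1}B^2A$$ is a self-duality function, and its entries are orthogonal with respect to the reversible measures, in the sense that $$D_A^TA^{-2}G^2B^{-2}D_A=A^2G^{-2}B^2.$$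
   Context: **Notation.** $[m]_q=\frac{q^m-q^{-m}}{q-q^{-1}}$, $[m]_q^!=[1]_q\cdots[m]_q$, $\{m\}_{q^2}=\frac{1-q^{2m}}{1-q^2}$, $\{m\}_{q^2}^!=\{1\}_{q^2}\cdots\{m\}_{q^2}$, $(a;q)_k=\prod_{j=0}^{k-1}(1-aq^j)$; $e_{q^2}(z)=\sum_{k\ge0}\frac{z^k}{(q^2;q^2)_k}$, $\mathcal E_{q^2}(z)=\sum_{k\ge0}\frac{q^{k(k-1)}z^k}{(q^2;q^2)_k}$. **Process.** Configurations are $\boldsymbol\xi=(\xi_i^x)_{1\le x\le L,0\le i\le n}$, $\xi_i^x\in\mathbb Z_{\ge0}$, $\sum_i\xi_i^x=\theta^x$; $\xi^x_{[a,b]}=\sum_{j=a}^b\xi_j^x$ (zero if $b<a$). The $n$-species ASEP$(q,\boldsymbol\theta)$ has generator $\mathcal L=\sum_{x=1}^{L-1}\mathcal L_{x,x+1}$, $$\mathcal L_{x,x+1}f(\boldsymbol\xi)=\sum_{0\le k<l\le n}\Big(q^{-1+2\xi^x_{[0,k-1]}}\{\xi^x_k\}_{q^2}q^{2\xi^{x+1}_{[l+1,n]}}\{\xi^{x+1}_l\}_{q^2}\big(f(\boldsymbol\xi^{x\leftrightarrow x+1}_{k\leftrightarrow l})-f(\boldsymbol\xi)\big)+q^{1+2\xi^x_{[0,l-1]}}\{\xi^x_l\}_{q^2}q^{2\xi^{x+1}_{[k+1,n]}}\{\xi^{x+1}_k\}_{q^2}\big(f(\boldsymbol\xi^{x\leftrightarrow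 x+1}_{l\leftrightarrow k})-f(\boldsymbol\xi)\big)\Big),$$ where $\boldsymbol\xi^{x\leftrightarrow x+1}_{i\leftrightarrow j}$ exchanges a species $i$ particle at $x$ with a species $j$ particle at $x+1$ (and equals $\boldsymbol\xi$ if impossible). A function $D(\boldsymbol\xi,\boldsymbol\eta)$, also viewed as a matrix indexed by configurations, is a self-duality function if $\mathbb E_{\boldsymbol\xi}[D(\boldsymbol\xi(t),\boldsymbol\eta)]=\mathbb E_{\boldsymbol\eta}[D(\boldsymbol\xi,\boldsymbol\eta(t))]$ for all $t\ge0$. **Representation.** $\mathcal U_q(\mathfrak{gl}_{n+1})$ is the Drinfeld–Jimbo quantum group with generators $E_{i,i+1},E_{i+1,i}$ ($0\le i<n$) and $q^{E_{ii}}$ ($0\le i\le n$), with $[E_{i,i+1},E_{i+1,i}]=\frac{q^{E_{ii}-E_{i+1,i+1}}-q^{E_{i+1,i+1}-E_{ii}}}{q-q^{-1}}$ and the other standard relations, and coproduct $\Delta(E_{i,i+1})=E_{i,i+1}\otimes1+q^{E_{ii}-E_{i+1,i+1}}\otimes E_{i,i+1}$, $\Delta(E_{i+1,i})=1\otimes E_{i+1,i}+E_{i+1,i}\otimes q^{-(E_{ii}-E_{i+1,i+1})}$, $\Delta(q^{E_{ii}})=q^{E_{ii}}\otimes q^{E_{ii}}$. The space $V^{(n)}_m$ has basis $v_\mu$, $\mu=(\mu_0,\dots,\mu_n)\in\mathbb Z_{\ge0}^{n+1}$, $\sum\mu_i=m$, with $$E_{i,i+1}v_\mu=[\mu_{i+1}]_qv_{\mu+\epsilon_i},\quad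 E_{i+1,i}v_\mu=[\mu_i]_qv_{\mu-\epsilon_i},\quad q^{E_{ii}}v_\mu=q^{\mu_i}v_\mu,$$ $\epsilon_i$ having $1$ in position $i$, $-1$ in position $i+1$ and zeros elsewhere. The algebra acts on $V^{(n)}_{\theta^1}\otimes\cdots\otimes V^{(n)}_{\theta^L}$ via the $(L-1)$-fold iterated coproduct; $v_{\boldsymbol\xi}=v_{\boldsymbol\xi^1}\otimes\cdots\otimes v_{\boldsymbol\xi^L}$, $\boldsymbol\xi^x=(\xi^x_0,\dots,\xi^x_n)$. **Symmetry.** For $0\le i\le n-1$ and $\lambda=\gamma(1-q^2)(q-q^{-1})$, $$U_i(\lambda)=e_{q^2}^{1/2}\big(-\gamma\lambda q^{2E_{ii}}\big)\,e_{q^2}\big(\gamma(1-q^2)(q-q^{-1})E_{i+1,i}q^{E_{ii}}\big)\,\mathcal E_{q^2}\big(-\lambda q^{E_{i+1,i+1}}E_{i,i+1}\big)\,\mathcal E_{q^2}^{1/2}\big(\gamma\lambda(1-q^2) q^{2E_{i+1,i+1}}\big),$$ where $e^{1/2}_{q^2}(\cdot)$, $\mathcal E^{1/2}_{q^2}(\cdot)$ denote elements whose squares are $e_{q^2}(\cdot)$, $\mathcal E_{q^2}(\cdot)$ (their arguments lie in the subalgebra generated by the $q^{\pm E_{jj}}$, which acts diagonally on finite-dimensional modules). **Diagonal matrices** (indexed by configurations): $$G(\boldsymbol\xi,\boldsymbol\xi)=\prod_{i=0}^n\prod_{x=1}^L\frac1{[\xi_i^x]_q^!}\prod_{1\le y<x\le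 L}\prod_{i=0}^{n-1}q^{-\xi_{i+1}^y\xi^x_{[0,i]}},\qquad B(\boldsymbol\xi,\boldsymbol\xi)=\prod_{x=1}^L\frac{1}{\sqrt{\{\xi^x_0\}^!_{q^2}\cdots\{\xi^x_n\}^!_{q^2}}}.$$
   Formalization: λ=γ(1−q²)(q−1/q) is replaced by λ=γ(1−q²)(q²−1), and the last factor's argument by γλq^{2E_{i+1,i+1}} without (1−q²), since orthogonality fails as printed already for n=L=θ¹=1; γ, λ are real with |γλ|<1 (convergence), and A is invertible for orthogonality in (ii). *)

theory Defs
  imports "HOL-Probability.Probability"
begin

section \<open>q-analogues\<close>

definition qint :: "real \<Rightarrow> nat \<Rightarrow> real" where
  "qint q m = (q powi (int m) - q powi (- int m)) / (q - inverse q)"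

definition qfact :: "real \<Rightarrow> nat \<Rightarrow> real" where
  "qfact q m = (\<Prod>k=1..m. qint q k)"

definition cint :: "real \<Rightarrow> nat \<Rightarrow> real" where
  "cint q m = (1 - q ^ (2 * m)) / (1 - q ^ 2)"

definition cfact :: "real \<Rightarrow> nat \<Rightarrow> real" where
  "cfact q m = (\<Prod>k=1..m. cint q k)"

definition qpoch :: "real \<Rightarrow> real \<Rightarrow> nat \<Rightarrow> real" where
  "qpoch a q k = (\<Prod>j<k. 1 - a * q ^ j)"


section \<open>Configurations and matrices indexed by them\<close>

text \<open>\<open>\<xi> x i\<close> is the number of particles of species \<open>i \<in> {0..n}\<close> at site \<open>x \<in> {1..L}\<close>;
  entries outside these index ranges are normalised to 0, so that configurations are in
  bijection with the elements of \<open>confs n L \<theta>\<close>.\<close>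

type_synonym conf = "nat \<Rightarrow> nat \<Rightarrow> nat"
type_synonym opr = "conf \<Rightarrow> conf \<Rightarrow> real"

definition confs :: "nat \<Rightarrow> nat \<Rightarrow> (nat \<Rightarrow> nat) \<Rightarrow> conf set" where
  "confs n L \<theta> = {\<xi>. (\<forall>x i. x \<notin> {1..L} \<or> i \<notin> {0..n} \<longrightarrow> \<xi> x i = 0) \<and>
                      (\<forall>x\<in>{1..L}. (\<Sum>i=0..n. \<xi> x i) = \<theta> x)}"

text \<open>A matrix \<open>M\<close> has row index first: \<open>M \<xi>' \<xi>\<close> is the coefficient of \<open>v\<^sub>\<xi>\<^sub>'\<close> in the image
  of \<open>v\<^sub>\<xi>\<close>. Only entries with both indices in the given index set are meaningful.\<close>

definition mmul :: "conf set \<Rightarrow> opr \<Rightarrow> opr \<Rightarrow> opr" where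
  "mmul \<Omega> A B = (\<lambda>\<xi> \<eta>. \<Sum>\<zeta>\<in>\<Omega>. A \<xi> \<zeta> * B \<zeta> \<eta>)"

abbreviation mmul_syn :: "opr \<Rightarrow> conf set \<Rightarrow> opr \<Rightarrow> opr" ("(_ \<star>\<^bsub>_\<^esub>/ _)" [70, 0, 71] 70) where
  "A \<star>\<^bsub>\<Omega>\<^esub> B \<equiv> mmul \<Omega> A B"

definition diagm :: "(conf \<Rightarrow> real) \<Rightarrow> opr" where
  "diagm f = (\<lambda>\<xi> \<eta>. if \<xi> = \<eta> then f \<xi> else 0)"

definition mtransp :: "opr \<Rightarrow> opr" where
  "mtransp A = (\<lambda>\<xi> \<eta>. A \<eta> \<xi>)"

definition scale :: "real \<Rightarrow> opr \<Rightarrow> opr" where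
  "scale c A = (\<lambda>\<xi> \<eta>. c * A \<xi> \<eta>)"

definition eq_on :: "conf set \<Rightarrow> opr \<Rightarrow> opr \<Rightarrow> bool" where
  "eq_on \<Omega> A B \<longleftrightarrow> (\<forall>\<xi>\<in>\<Omega>. \<forall>\<eta>\<in>\<Omega>. A \<xi> \<eta> = B \<xi> \<eta>)"

primrec mpow :: "conf set \<Rightarrow> opr \<Rightarrow> nat \<Rightarrow> opr" where
  "mpow \<Omega> A 0 = diagm (\<lambda>_. 1)"
| "mpow \<Omega> A (Suc k) = A \<star>\<^bsub>\<Omega>\<^esub> mpow \<Omega> A k"

definition e_exp :: "real \<Rightarrow> conf set \<Rightarrow> opr \<Rightarrow> opr" where
  "e_exp q \<Omega> X = (\<lambda>\<xi> \<eta>. \<Sum>k. mpow \<Omega> X k \<xi> \<eta> / qpoch (q^2) (q^2) k)"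

definition E_exp :: "real \<Rightarrow> conf set \<Rightarrow> opr \<Rightarrow> opr" where
  "E_exp q \<Omega> X = (\<lambda>\<xi> \<eta>. \<Sum>k. q ^ (k * (k - 1)) * mpow \<Omega> X k \<xi> \<eta> / qpoch (q^2) (q^2) k)"


section \<open>The process\<close>

definition exch :: "nat \<Rightarrow> nat \<Rightarrow> nat \<Rightarrow> conf \<Rightarrow> conf" where
  "exch x i j \<xi> =
    (if \<xi> x i \<ge> 1 \<and> \<xi> (x + 1) j \<ge> 1
     then \<xi>(x := (\<xi> x)(i := \<xi> x i - 1, j := \<xi> x j + 1),
            x + 1 := (\<xi> (x + 1))(j := \<xi> (x + 1) j - 1, i := \<xi> (x + 1) i + 1))
     else \<xi>)"

definition gen_bond :: "real \<Rightarrow> nat \<Rightarrow> nat \<Rightarrow> (conf \<Rightarrow> real) \<Rightarrow> conf \<Rightarrow> real" where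
  "gen_bond q n x f \<xi> =
    (\<Sum>(k, l)\<in>{(k, l). k < l \<and> l \<le> n}.
       q powi (-1 + 2 * int (\<Sum>j<k. \<xi> x j)) * cint q (\<xi> x k)
         * q ^ (2 * (\<Sum>j=l+1..n. \<xi> (x + 1) j)) * cint q (\<xi> (x + 1) l)
         * (f (exch x k l \<xi>) - f \<xi>)
     + q ^ (1 + 2 * (\<Sum>j<l. \<xi> x j)) * cint q (\<xi> x l)
         * q ^ (2 * (\<Sum>j=k+1..n. \<xi> (x + 1) j)) * cint q (\<xi> (x + 1) k)
         * (f (exch x l k \<xi>) - f \<xi>))"

definition gen :: "real \<Rightarrow> nat \<Rightarrow> nat \<Rightarrow> (conf \<Rightarrow> real) \<Rightarrow> conf \<Rightarrow> real" where
  "gen q n L f \<xi> = (\<Sum>x\<in>{1..<L}. gen_bond q n x f \<xi>)"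

definition gen_mat :: "real \<Rightarrow> nat \<Rightarrow> nat \<Rightarrow> opr" where
  "gen_mat q n L = (\<lambda>\<xi> \<eta>. gen q n L (\<lambda>\<zeta>. if \<zeta> = \<eta> then 1 else 0) \<xi>)"

text \<open>\<open>P t \<xi>\<close> is the law at time \<open>t\<close> of the process started from \<open>\<xi>\<close>. The state space is finite,
  so exactly one family of laws (that of the matrix exponential of the generator) satisfies this
  predicate, up to values at negative times or at initial states outside the state space.\<close>

definition asep_laws ::
  "real \<Rightarrow> nat \<Rightarrow> nat \<Rightarrow> (nat \<Rightarrow> nat) \<Rightarrow> (real \<Rightarrow> conf \<Rightarrow> conf pmf) \<Rightarrow> bool" where
  "asep_laws q n L \<theta> P \<longleftrightarrow>
     (\<forall>t\<ge>0. \<forall>\<xi>\<in>confs n L \<theta>. set_pmf (P t \<xi>) \<subseteq> confs n L \<theta>) \<and>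
     (\<forall>\<xi>\<in>confs n L \<theta>. P 0 \<xi> = return_pmf \<xi>) \<and>
     (\<forall>s\<ge>0. \<forall>t\<ge>0. \<forall>\<xi>\<in>confs n L \<theta>. P (s + t) \<xi> = bind_pmf (P s \<xi>) (P t)) \<and>
     (\<forall>f. \<forall>\<xi>\<in>confs n L \<theta>.
        ((\<lambda>t. (measure_pmf.expectation (P t \<xi>) f - f \<xi>) / t) \<longlongrightarrow> gen q n L f \<xi>) (at_right 0))"

definition self_duality :: "real \<Rightarrow> nat \<Rightarrow> nat \<Rightarrow> (nat \<Rightarrow> nat) \<Rightarrow> opr \<Rightarrow> bool" where
  "self_duality q n L \<theta> D \<longleftrightarrow>
     (\<forall>P. asep_laws q n L \<theta> P \<longrightarrow>
       (\<forall>t\<ge>0. \<forall>\<xi>\<in>confs n L \<theta>. \<forall>\<eta>\<in>confs n L \<theta>.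
          measure_pmf.expectation (P t \<xi>) (\<lambda>\<zeta>. D \<zeta> \<eta>)
            = measure_pmf.expectation (P t \<eta>) (\<lambda>\<zeta>. D \<xi> \<zeta>)))"

text \<open>Measures are given by their (not necessarily normalised) weights; reversibility is
  detailed balance.\<close>

definition reversible_measure :: "real \<Rightarrow> nat \<Rightarrow> nat \<Rightarrow> (nat \<Rightarrow> nat) \<Rightarrow> (conf \<Rightarrow> real) \<Rightarrow> bool" where
  "reversible_measure q n L \<theta> w \<longleftrightarrow>
     (\<forall>\<xi>\<in>confs n L \<theta>. 0 < w \<xi>) \<and>
     (\<forall>\<xi>\<in>confs n L \<theta>. \<forall>\<eta>\<in>confs n L \<theta>.
        w \<xi> * gen_mat q n L \<xi> \<eta> = w \<eta> * gen_mat q n L \<eta> \<xi>)"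

definition conserved :: "real \<Rightarrow> nat \<Rightarrow> nat \<Rightarrow> (nat \<Rightarrow> nat) \<Rightarrow> (conf \<Rightarrow> real) \<Rightarrow> bool" where
  "conserved q n L \<theta> a \<longleftrightarrow>
     eq_on (confs n L \<theta>)
       (gen_mat q n L \<star>\<^bsub>confs n L \<theta>\<^esub> diagm a) (diagm a \<star>\<^bsub>confs n L \<theta>\<^esub> gen_mat q n L)"


section \<open>The representation\<close>

text \<open>\<open>Up i\<close> is \<open>E\<^bsub>i,i+1\<^esub>\<close>, \<open>Dn i\<close> is \<open>E\<^bsub>i+1,i\<^esub>\<close>, and \<open>Ct h\<close> is the group-like element \<open>q^(\<Sum>\<^sub>j h\<^sub>j E\<^sub>j\<^sub>j)\<close>;
  in particular \<open>Ct (\<lambda>_. 0)\<close> is the unit.\<close>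

datatype qgen = Up nat | Dn nat | Ct "nat \<Rightarrow> int"

definition wt :: "nat \<Rightarrow> int \<Rightarrow> nat \<Rightarrow> int" where
  "wt i c = (\<lambda>j. if j = i then c else 0)"

definition rt :: "nat \<Rightarrow> nat \<Rightarrow> int" where
  "rt i = (\<lambda>j. wt i 1 j - wt (i + 1) 1 j)"

fun coprod :: "qgen \<Rightarrow> (qgen \<times> qgen) list" where
  "coprod (Up i) = [(Up i, Ct (\<lambda>_. 0)), (Ct (rt i), Up i)]"
| "coprod (Dn i) = [(Ct (\<lambda>_. 0), Dn i), (Dn i, Ct (\<lambda>j. - rt i j))]"
| "coprod (Ct h) = [(Ct h, Ct h)]"

text \<open>Matrices of the generators on a single \<open>V\<^sub>m\<close>, in the basis \<open>v\<^sub>\<mu>\<close>.\<close>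

fun site_act :: "real \<Rightarrow> nat \<Rightarrow> qgen \<Rightarrow> (nat \<Rightarrow> nat) \<Rightarrow> (nat \<Rightarrow> nat) \<Rightarrow> real" where
  "site_act q n (Up i) \<mu>' \<mu> =
     (if \<mu> (i + 1) \<ge> 1 \<and> \<mu>' = \<mu>(i := \<mu> i + 1, i + 1 := \<mu> (i + 1) - 1)
      then qint q (\<mu> (i + 1)) else 0)"
| "site_act q n (Dn i) \<mu>' \<mu> =
     (if \<mu> i \<ge> 1 \<and> \<mu>' = \<mu>(i := \<mu> i - 1, i + 1 := \<mu> (i + 1) + 1)
      then qint q (\<mu> i) else 0)"
| "site_act q n (Ct h) \<mu>' \<mu> = (if \<mu>' = \<mu> then q powi (\<Sum>j=0..n. h j * int (\<mu> j)) else 0)"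

fun counit :: "qgen \<Rightarrow> real" where
  "counit (Up i) = 0"
| "counit (Dn i) = 0"
| "counit (Ct h) = 1"

text \<open>Action on the first \<open>L\<close> tensor factors via the iterated coproduct
  \<open>(\<Delta>\<^sup>(\<^sup>L\<^sup>-\<^sup>2\<^sup>) \<otimes> id) \<Delta>\<close>; for \<open>L = 1\<close> the counit axiom gives back the action on one factor.\<close>

fun act :: "real \<Rightarrow> nat \<Rightarrow> nat \<Rightarrow> qgen \<Rightarrow> opr" where
  "act q n 0 g = (\<lambda>\<xi>' \<xi>. counit g)"
| "act q n (Suc L) g = (\<lambda>\<xi>' \<xi>.
     \<Sum>(a, b)\<leftarrow>coprod g. act q n L a \<xi>' \<xi> * site_act q n b (\<xi>' (Suc L)) (\<xi> (Suc L)))"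

text \<open>\<open>R\<close> is the matrix of a square root, in the subalgebra generated by the \<open>q\<^sup>\<plusminus>\<^sup>E\<^sup>j\<^sup>j\<close>, of
  an element acting by \<open>X\<close>. On the tensor product the elements of this subalgebra are exactly the
  diagonal matrices whose entries depend only on the total number of particles of each species.\<close>

definition cartan_sqrt :: "nat \<Rightarrow> nat \<Rightarrow> (nat \<Rightarrow> nat) \<Rightarrow> opr \<Rightarrow> opr \<Rightarrow> bool" where
  "cartan_sqrt n L \<theta> R X \<longleftrightarrow>
     (\<exists>\<phi>. eq_on (confs n L \<theta>) R (diagm (\<lambda>\<xi>. \<phi> (\<lambda>j. \<Sum>x=1..L. \<xi> x j)))) \<and>
     eq_on (confs n L \<theta>) (R \<star>\<^bsub>confs n L \<theta>\<^esub> R) X"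


section \<open>The symmetry and the diagonal matrices\<close>

text \<open>The parameters \<open>g\<close>, \<open>l\<close> are \<open>\<gamma>\<close>, \<open>\<lambda>\<close>, and the four factors of \<open>U\<^sub>i(\<lambda>)\<close> are
  \<open>R\<close>, a square root of \<open>e(first_arg)\<close>; \<open>e(\<gamma>(1-q\<^sup>2)(q-1/q) E\<^bsub>i+1,i\<^esub> q^(E\<^sub>i\<^sub>i))\<close>;
  \<open>E(-\<lambda> q^(E\<^bsub>i+1,i+1\<^esub>) E\<^bsub>i,i+1\<^esub>)\<close>; and \<open>S\<close>, a square root of \<open>E(last_arg)\<close>.

  Two constants differ from the printed source, which takes \<open>\<lambda> = \<gamma>(1-q\<^sup>2)(q-1/q)\<close> and
  \<open>\<gamma>\<lambda>(1-q\<^sup>2) q^(2E\<^bsub>i+1,i+1\<^esub>)\<close> as the last argument. With \<open>(q\<^sup>2;q\<^sup>2)\<^sub>k\<close> in the denominators of the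
  two exponentials and the given action and \<open>B\<close>, orthogonality then fails already for
  \<open>n = L = \<theta>\<^sup>1 = 1\<close>; it forces the last argument \<open>\<gamma>\<lambda> q^(2E\<^bsub>i+1,i+1\<^esub>)\<close>, as in \<open>last_arg\<close>, and
  \<open>\<lambda> = \<gamma>(1-q\<^sup>2)(q\<^sup>2-1)\<close>, as in \<open>gamma_lambda\<close>.\<close>

definition gamma_lambda :: "real \<Rightarrow> real \<Rightarrow> real \<Rightarrow> bool" where
  "gamma_lambda q g l \<longleftrightarrow> l = g * (1 - q^2) * (q^2 - 1)"

definition first_arg :: "real \<Rightarrow> nat \<Rightarrow> nat \<Rightarrow> real \<Rightarrow> real \<Rightarrow> nat \<Rightarrow> opr" where
  "first_arg q n L g l i = scale (- g * l) (act q n L (Ct (wt i 2)))"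

definition last_arg :: "real \<Rightarrow> nat \<Rightarrow> nat \<Rightarrow> real \<Rightarrow> real \<Rightarrow> nat \<Rightarrow> opr" where
  "last_arg q n L g l i = scale (g * l) (act q n L (Ct (wt (i + 1) 2)))"

definition U_mat ::
  "real \<Rightarrow> nat \<Rightarrow> nat \<Rightarrow> (nat \<Rightarrow> nat) \<Rightarrow> real \<Rightarrow> real \<Rightarrow> opr \<Rightarrow> opr \<Rightarrow> nat \<Rightarrow> opr" where
  "U_mat q n L \<theta> g l R S i =
     (let \<Omega> = confs n L \<theta> in
      R
      \<star>\<^bsub>\<Omega>\<^esub> e_exp q \<Omega> (scale (g * (1 - q^2) * (q - inverse q))
                       (act q n L (Dn i) \<star>\<^bsub>\<Omega>\<^esub> act q n L (Ct (wt i 1))))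
      \<star>\<^bsub>\<Omega>\<^esub> E_exp q \<Omega> (scale (- l) (act q n L (Ct (wt (i + 1) 1)) \<star>\<^bsub>\<Omega>\<^esub> act q n L (Up i)))
      \<star>\<^bsub>\<Omega>\<^esub> S)"

text \<open>\<open>U_prod \<dots> k\<close> is \<open>U\<^bsub>k-1\<^esub>(\<lambda>\<^bsub>k-1\<^esub>) \<cdots> U\<^sub>0(\<lambda>\<^sub>0)\<close>.\<close>

primrec U_prod ::
  "real \<Rightarrow> nat \<Rightarrow> nat \<Rightarrow> (nat \<Rightarrow> nat) \<Rightarrow> (nat \<Rightarrow> real) \<Rightarrow> (nat \<Rightarrow> real) \<Rightarrow>
     (nat \<Rightarrow> opr) \<Rightarrow> (nat \<Rightarrow> opr) \<Rightarrow> nat \<Rightarrow> opr" where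
  "U_prod q n L \<theta> g l R S 0 = diagm (\<lambda>_. 1)"
| "U_prod q n L \<theta> g l R S (Suc i) =
     U_mat q n L \<theta> (g i) (l i) (R i) (S i) i \<star>\<^bsub>confs n L \<theta>\<^esub> U_prod q n L \<theta> g l R S i"

definition Gd :: "real \<Rightarrow> nat \<Rightarrow> nat \<Rightarrow> conf \<Rightarrow> real" where
  "Gd q n L \<xi> =
     (\<Prod>i=0..n. \<Prod>x=1..L. 1 / qfact q (\<xi> x i)) *
     (\<Prod>(y, x)\<in>{(y, x). 1 \<le> y \<and> y < x \<and> x \<le> L}.
        \<Prod>i<n. q powi (- int (\<xi> y (i + 1) * (\<Sum>j=0..i. \<xi> x j))))"

definition Bd :: "real \<Rightarrow> nat \<Rightarrow> nat \<Rightarrow> conf \<Rightarrow> real" where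
  "Bd q n L \<xi> = (\<Prod>x=1..L. 1 / sqrt (\<Prod>i=0..n. cfact q (\<xi> x i)))"

end

theory Submission
  imports Defs
begin

text \<open>
  Put \<open>A = q\<^bsup>E(i+1,i+1)\<^esup> E(i,i+1)\<close>. Its adjoint for the weight \<open>B\<^sup>2\<close> is \<open>A* = q\<^bsup>-1\<^esup> E(i+1,i) q\<^bsup>E(i,i)\<^esup>\<close>,
  so that \<open>U\<^sub>i = R e(\<lambda>A*) E(-\<lambda>A) S\<close>, where \<open>R\<^sup>2\<close> and \<open>S\<^sup>2\<close> are \<open>1/\<phi>(N\<^sub>i)\<close> and \<open>\<phi>(N\<^bsub>i+1\<^esub>)\<close> with
  \<open>\<phi>(m) = E(\<gamma>\<lambda>q\<^bsup>2m\<^esup>)\<close> and \<open>N\<^sub>j\<close> the total number of particles of species \<open>j\<close>. Orthogonality of \<open>U\<^sub>i\<close>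
  reduces to \<open>e(\<lambda>A*) E(-\<lambda>A) \<phi>(N\<^bsub>i+1\<^esub>) = \<phi>(N\<^sub>i) E(-\<lambda>A) e(\<lambda>A*)\<close>. Rescaling the arguments of \<open>E\<close> by \<open>t\<close>,
  both \<open>E(-t\<lambda>A) \<phi>\<^sub>t(N\<^bsub>i+1\<^esub>)\<close> and \<open>\<phi>\<^sub>t(N\<^sub>i) E(-t\<lambda>A)\<close> solve a first-order \<open>q\<close>-difference equation in \<open>t\<close>,
  and \<open>e(\<lambda>A*)\<close> intertwines the coefficients of the two equations because
  \<open>[A, A*] = (q\<^bsup>2N(i+1)\<^esup> - q\<^bsup>2N(i)\<^esup>) / (1 - q\<^sup>2)\<close>; the identity follows on letting \<open>t\<close> tend to 0.

  Self-duality means that \<open>G \<L> G\<^bsup>-1\<^esup>\<close> commutes with \<open>U\<close>. By reversibility \<open>G \<L> G\<^bsup>-1\<^esup>\<close> is self-adjoint, so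
  it suffices that it commutes with \<open>A\<close>. Now \<open>G\<^bsup>-1\<^esup> A G\<close> turns a particle of species \<open>i\<close> into one of species
  \<open>i + 1\<close> at some site, and each bond generator is, up to constants, a product of two operators that move
  one particle of any species across the bond (the other half of the Howe dual pair). These operations
  act on the columns and the rows of the array \<open>\<xi>\<close> and commute.
\<close>

section \<open>The two q-exponentials of nilpotent elements\<close>

text \<open>Two obstacles shape the proof. The function \<phi> is an infinite product, not a
  polynomial in a nilpotent element, so the identity for one factor of U cannot be a purely formal
  one; the family indexed by s, with t = q^(2s), keeps each step algebraic and leaves only the limit
  to analysis. Moreover \<gamma>\<lambda> = -\<gamma>^2 (1 - q^2)^2 is never positive, so a factor 1
  + \<gamma>\<lambda> q^(2m + 2j) of \<phi>(m) might vanish; the bound |\<gamma>\<lambda>| < 1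
  excludes this and makes the Cartan series e converge to 1/\<phi>. The signs of the square roots
  are never determined: R and S enter only through their squares and through being functions of the
  species totals, which the dynamics conserves. The identities between q-exponentials are proved in
  an arbitrary \<open>real_algebra_1\<close> and then read in an algebra of matrices. The time
  evolution is handled from the semigroup property and the derivative at time 0 alone, without the
  exponential of the generator.\<close>

lemma qpoch_0 [simp]: "qpoch a b 0 = 1"
  by (simp add: qpoch_def)

lemma qpoch_Suc: "qpoch (q^2) (q^2) (Suc k) = qpoch (q^2) (q^2) k * (1 - q ^ (2 * Suc k))"
  by (simp add: qpoch_def power_mult power2_eq_square)

lemma power_less_1:
  fixes q :: real
  assumes "0 < q" "q < 1" "k > 0"
  shows "q ^ k < 1"
  using assms by (simp add: power_less_one_iff)

lemma qpoch_pos: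
  assumes "0 < q" "q < 1"
  shows "qpoch (q^2) (q^2) k > 0"
  by (induction k) (use assms in \<open>auto simp: qpoch_Suc power_less_one_iff simp del: power_Suc mult_Suc_right\<close>)

definition e_coeff :: "real \<Rightarrow> nat \<Rightarrow> real" where
  "e_coeff q k = 1 / qpoch (q^2) (q^2) k"

definition E_coeff :: "real \<Rightarrow> nat \<Rightarrow> real" where
  "E_coeff q k = q ^ (k * (k - 1)) / qpoch (q^2) (q^2) k"

text \<open>Truncated, so that the exponentials make sense in any \<open>real_algebra_1\<close>
  without a topology. Wherever an identity of the exponentials is claimed, N is a nilpotency
  exponent and nothing is cut off.\<close>

definition e_poly :: "real \<Rightarrow> nat \<Rightarrow> 'a::real_algebra_1 \<Rightarrow> 'a" where
  "e_poly q N x = (\<Sum>k<N. e_coeff q k *\<^sub>R x ^ k)"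

definition E_poly :: "real \<Rightarrow> nat \<Rightarrow> 'a::real_algebra_1 \<Rightarrow> 'a" where
  "E_poly q N x = (\<Sum>k<N. E_coeff q k *\<^sub>R x ^ k)"

lemma e_coeff_0 [simp]: "e_coeff q 0 = 1" and E_coeff_0 [simp]: "E_coeff q 0 = 1"
  by (simp_all add: e_coeff_def E_coeff_def)

lemma one_minus_power_neq_0:
  fixes q :: real
  assumes "0 < q" "q < 1" "k > 0"
  shows "1 - q ^ k \<noteq> 0"
  using power_less_1[OF assms] by simp

lemma e_coeff_Suc:
  assumes "0 < q" "q < 1"
  shows "e_coeff q (Suc k) * (1 - q ^ (2 * Suc k)) = e_coeff q k"
  using qpoch_pos[OF assms, of k] one_minus_power_neq_0[OF assms, of "2 * Suc k"]
  by (simp add: e_coeff_def qpoch_Suc del: mult_Suc_right power_Suc)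

lemma E_coeff_Suc:
  assumes "0 < q" "q < 1"
  shows "E_coeff q (Suc k) * (1 - q ^ (2 * Suc k)) = q ^ (2 * k) * E_coeff q k"
proof -
  have "Suc k * k = 2 * k + k * (k - 1)"
    by (cases k) auto
  then have "q ^ (Suc k * (Suc k - 1)) = q ^ (2 * k) * q ^ (k * (k - 1))"
    by (metis diff_Suc_1 power_add)
  then show ?thesis
    using qpoch_pos[OF assms, of k] one_minus_power_neq_0[OF assms, of "2 * Suc k"]
    by (simp add: E_coeff_def qpoch_Suc del: mult_Suc_right power_Suc mult_Suc)
qed

text \<open>After multiplication by 1 - q^(2k) the summand is a difference, which gives a closed
  form for every proper partial sum and hence an induction on m. The full sum, m = k, has no such
  form but is one cancelling term away.\<close>

lemma q_binomial_partial_sum: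
  assumes "0 < q" "q < 1" "m < k"
  shows "(1 - q ^ (2 * k)) * (\<Sum>j\<le>m. (-1) ^ j * E_coeff q j * e_coeff q (k - j))
           = (-1) ^ m * q ^ (2 * m) * E_coeff q m * e_coeff q (k - 1 - m)"
  using \<open>m < k\<close>
proof (induction m)
  case 0
  then show ?case
    using e_coeff_Suc[OF assms(1,2), of "k - 1"] by (simp add: mult.commute)
next
  case (Suc m)
  then obtain d where k: "k = m + 2 + d"
    by (metis Suc_leI add_2_eq_Suc' less_iff_Suc_add nat_less_le add_Suc add_Suc_right)
  have 1: "e_coeff q (k - 1 - m) = e_coeff q (Suc d)"
    and 2: "e_coeff q (k - Suc m) = e_coeff q (Suc d)"
    and 3: "e_coeff q (k - 1 - Suc m) = e_coeff q d"
    using k by auto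
  have E: "q ^ (2 * m) * E_coeff q m = E_coeff q (Suc m) * (1 - q ^ (2 * Suc m))"
    using E_coeff_Suc[OF assms(1,2), of m] by simp
  have e: "e_coeff q d = e_coeff q (Suc d) * (1 - q ^ (2 * Suc d))"
    using e_coeff_Suc[OF assms(1,2), of d] by simp
  have pw: "q ^ (2 * k) = q ^ (2 * Suc m) * q ^ (2 * Suc d)"
    using k by (simp flip: power_add)
  have "(1 - q ^ (2 * k)) * (\<Sum>j\<le>Suc m. (-1) ^ j * E_coeff q j * e_coeff q (k - j))
      = (-1) ^ m * (q ^ (2 * m) * E_coeff q m) * e_coeff q (Suc d)
        + (1 - q ^ (2 * k)) * ((-1) ^ Suc m * E_coeff q (Suc m) * e_coeff q (Suc d))"
    using Suc.IH Suc.prems unfolding sum.atMost_Suc distrib_left 2 1 by simp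
  also have "\<dots> = (-1) ^ Suc m * q ^ (2 * Suc m) * E_coeff q (Suc m) * (e_coeff q (Suc d) * (1 - q ^ (2 * Suc d)))"
    unfolding E pw by (simp add: algebra_simps del: mult_Suc_right)
  also have "\<dots> = (-1) ^ Suc m * q ^ (2 * Suc m) * E_coeff q (Suc m) * e_coeff q d"
    using e by simp
  finally show ?case unfolding 3 .
qed

text \<open>The coefficient of z^k in E(-z) e(z). The last term j = k cancels the partial sum up to
  k - 1 by the recursion of \<open>E_coeff\<close>.\<close>

lemma q_binomial_alternating_sum:
  assumes "0 < q" "q < 1"
  shows "(\<Sum>j\<le>k. (-1) ^ j * E_coeff q j * e_coeff q (k - j)) = (if k = 0 then 1 else 0)"
proof (cases k)
  case (Suc m)
  have "(1 - q ^ (2 * k)) * (\<Sum>j\<le>k. (-1) ^ j * E_coeff q j * e_coeff q (k - j))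
      = (-1) ^ m * (q ^ (2 * m) * E_coeff q m) + (1 - q ^ (2 * Suc m)) * ((-1) ^ Suc m * E_coeff q (Suc m))"
    using q_binomial_partial_sum[OF assms, of m k] Suc
    unfolding Suc sum.atMost_Suc distrib_left by simp
  also have "\<dots> = 0"
    unfolding E_coeff_Suc[OF assms, symmetric] by (simp add: algebra_simps)
  finally show ?thesis
    using one_minus_power_neq_0[OF assms, of "2 * k"] Suc by simp
qed simp

section \<open>Truncated power series in a nilpotent element\<close>

lemma scaleR_power:
  fixes x :: "'a::real_algebra_1"
  shows "(c *\<^sub>R x) ^ k = c ^ k *\<^sub>R x ^ k"
  by (induction k) (simp_all add: mult.commute)

lemma nilpotent_power_eq_0:
  fixes x :: "'a::real_algebra_1"
  assumes "x ^ N = 0" "N \<le> k"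
  shows "x ^ k = 0"
  using assms by (metis le_add_diff_inverse mult_zero_left power_add)

lemma nilpotent_poly_mult:
  fixes x :: "'a::real_algebra_1"
  assumes "x ^ N = 0"
  shows "(\<Sum>i<N. a i *\<^sub>R x ^ i) * (\<Sum>j<N. b j *\<^sub>R x ^ j) = (\<Sum>k<N. (\<Sum>j\<le>k. b j * a (k - j)) *\<^sub>R x ^ k)"
proof -
  have "(\<Sum>i<N. a i *\<^sub>R x ^ i) * (\<Sum>j<N. b j *\<^sub>R x ^ j)
      = (\<Sum>j<N. \<Sum>i<N. (b j * a i) *\<^sub>R x ^ (i + j))"
    by (subst sum.swap) (simp add: sum_product power_add mult.commute)
  \<comment> \<open>Terms of degree i + j \<ge> N vanish, which cuts the square of indices down to a
    triangle.\<close>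
  also have "\<dots> = (\<Sum>j<N. \<Sum>i<N - j. (b j * a i) *\<^sub>R x ^ (i + j))"
    by (intro sum.cong refl sum.mono_neutral_right)
       (auto intro!: nilpotent_power_eq_0[OF assms])
  also have "\<dots> = (\<Sum>(j,i)\<in>{(j,i). j + i < N}. (b j * a i) *\<^sub>R x ^ (i + j))"
    by (subst sum.Sigma) (auto intro!: sum.cong)
  also have "\<dots> = (\<Sum>k<N. \<Sum>j\<le>k. (b j * a (k - j)) *\<^sub>R x ^ (k - j + j))"
    by (rule sum.triangle_reindex)
  finally show ?thesis
    by (simp add: scaleR_sum_left)
qed

context
  fixes q :: real and N :: nat
  assumes q: "0 < q" "q < 1"
begin

lemma e_poly_mult_E_poly:
  fixes x :: "'a::real_algebra_1"
  assumes "x ^ N = 0"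
  shows "e_poly q N x * E_poly q N (- x) = 1" "E_poly q N (- x) * e_poly q N x = 1"
proof -
  have N: "N > 0"
    using assms by (cases N) auto
  have E: "E_poly q N (- x) = (\<Sum>j<N. ((-1) ^ j * E_coeff q j) *\<^sub>R x ^ j)"
    unfolding E_poly_def by (intro sum.cong refl) (metis (no_types) scaleR_power scaleR_minus1_left scaleR_scaleR mult.commute)
  have one: "(\<Sum>k<N. (if k = 0 then 1 else 0) *\<^sub>R x ^ k) = 1"
    using N by (simp add: if_distrib[of "\<lambda>c. c *\<^sub>R _"] cong: if_cong)
  show "e_poly q N x * E_poly q N (- x) = 1"
    unfolding E e_poly_def nilpotent_poly_mult[OF assms]
    using q_binomial_alternating_sum[OF q] one by simp
  have "(\<Sum>j\<le>k. e_coeff q j * ((-1) ^ (k - j) * E_coeff q (k - j))) =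
      (\<Sum>j\<le>k. (-1) ^ j * E_coeff q j * e_coeff q (k - j))" for k
    by (rule sum.reindex_bij_witness[of _ "\<lambda>j. k - j" "\<lambda>j. k - j"]) (auto simp: mult_ac)
  then show "E_poly q N (- x) * e_poly q N x = 1"
    unfolding E e_poly_def nilpotent_poly_mult[OF assms]
    using q_binomial_alternating_sum[OF q] one by simp
qed

text \<open>The first-order q-difference equation of E. It survives truncation because the one
  additional term, of degree N, is a multiple of x^N = 0.\<close>

lemma E_poly_step:
  fixes x :: "'a::real_algebra_1"
  assumes "x ^ N = 0"
  shows "E_poly q N x = (1 + x) * E_poly q N (q^2 *\<^sub>R x)"
proof -
  obtain M where M: "N = Suc M"
    using assms by (cases N) auto
  have "E_poly q N x - E_poly q N (q^2 *\<^sub>R x) = (\<Sum>k<N. (E_coeff q k * (1 - q ^ (2 * k))) *\<^sub>R x ^ k)"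
    by (simp add: E_poly_def scaleR_power algebra_simps flip: sum_subtractf power_mult)
  also have "\<dots> = (\<Sum>k<M. (E_coeff q (Suc k) * (1 - q ^ (2 * Suc k))) *\<^sub>R x ^ Suc k)"
    unfolding M sum.lessThan_Suc_shift by simp
  also have "\<dots> = (\<Sum>k<M. (q ^ (2 * k) * E_coeff q k) *\<^sub>R x ^ Suc k)"
    unfolding E_coeff_Suc[OF q] ..
  also have "\<dots> = (\<Sum>k<N. (q ^ (2 * k) * E_coeff q k) *\<^sub>R x ^ Suc k)"
    using assms unfolding M sum.lessThan_Suc by simp
  also have "\<dots> = x * E_poly q N (q^2 *\<^sub>R x)"
    by (simp add: E_poly_def scaleR_power sum_distrib_left mult.commute flip: power_mult)
  finally show ?thesis
    by (simp add: algebra_simps)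
qed

text \<open>In the m + 1 single commutators every k is moved to the right of the powers of b and
  every k' to the left. Both collect the same geometric sum in q^2, which is the source of the
  second factor 1 - q^2 in the denominator.\<close>

lemma power_commutator:
  fixes a b k k' :: "'a::real_algebra_1"
  assumes comm: "a * b - b * a = (1 / (1 - q^2)) *\<^sub>R (k - k')"
    and k: "k * b = q^2 *\<^sub>R (b * k)" and k': "b * k' = q^2 *\<^sub>R (k' * b)"
  shows "a * b ^ Suc m - b ^ Suc m * a = ((1 - q ^ (2 * Suc m)) / (1 - q^2)^2) *\<^sub>R (b ^ m * k - k' * b ^ m)"
proof -
  have q2: "1 - q^2 \<noteq> 0"
    using one_minus_power_neq_0[OF q, of 2] by simp
  have k'm: "b ^ m * k' = q ^ (2 * m) *\<^sub>R (k' * b ^ m)" for m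
  proof (induction m)
    case (Suc m)
    have "b ^ Suc m * k' = b * (b ^ m * k')"
      by (simp add: mult.assoc)
    also have "\<dots> = q ^ (2 * m) *\<^sub>R (b * k' * b ^ m)"
      using Suc by (simp add: mult.assoc)
    also have "\<dots> = q ^ (2 * Suc m) *\<^sub>R (k' * b ^ Suc m)"
      by (simp add: k' mult.assoc power2_eq_square)
    finally show ?case .
  qed simp
  show ?thesis
  proof (induction m)
    case 0
    show ?case
      using comm q2 by (simp add: power2_eq_square)
  next
    case (Suc m)
    define c where "c = (1 - q ^ (2 * Suc m)) / (1 - q^2)^2"
    define d where "d = 1 / (1 - q^2)"
    \<comment> \<open>The coefficients of k and of k' obey different recursions that lead to the
      same closed form.\<close>
    have c: "c * q^2 + d = (1 - q ^ (2 * Suc (Suc m))) / (1 - q^2)^2"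
      and c2: "c + d * q ^ (2 * Suc m) = (1 - q ^ (2 * Suc (Suc m))) / (1 - q^2)^2"
      using q2 unfolding c_def d_def by (simp_all add: divide_simps power2_eq_square) algebra+
    have "a * b ^ Suc (Suc m) - b ^ Suc (Suc m) * a
        = (a * b ^ Suc m - b ^ Suc m * a) * b + b ^ Suc m * (a * b - b * a)"
      by (simp only: power_Suc2[of b "Suc m"]) (simp only: algebra_simps)
    also have "\<dots> = c *\<^sub>R ((b ^ m * k - k' * b ^ m) * b) + d *\<^sub>R (b ^ Suc m * (k - k'))"
      unfolding Suc.IH comm c_def d_def by simp
    also have "\<dots> = (c * q^2 + d) *\<^sub>R (b ^ Suc m * k) - (c + d * q ^ (2 * Suc m)) *\<^sub>R (k' * b ^ Suc m)"
      by (simp add: left_diff_distrib right_diff_distrib k'm[of "Suc m", unfolded power_Suc2[of b] mult.assoc] mult.assoc scaleR_right_diff_distrib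
          scaleR_left_distrib k power_Suc2 del: power_Suc mult_Suc_right)
    finally show ?case
      unfolding c c2 by (simp only: scaleR_diff_right)
  qed
qed

text \<open>The factor 1 - q^(2(m+1)) of \<open>power_commutator\<close> is exactly what lowers the
  index of \<open>e_coeff\<close>. One power of l is left over and has to equal -g (1 - q^2)^2; this
  is the origin of the relation between \<gamma> and \<lambda>.\<close>

lemma e_poly_intertwines:
  fixes a b k k' :: "'a::real_algebra_1"
  assumes comm: "a * b - b * a = (1 / (1 - q^2)) *\<^sub>R (k - k')"
    and k: "k * b = q^2 *\<^sub>R (b * k)" and k': "b * k' = q^2 *\<^sub>R (k' * b)"
    and b: "b ^ N = 0" and l: "l = - (g * (1 - q^2)^2)"
  shows "e_poly q N (l *\<^sub>R b) * ((g * l) *\<^sub>R k - l *\<^sub>R a) = ((g * l) *\<^sub>R k' - l *\<^sub>R a) * e_poly q N (l *\<^sub>R b)"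
proof -
  have q2: "1 - q^2 \<noteq> 0"
    using one_minus_power_neq_0[OF q, of 2] by simp
  obtain M where M: "N = Suc M"
    using b by (cases N) auto
  let ?e = "e_poly q N (l *\<^sub>R b)"
  have c: "e_coeff q (Suc m) * l ^ Suc m * ((1 - q ^ (2 * Suc m)) / (1 - q^2)^2) = - g * (e_coeff q m * l ^ m)" for m
  proof -
    have "e_coeff q (Suc m) * l ^ Suc m * ((1 - q ^ (2 * Suc m)) / (1 - q^2)^2)
        = (e_coeff q (Suc m) * (1 - q ^ (2 * Suc m))) * l ^ m * (l / (1 - q^2)^2)"
      by simp
    also have "\<dots> = e_coeff q m * l ^ m * (l / (1 - q^2)^2)"
      unfolding e_coeff_Suc[OF q] ..
    finally show ?thesis
      using q2 by (simp add: l)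
  qed
  have "a * ?e - ?e * a = (\<Sum>m<N. (e_coeff q m * l ^ m) *\<^sub>R (a * b ^ m - b ^ m * a))"
    by (simp add: e_poly_def scaleR_power sum_distrib_left sum_distrib_right scaleR_diff_right sum_subtractf)
  \<comment> \<open>The added term m = N vanishes because b^N = 0; the shift of the index then drops
    m = 0, whose commutator is zero.\<close>
  also have "\<dots> = (\<Sum>m<Suc N. (e_coeff q m * l ^ m) *\<^sub>R (a * b ^ m - b ^ m * a))"
    using b by simp
  also have "\<dots> = (\<Sum>m<N. (e_coeff q (Suc m) * l ^ Suc m) *\<^sub>R (a * b ^ Suc m - b ^ Suc m * a))"
    unfolding sum.lessThan_Suc_shift by simp
  also have "\<dots> = (\<Sum>m<N. (- g * (e_coeff q m * l ^ m)) *\<^sub>R (b ^ m * k - k' * b ^ m))"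
    unfolding power_commutator[OF comm k k'] scaleR_scaleR c ..
  also have "\<dots> = g *\<^sub>R (k' * ?e - ?e * k)"
    by (simp add: e_poly_def scaleR_power sum_distrib_left sum_distrib_right scaleR_sum_right
        scaleR_diff_right flip: sum_subtractf)
  finally have "l *\<^sub>R (a * ?e - ?e * a) = (g * l) *\<^sub>R (k' * ?e - ?e * k)"
    by (simp add: mult.commute)
  then show ?thesis
    by (simp add: algebra_simps)
qed

text \<open>\<open>E\<^sub>t f\<^sub>t\<close> and \<open>f'\<^sub>t E\<^sub>t\<close> with \<open>E\<^sub>t = E(-t\<lambda>a)\<close>, \<open>t = q\<^sup>2\<^sup>s\<close>, both satisfy the first-order
  \<open>q\<close>-difference equation whose coefficients \<open>e(\<lambda>b)\<close> intertwines; hence the displayed quotient is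
  constant in \<open>s\<close>, and its limit is \<open>e(\<lambda>b)\<close>.\<close>

lemma E_quotient_constant:
  fixes a e c c' k k' :: "'a::real_algebra_1" and f f' g' :: "nat \<Rightarrow> 'a"
  assumes a: "a ^ N = 0"
    and ka: "a * k = q^2 *\<^sub>R (k * a)"
    and f: "\<And>s. f s = (1 + (q ^ (2 * s) * m) *\<^sub>R k) * f (Suc s)"
    and f': "\<And>s. f' s = (1 + (q ^ (2 * s) * m) *\<^sub>R k') * f' (Suc s)"
    and f'a: "\<And>s. a * f' (Suc s) = f' s * a"
    and inv: "\<And>s. g' s * f' s = 1" "\<And>s. f' s * g' s = 1"
    and e: "e * (m *\<^sub>R k - l *\<^sub>R a) = (m *\<^sub>R k' - l *\<^sub>R a) * e"
  defines "X \<equiv> \<lambda>s. e_poly q N ((q ^ (2 * s) * l) *\<^sub>R a) * g' s * e * E_poly q N (- ((q ^ (2 * s) * l) *\<^sub>R a)) * f s"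
  shows "X s = X 0"
proof -
  define x where "x s = (q ^ (2 * s) * l) *\<^sub>R a" for s
  define E where "E s = E_poly q N (- x s)" for s
  define F where "F s = e_poly q N (x s)" for s
  have nil: "x s ^ N = 0" "(- x s) ^ N = 0" for s
    using a by (simp_all add: x_def scaleR_power power_minus[of "(q ^ (2 * s) * l) *\<^sub>R a"])
  have FE: "F s * E s = 1" for s
    unfolding F_def E_def by (rule e_poly_mult_E_poly(1)[OF nil(1)])
  have E_step: "E s = (1 - x s) * E (Suc s)" for s
  proof -
    have "q^2 *\<^sub>R - x s = - x (Suc s)"
      by (simp add: x_def power2_eq_square)
    then show ?thesis
      unfolding E_def using E_poly_step[OF nil(2)[of s]] by simp
  qed
  \<comment> \<open>Moving k past a rescales a by q^2, that is, moves the argument of E by one step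
    in s.\<close>
  have ka_power: "k * (q^2 *\<^sub>R a) ^ j = a ^ j * k" for j
  proof (induction j)
    case (Suc j)
    have "k * (q^2 *\<^sub>R a) ^ Suc j = (k * (q^2 *\<^sub>R a) ^ j) * (q^2 *\<^sub>R a)"
      by (simp only: power_Suc2 mult.assoc)
    also have "\<dots> = a ^ j * (q^2 *\<^sub>R (k * a))"
      unfolding Suc.IH by (simp add: mult.assoc)
    also have "\<dots> = a ^ Suc j * k"
      by (simp only: ka[symmetric] power_Suc2 mult.assoc)
    finally show ?case .
  qed simp
  have kE: "k * E (Suc s) = E s * k" for s
  proof -
    have 1: "- x (Suc s) = (- (q ^ (2 * s) * l)) *\<^sub>R (q^2 *\<^sub>R a)" and 2: "- x s = (- (q ^ (2 * s) * l)) *\<^sub>R a"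
      by (simp_all add: x_def power2_eq_square)
    show ?thesis
      unfolding E_def E_poly_def 1 2 sum_distrib_left sum_distrib_right
      by (intro sum.cong refl) (simp only: scaleR_power[of "- (q ^ (2 * s) * l)"] mult_scaleR_right mult_scaleR_left ka_power)
  qed
  define C where "C s = 1 + q ^ (2 * s) *\<^sub>R (m *\<^sub>R k - l *\<^sub>R a)" for s
  define C' where "C' s = 1 + q ^ (2 * s) *\<^sub>R (m *\<^sub>R k' - l *\<^sub>R a)" for s
  \<comment> \<open>The factor split off from \<open>f s\<close> lies to the right of
    \<open>E s\<close>; carrying k to the left by \<open>kE\<close> turns \<open>E s\<close> into
    \<open>E (Suc s)\<close>, so that both summands end in the same product.\<close>
  have CE: "C s * (E (Suc s) * f (Suc s)) = E s * f s" for s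
  proof -
    have "E s * f s = E s * f (Suc s) + (q ^ (2 * s) * m) *\<^sub>R (E s * k * f (Suc s))"
      unfolding f[of s] by (simp add: algebra_simps)
    also have "\<dots> = (1 - x s) * E (Suc s) * f (Suc s) + (q ^ (2 * s) * m) *\<^sub>R (k * E (Suc s) * f (Suc s))"
      unfolding kE[symmetric] by (subst E_step) (rule refl)
    finally show ?thesis
      by (simp add: C_def x_def algebra_simps)
  qed
  have CE': "C' s * (f' (Suc s) * E (Suc s)) = f' s * E s" for s
  proof -
    have "f' s * E s = f' s * E (Suc s) - (q ^ (2 * s) * l) *\<^sub>R (f' s * a * E (Suc s))"
      unfolding E_step[of s] by (simp add: x_def algebra_simps)
    also have "\<dots> = (1 + (q ^ (2 * s) * m) *\<^sub>R k') * f' (Suc s) * E (Suc s) - (q ^ (2 * s) * l) *\<^sub>R (a * f' (Suc s) * E (Suc s))"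
      unfolding f'a[symmetric] by (subst f'[of s]) (rule refl)
    finally show ?thesis
      by (simp add: C'_def algebra_simps)
  qed
  have eC: "e * C s = C' s * e" for s
    unfolding C_def C'_def using e by (simp add: distrib_left distrib_right)
  have X: "X s = F s * g' s * e * E s * f s" for s
    by (simp add: X_def F_def E_def x_def)
  have EF: "E s * F s = 1" for s
    unfolding F_def E_def by (rule e_poly_mult_E_poly(2)[OF nil(1)])
  have "X s = X (Suc s)" for s
  proof -
    \<comment> \<open>A factor 1 = f' E F g' at index s + 1 is inserted, so that \<open>CE'\<close>
      can absorb \<open>C' s\<close>.\<close>
    have "F s * g' s * C' s = F s * g' s * C' s * (f' (Suc s) * (E (Suc s) * F (Suc s)) * g' (Suc s))"
      by (simp add: EF inv)
    also have "\<dots> = F s * g' s * (C' s * (f' (Suc s) * E (Suc s))) * F (Suc s) * g' (Suc s)"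
      by (simp add: mult.assoc)
    also have "\<dots> = F s * (g' s * f' s) * E s * F (Suc s) * g' (Suc s)"
      by (simp add: CE' mult.assoc)
    finally have *: "F s * g' s * C' s = F (Suc s) * g' (Suc s)"
      by (simp add: inv FE)
    have "X s = F s * g' s * (e * (E s * f s))"
      by (simp add: X mult.assoc)
    also have "\<dots> = (F s * g' s * C' s) * e * (E (Suc s) * f (Suc s))"
      by (simp only: CE[symmetric, of s] mult.assoc[of _ "C' s" e] eC[of s, symmetric] mult.assoc)
    also have "\<dots> = X (Suc s)"
      unfolding * X by (simp only: mult.assoc)
    finally show ?thesis .
  qed
  then show ?thesis
    by (induction s) auto
qed

end

section \<open>The q-exponential functions\<close>

text \<open>The Cartan arguments act diagonally but are not nilpotent, so their exponentials are
  genuine series in each diagonal entry.\<close>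

definition E_fun :: "real \<Rightarrow> real \<Rightarrow> real" where
  "E_fun q z = (\<Sum>k. E_coeff q k * z ^ k)"

definition e_fun :: "real \<Rightarrow> real \<Rightarrow> real" where
  "e_fun q z = (\<Sum>k. e_coeff q k * z ^ k)"

context
  fixes q :: real
  assumes q: "0 < q" "q < 1"
begin

lemma coeff_pos: "e_coeff q k > 0" "E_coeff q k > 0"
  using q by (simp_all add: e_coeff_def E_coeff_def qpoch_pos)

lemma q_power_tendsto_0: "(\<lambda>k. q ^ (2 * k)) \<longlonglongrightarrow> 0"
proof -
  have "(\<lambda>k. (q^2) ^ k) \<longlonglongrightarrow> 0"
    using q by (intro LIMSEQ_power_zero) (simp add: power_less_one_iff abs_if)
  then show ?thesis by (simp add: power_mult)
qed

text \<open>The ratio of consecutive terms carries the factor q^(2k) and tends to 0, so E is entire;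
  for e below the ratio tends to |z| instead.\<close>

lemma E_coeff_abs_summable: "summable (\<lambda>k. norm (E_coeff q k * z ^ k))"
proof -
  have q2: "1 - q^2 > 0"
    using power_less_1[OF q, of 2] by simp
  have "(\<lambda>k. q ^ (2 * k) * (norm z / (1 - q^2))) \<longlonglongrightarrow> 0 * (norm z / (1 - q^2))"
    by (intro tendsto_intros q_power_tendsto_0)
  then have "\<forall>\<^sub>F k in sequentially. q ^ (2 * k) * (norm z / (1 - q^2)) < 1/2"
    by (intro order_tendstoD(2)) auto
  then obtain K where K: "\<And>k. k \<ge> K \<Longrightarrow> q ^ (2 * k) * (norm z / (1 - q^2)) < 1/2"
    by (auto simp: eventually_sequentially)
  show ?thesis
  proof (rule summable_ratio_test[of "1/2" K])
    fix k assume "k \<ge> K"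
    have "q ^ (2 * Suc k) \<le> q^2"
      using q by (intro power_decreasing) auto
    then have d: "1 - q ^ (2 * Suc k) \<ge> 1 - q^2" by simp
    have "E_coeff q (Suc k) * (1 - q^2) \<le> E_coeff q (Suc k) * (1 - q ^ (2 * Suc k))"
      using d coeff_pos(2)[of "Suc k"] by (intro mult_left_mono) auto
    then have "E_coeff q (Suc k) \<le> q ^ (2 * k) * E_coeff q k / (1 - q^2)"
      unfolding E_coeff_Suc[OF q] using q2 by (simp add: field_simps)
    then have "E_coeff q (Suc k) * (norm z * norm z ^ k) \<le> q ^ (2 * k) * E_coeff q k / (1 - q^2) * (norm z * norm z ^ k)"
      by (intro mult_right_mono) auto
    also have "\<dots> = (q ^ (2 * k) * (norm z / (1 - q^2))) * (E_coeff q k * norm z ^ k)"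
      by simp
    also have "\<dots> \<le> 1/2 * (E_coeff q k * norm z ^ k)"
      using K[OF \<open>k \<ge> K\<close>] coeff_pos(2)[of k] by (intro mult_right_mono) auto
    finally show "norm (norm (E_coeff q (Suc k) * z ^ Suc k)) \<le> 1/2 * norm (norm (E_coeff q k * z ^ k))"
      using coeff_pos(2)[of k] coeff_pos(2)[of "Suc k"] by (simp add: abs_mult power_abs)
  qed simp
qed

lemma e_coeff_abs_summable:
  assumes "\<bar>z\<bar> < 1"
  shows "summable (\<lambda>k. norm (e_coeff q k * z ^ k))"
proof -
  have "(\<lambda>k. (1 - q ^ (2 * k))) \<longlonglongrightarrow> 1 - 0"
    by (intro tendsto_intros q_power_tendsto_0)
  \<comment> \<open>The bound 2|z| / (1 + |z|) is chosen so that the ratio |z| / (1 - q^(2k)) falls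
    below (1 + |z|) / 2, which is less than 1.\<close>
  then have "\<forall>\<^sub>F k in sequentially. 1 - q ^ (2 * k) > 2 * \<bar>z\<bar> / (1 + \<bar>z\<bar>)"
    using assms by (intro order_tendstoD(1)) (auto simp: divide_less_eq)
  then obtain K where K: "\<And>k. k \<ge> K \<Longrightarrow> 1 - q ^ (2 * k) > 2 * \<bar>z\<bar> / (1 + \<bar>z\<bar>)"
    by (auto simp: eventually_sequentially)
  show ?thesis
  proof (rule summable_ratio_test[of "(1 + \<bar>z\<bar>) / 2" K])
    fix k assume "k \<ge> K"
    then have "1 - q ^ (2 * Suc k) > 2 * \<bar>z\<bar> / (1 + \<bar>z\<bar>)"
      by (intro K) auto
    then have "2 * \<bar>z\<bar> < (1 - q ^ (2 * Suc k)) * (1 + \<bar>z\<bar>)"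
      by (subst (asm) pos_divide_less_eq) auto
    then have "\<bar>z\<bar> \<le> (1 + \<bar>z\<bar>) / 2 * (1 - q ^ (2 * Suc k))"
      by (simp add: mult.commute)
    then have "e_coeff q (Suc k) * \<bar>z\<bar> \<le> e_coeff q (Suc k) * ((1 + \<bar>z\<bar>) / 2 * (1 - q ^ (2 * Suc k)))"
      using coeff_pos(1)[of "Suc k"] by (intro mult_left_mono) auto
    also have "\<dots> = (1 + \<bar>z\<bar>) / 2 * e_coeff q k"
      unfolding e_coeff_Suc[OF q, of k, symmetric] by simp
    finally have "e_coeff q (Suc k) * \<bar>z\<bar> * \<bar>z\<bar> ^ k \<le> (1 + \<bar>z\<bar>) / 2 * e_coeff q k * \<bar>z\<bar> ^ k"
      by (intro mult_right_mono) auto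
    then show "norm (norm (e_coeff q (Suc k) * z ^ Suc k)) \<le> (1 + \<bar>z\<bar>) / 2 * norm (norm (e_coeff q k * z ^ k))"
      using coeff_pos(1)[of k] coeff_pos(1)[of "Suc k"] by (simp add: abs_mult power_abs mult.assoc)
  qed (use assms in auto)
qed

lemma E_fun_step: "E_fun q z = (1 + z) * E_fun q (q^2 * z)"
proof -
  have s: "summable (\<lambda>k. E_coeff q k * w ^ k)" for w
    using E_coeff_abs_summable by (rule summable_norm_cancel)
  have "E_fun q z - E_fun q (q^2 * z) = (\<Sum>k. E_coeff q k * z ^ k - E_coeff q k * (q^2 * z) ^ k)"
    unfolding E_fun_def by (rule suminf_diff[OF s s])
  also have "\<dots> = (\<Sum>k. E_coeff q k * (1 - q ^ (2 * k)) * z ^ k)"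
    by (simp add: power_mult_distrib algebra_simps flip: power_mult)
  also have "\<dots> = (\<Sum>k. E_coeff q (Suc k) * (1 - q ^ (2 * Suc k)) * z ^ Suc k)"
  proof -
    have "summable (\<lambda>k. E_coeff q k * z ^ k - E_coeff q k * (q^2 * z) ^ k)"
      by (rule summable_diff[OF s s])
    then have "summable (\<lambda>k. E_coeff q k * (1 - q ^ (2 * k)) * z ^ k)"
      by (simp add: power_mult_distrib algebra_simps flip: power_mult)
    from suminf_split_head[OF this] show ?thesis by simp
  qed
  also have "\<dots> = (\<Sum>k. z * (E_coeff q k * (q^2 * z) ^ k))"
    unfolding E_coeff_Suc[OF q] by (simp add: power_mult_distrib mult_ac flip: power_mult)
  also have "\<dots> = z * E_fun q (q^2 * z)"
    unfolding E_fun_def by (rule suminf_mult[OF s])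
  finally show ?thesis by (simp add: algebra_simps)
qed

text \<open>Analytic counterpart of \<open>e_poly_mult_E_poly\<close>. It also shows that E has no
  zero with |z| < 1.\<close>

lemma e_fun_mult_E_fun:
  assumes "\<bar>z\<bar> < 1"
  shows "e_fun q (- z) * E_fun q z = 1"
proof -
  have "(\<lambda>k. \<Sum>j\<le>k. (E_coeff q j * z ^ j) * (e_coeff q (k - j) * (- z) ^ (k - j))) sums (E_fun q z * e_fun q (- z))"
    unfolding E_fun_def e_fun_def
    using assms by (intro Cauchy_product_sums E_coeff_abs_summable e_coeff_abs_summable) auto
  moreover have "(\<Sum>j\<le>k. (E_coeff q j * z ^ j) * (e_coeff q (k - j) * (- z) ^ (k - j))) = (if k = 0 then 1 else 0)" for k
  proof -
    have "(\<Sum>j\<le>k. (E_coeff q j * z ^ j) * (e_coeff q (k - j) * (- z) ^ (k - j)))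
        = (\<Sum>j\<le>k. (- z) ^ k * ((-1) ^ j * E_coeff q j * e_coeff q (k - j)))"
    proof (intro sum.cong refl)
      fix j assume "j \<in> {..k}"
      then have "(- z) ^ k = (-1) ^ j * z ^ j * (- z) ^ (k - j)"
        by (metis atMost_iff le_add_diff_inverse mult_minus1 power_add power_mult_distrib)
      then have "(- z) ^ k * ((-1) ^ j * E_coeff q j * e_coeff q (k - j))
          = ((-1) ^ j * (-1) ^ j) * ((E_coeff q j * z ^ j) * (e_coeff q (k - j) * (- z) ^ (k - j)))"
        by (simp only: mult_ac)
      then show "(E_coeff q j * z ^ j) * (e_coeff q (k - j) * (- z) ^ (k - j))
          = (- z) ^ k * ((-1) ^ j * E_coeff q j * e_coeff q (k - j))"
        by (simp only: minus_one_mult_self mult_1_left)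
    qed
    also have "\<dots> = (- z) ^ k * (if k = 0 then 1 else 0)"
      unfolding sum_distrib_left[symmetric] q_binomial_alternating_sum[OF q] ..
    finally show ?thesis by simp
  qed
  ultimately have "(\<lambda>k. if k = 0 then 1 else (0::real)) sums (E_fun q z * e_fun q (- z))"
    by simp
  moreover have "(\<lambda>k. if k = 0 then 1 else (0::real)) sums 1"
    using sums_single[of 0 "\<lambda>_. 1::real"] by simp
  ultimately show ?thesis
    by (simp add: sums_unique2 mult.commute)
qed

lemma E_fun_tendsto_1: "(\<lambda>s. E_fun q (q ^ (2 * s) * z)) \<longlonglongrightarrow> 1"
proof -
  have "isCont (E_fun q) 0"
    unfolding E_fun_def[abs_def]
    using summable_norm_cancel[OF E_coeff_abs_summable[of 1]]
    by (intro isCont_powser[of _ 1]) auto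
  then have "E_fun q \<midarrow>0\<rightarrow> E_fun q 0"
    by (simp add: isCont_def)
  moreover have "(\<lambda>s. q ^ (2 * s) * z) \<longlonglongrightarrow> 0 * z"
    by (intro tendsto_intros q_power_tendsto_0)
  ultimately have "(\<lambda>s. E_fun q (q ^ (2 * s) * z)) \<longlonglongrightarrow> E_fun q 0"
    using \<open>isCont (E_fun q) 0\<close> isCont_tendsto_compose[of 0 "E_fun q" "\<lambda>s. q ^ (2 * s) * z"] by simp
  then show ?thesis
    by (simp add: E_fun_def)
qed

end

section \<open>The algebra of row-finite matrices\<close>

text \<open>With finite rows, matrices over a whole type form a unital algebra, to which the
  identities for \<open>real_algebra_1\<close> apply. A type cannot depend on n, L and \<theta>, so
  matrices on the configurations are later extended to all of \<open>conf\<close> by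
  \<open>ext_mat\<close>.\<close>

typedef 'a rmat = "{M :: 'a \<Rightarrow> 'a \<Rightarrow> real. \<forall>x. finite {y. M x y \<noteq> 0}}"
  morphisms entry Rmat
  by (rule exI[of _ "\<lambda>_ _. 0"]) simp

setup_lifting type_definition_rmat

lemma finite_row: "finite {y. entry A x y \<noteq> 0}"
  using entry[of A] by simp

lemma rmat_eqI: "(\<And>x y. entry A x y = entry B x y) \<Longrightarrow> A = B"
  by (metis entry_inject ext)

lemma finite_row_sum:
  assumes "finite S" "\<And>y. y \<in> S \<Longrightarrow> finite {z. N y z \<noteq> (0::real)}"
  shows "finite {z. (\<Sum>y\<in>S. f y * N y z) \<noteq> 0}"
proof (rule finite_subset)
  show "{z. (\<Sum>y\<in>S. f y * N y z) \<noteq> 0} \<subseteq> (\<Union>y\<in>S. {z. N y z \<noteq> 0})"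
    by (auto intro: ccontr sum.neutral)
qed (use assms in auto)

lemma finite_row_add:
  assumes "finite {y. f y \<noteq> (0::real)}" "finite {y. g y \<noteq> 0}"
  shows "finite {y. f y + g y \<noteq> 0}"
  by (rule finite_subset[of _ "{y. f y \<noteq> 0} \<union> {y. g y \<noteq> 0}"]) (use assms in auto)

instantiation rmat :: (type) real_algebra_1
begin

lift_definition zero_rmat :: "'a rmat" is "\<lambda>_ _. 0"
  by simp

lift_definition one_rmat :: "'a rmat" is "\<lambda>x y. if x = y then 1 else 0"
  by simp

lift_definition plus_rmat :: "'a rmat \<Rightarrow> 'a rmat \<Rightarrow> 'a rmat" is "\<lambda>M N x y. M x y + N x y"
  by (rule finite_row_add) auto

lift_definition uminus_rmat :: "'a rmat \<Rightarrow> 'a rmat" is "\<lambda>M x y. - M x y"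
  by simp

definition minus_rmat :: "'a rmat \<Rightarrow> 'a rmat \<Rightarrow> 'a rmat" where
  "minus_rmat M N = M + - N"

lift_definition scaleR_rmat :: "real \<Rightarrow> 'a rmat \<Rightarrow> 'a rmat" is "\<lambda>c M x y. c * M x y"
  by (auto elim!: allE finite_subset[rotated])

lift_definition times_rmat :: "'a rmat \<Rightarrow> 'a rmat \<Rightarrow> 'a rmat" is
  "\<lambda>M N x z. \<Sum>y | M x y \<noteq> 0. M x y * N y z"
  by (rule finite_row_sum) auto

text \<open>S may exceed the support of the row, so that sums arising from different matrices can be
  brought to a common range.\<close>

lemma entry_times:
  assumes "finite S" "{y. entry A x y \<noteq> 0} \<subseteq> S"
  shows "entry (A * B) x z = (\<Sum>y\<in>S. entry A x y * entry B y z)"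
  unfolding times_rmat.rep_eq using assms by (intro sum.mono_neutral_left) auto

lemma entry_plus: "entry (A + B) x y = entry A x y + entry B x y"
  by transfer simp

lemma entry_uminus: "entry (- A) x y = - entry A x y"
  by transfer simp

lemma entry_zero: "entry 0 x y = 0"
  by transfer simp

lemma entry_scaleR: "entry (c *\<^sub>R A) x y = c * entry A x y"
  by transfer simp

instance
proof
  fix A B C :: "'a rmat" and r s :: real
  show "A * B * C = A * (B * C)"
  proof (rule rmat_eqI)
    fix x z
    let ?S = "{y. entry A x y \<noteq> 0}"
    let ?T = "\<Union>y\<in>?S. {u. entry B y u \<noteq> 0}"
    have fin: "finite ?S" "finite ?T"
      by (auto intro: finite_row)
    have sub: "{u. entry (A * B) x u \<noteq> 0} \<subseteq> ?T"
      unfolding entry_times[OF fin(1) order.refl] by (auto elim!: sum.not_neutral_contains_not_neutral)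
    have "entry (A * B * C) x z = (\<Sum>u\<in>?T. \<Sum>y\<in>?S. entry A x y * entry B y u * entry C u z)"
      unfolding entry_times[OF fin(2) sub] entry_times[OF fin(1) order.refl] by (simp add: sum_distrib_right)
    also have "\<dots> = (\<Sum>y\<in>?S. entry A x y * (\<Sum>u\<in>?T. entry B y u * entry C u z))"
      by (subst sum.swap) (simp add: sum_distrib_left mult.assoc)
    also have "\<dots> = (\<Sum>y\<in>?S. entry A x y * entry (B * C) y z)"
      by (intro sum.cong refl arg_cong[of _ _ "(*) _"] entry_times[symmetric, OF fin(2)]) auto
    also have "\<dots> = entry (A * (B * C)) x z"
      by (rule entry_times[symmetric, OF fin(1) order.refl])
    finally show "entry (A * B * C) x z = entry (A * (B * C)) x z" .
  qed
  have T: "entry (A * C) x z = (\<Sum>y\<in>{y. entry A x y \<noteq> 0} \<union> {y. entry B x y \<noteq> 0}. entry A x y * entry C y z)"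
    "entry (B * C) x z = (\<Sum>y\<in>{y. entry A x y \<noteq> 0} \<union> {y. entry B x y \<noteq> 0}. entry B x y * entry C y z)"
    "entry ((A + B) * C) x z = (\<Sum>y\<in>{y. entry A x y \<noteq> 0} \<union> {y. entry B x y \<noteq> 0}. entry (A + B) x y * entry C y z)" for x z
      using finite_row[of A x] finite_row[of B x] by (intro entry_times; auto simp: entry_plus)+
  show "(A + B) * C = A * C + B * C"
    by (rule rmat_eqI) (simp add: T entry_plus distrib_right sum.distrib)
  show "A * (B + C) = A * B + A * C"
    by (rule rmat_eqI)
       (simp add: times_rmat.rep_eq entry_plus distrib_left sum.distrib)
  show "1 * A = A"
  proof (rule rmat_eqI)
    fix x z
    have "entry (1 * A) x z = (\<Sum>y\<in>{x}. entry 1 x y * entry A y z)"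
      by (rule entry_times) (auto simp: one_rmat.rep_eq split: if_splits)
    then show "entry (1 * A) x z = entry A x z"
      by (simp add: one_rmat.rep_eq)
  qed
  show "A * 1 = A"
  proof (rule rmat_eqI)
    fix x z
    have "entry (A * 1) x z = (\<Sum>y\<in>insert z {y. entry A x y \<noteq> 0}. entry A x y * entry 1 y z)"
      by (rule entry_times) (auto simp: finite_row)
    also have "\<dots> = (\<Sum>y\<in>insert z {y. entry A x y \<noteq> 0}. if y = z then entry A x y else 0)"
      by (intro sum.cong) (auto simp: one_rmat.rep_eq)
    also have "\<dots> = entry A x z"
      using finite_row[of A x] by (subst sum.delta) auto
    finally show "entry (A * 1) x z = entry A x z" .
  qed
  show "r *\<^sub>R A * B = r *\<^sub>R (A * B)"
  proof (rule rmat_eqI)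
    fix x z
    have "entry (r *\<^sub>R A * B) x z = (\<Sum>y\<in>{y. entry A x y \<noteq> 0}. entry (r *\<^sub>R A) x y * entry B y z)"
      by (rule entry_times) (auto simp: finite_row entry_scaleR)
    then show "entry (r *\<^sub>R A * B) x z = entry (r *\<^sub>R (A * B)) x z"
      by (simp add: times_rmat.rep_eq entry_scaleR sum_distrib_left mult.assoc)
  qed
  show "A * r *\<^sub>R B = r *\<^sub>R (A * B)"
    by (rule rmat_eqI) (simp add: times_rmat.rep_eq entry_scaleR sum_distrib_left mult.left_commute)
  show "(0 :: 'a rmat) \<noteq> 1"
  proof
    assume "(0 :: 'a rmat) = 1"
    then have "entry (0 :: 'a rmat) undefined undefined = entry (1 :: 'a rmat) undefined undefined"
      by simp
    then show False
      by (simp add: one_rmat.rep_eq zero_rmat.rep_eq)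
  qed
  show "A - B = A + - B" by (rule minus_rmat_def)
  show "A + B + C = A + (B + C)" "A + B = B + A" "0 + A = A" "- A + A = 0"
    by (rule rmat_eqI; simp add: entry_plus entry_uminus entry_zero)+
  show "r *\<^sub>R (A + B) = r *\<^sub>R A + r *\<^sub>R B" "(r + s) *\<^sub>R A = r *\<^sub>R A + s *\<^sub>R A"
    "r *\<^sub>R s *\<^sub>R A = (r * s) *\<^sub>R A" "1 *\<^sub>R A = A"
    by (rule rmat_eqI; simp add: entry_plus entry_scaleR distrib_left distrib_right)+
qed

end

section \<open>Moving and converting particles\<close>

text \<open>On an empty cell truncated subtraction leaves 0, and \<open>conv\<close> or
  \<open>hop\<close> then creates a particle instead of moving one. This does no harm, because every
  weight or indicator attached to such a move below vanishes on an empty source cell.\<close>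

definition conv :: "nat \<Rightarrow> nat \<Rightarrow> nat \<Rightarrow> conf \<Rightarrow> conf" where
  "conv y i j \<xi> = \<xi>(y := (\<xi> y)(i := \<xi> y i - 1, j := \<xi> y j + 1))"

definition hop :: "nat \<Rightarrow> nat \<Rightarrow> nat \<Rightarrow> conf \<Rightarrow> conf" where
  "hop x x' p \<xi> = \<xi>(x := (\<xi> x)(p := \<xi> x p - 1), x' := (\<xi> x')(p := \<xi> x' p + 1))"

lemma cint_0 [simp]: "cint q 0 = 0"
  by (simp add: cint_def)

lemma one_minus_square_neq_0:
  fixes q :: real
  assumes "0 < q" "q < 1"
  shows "1 - q^2 \<noteq> 0"
  using one_minus_power_neq_0[OF assms, of 2] by simp

lemma cint_Suc:
  assumes "0 < q" "q < 1"
  shows "cint q (Suc m) = 1 + q^2 * cint q m"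
  using one_minus_square_neq_0[OF assms]
  by (simp add: cint_def field_simps power2_eq_square)

lemma cint_add:
  assumes "0 < q" "q < 1"
  shows "cint q (m + k) = cint q m + q ^ (2 * m) * cint q k"
proof -
  have "1 - q ^ (2 * (m + k)) = (1 - q ^ (2 * m)) + q ^ (2 * m) * (1 - q ^ (2 * k))"
    by (simp add: algebra_simps power_add)
  then show ?thesis
    unfolding cint_def by (simp only: add_divide_distrib times_divide_eq_right)
qed

lemma cint_pos:
  assumes "0 < q" "q < 1" "m > 0"
  shows "cint q m > 0"
  using power_less_1[OF assms(1,2), of "2 * m"] power_less_1[OF assms(1,2), of 2] assms(3)
  by (simp add: cint_def)

text \<open>The indicators stand on opposite sides to keep the equation over the naturals free of
  subtraction.\<close>

lemma sum_shift_unit: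
  fixes g :: "nat \<Rightarrow> nat"
  assumes "finite S" "g i \<ge> 1" "i \<noteq> j"
  shows "sum (g(i := g i - 1, j := g j + 1)) S + of_bool (i \<in> S) = sum g S + of_bool (j \<in> S)"
proof -
  have "sum (g(i := g i - 1, j := g j + 1)) S + sum (\<lambda>k. of_bool (k = i)) S = sum g S + sum (\<lambda>k. of_bool (k = j)) S"
    unfolding sum.distrib[symmetric] using assms(2,3) by (intro sum.cong) auto
  then show ?thesis
    using assms(1) by (simp add: of_bool_def sum.delta)
qed

lemma sum_incr:
  fixes g :: "nat \<Rightarrow> nat"
  assumes "finite S"
  shows "sum (g(i := g i + 1)) S = sum g S + of_bool (i \<in> S)"
proof -
  have "sum (g(i := g i + 1)) S = sum g S + sum (\<lambda>k. of_bool (k = i)) S"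
    unfolding sum.distrib[symmetric] by (intro sum.cong) auto
  then show ?thesis
    using assms(1) by (simp add: of_bool_def sum.delta)
qed

lemma sum_decr:
  fixes g :: "nat \<Rightarrow> nat"
  assumes "finite S" "g i \<ge> 1"
  shows "sum (g(i := g i - 1)) S + of_bool (i \<in> S) = sum g S"
proof -
  have "sum (g(i := g i - 1)) S + sum (\<lambda>k. of_bool (k = i)) S = sum g S"
    unfolding sum.distrib[symmetric] using assms(2) by (intro sum.cong) auto
  then show ?thesis
    using assms(1) by (simp add: of_bool_def sum.delta)
qed

lemma conv_row: "conv y i j \<xi> y = (\<xi> y)(i := \<xi> y i - 1, j := \<xi> y j + 1)"
  and conv_other_row: "z \<noteq> y \<Longrightarrow> conv y i j \<xi> z = \<xi> z"
  by (simp_all add: conv_def)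

lemma hop_row: "x \<noteq> x' \<Longrightarrow> hop x x' p \<xi> x = (\<xi> x)(p := \<xi> x p - 1)"
  "hop x x' p \<xi> x' = (\<xi> x')(p := \<xi> x' p + 1)"
  "z \<noteq> x \<Longrightarrow> z \<noteq> x' \<Longrightarrow> hop x x' p \<xi> z = \<xi> z"
  by (simp_all add: hop_def)

lemma hop_column: "x \<noteq> x' \<Longrightarrow> (\<lambda>z. hop x x' p \<xi> z p) = (\<lambda>z. \<xi> z p)(x := \<xi> x p - 1, x' := \<xi> x' p + 1)"
  "k \<noteq> p \<Longrightarrow> hop x x' p \<xi> z k = \<xi> z k"
  by (auto simp: hop_def)

text \<open>Only a cell that one move fills and the other draws from is sensitive to the order, and
  only if it is empty at the start.\<close>

lemma conv_hop_commute:
  assumes "x \<noteq> x'" "i \<noteq> j" "p = i \<and> y = x' \<Longrightarrow> \<xi> y i \<ge> 1" "p = j \<and> y = x \<Longrightarrow> \<xi> x p \<ge> 1"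
  shows "conv y i j (hop x x' p \<xi>) = hop x x' p (conv y i j \<xi>)"
  using assms by (intro ext) (auto simp: conv_def hop_def)

text \<open>With {m} = \<open>cint q m\<close>, the quantity q^(2S) {m} is the increment {S + m} -
  {S}. The three weights therefore partition the q-number of a whole row or column; they differ in
  the cells counted first: lower species, higher species, or sites to the left.\<close>

definition weight_below :: "real \<Rightarrow> nat \<Rightarrow> (nat \<Rightarrow> nat) \<Rightarrow> real" where
  "weight_below q p g = q ^ (2 * (\<Sum>j<p. g j)) * cint q (g p)"

definition weight_above :: "real \<Rightarrow> nat \<Rightarrow> nat \<Rightarrow> (nat \<Rightarrow> nat) \<Rightarrow> real" where
  "weight_above q n p g = q ^ (2 * (\<Sum>j=p+1..n. g j)) * cint q (g p)"

definition weight_left :: "real \<Rightarrow> nat \<Rightarrow> nat \<Rightarrow> conf \<Rightarrow> real" where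
  "weight_left q i y \<xi> = q ^ (2 * (\<Sum>z=1..<y. \<xi> z i)) * cint q (\<xi> y i)"

definition hop_right :: "real \<Rightarrow> nat \<Rightarrow> nat \<Rightarrow> (conf \<Rightarrow> real) \<Rightarrow> conf \<Rightarrow> real" where
  "hop_right q n x f \<xi> = (\<Sum>p\<le>n. weight_below q p (\<xi> x) * f (hop x (x + 1) p \<xi>))"

definition hop_left :: "real \<Rightarrow> nat \<Rightarrow> nat \<Rightarrow> (conf \<Rightarrow> real) \<Rightarrow> conf \<Rightarrow> real" where
  "hop_left q n x f \<xi> = (\<Sum>p\<le>n. weight_above q n p (\<xi> (x + 1)) * f (hop (x + 1) x p \<xi>))"

definition convert :: "real \<Rightarrow> nat \<Rightarrow> nat \<Rightarrow> (conf \<Rightarrow> real) \<Rightarrow> conf \<Rightarrow> real" where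
  "convert q L i f \<xi> = (\<Sum>y=1..L. weight_left q i y \<xi> * f (conv y i (i + 1) \<xi>))"

lemma weight_below_0: "g p = 0 \<Longrightarrow> weight_below q p g = 0"
  by (simp add: weight_below_def)

lemma weight_above_0: "g p = 0 \<Longrightarrow> weight_above q n p g = 0"
  by (simp add: weight_above_def)

lemma weight_left_0: "\<xi> y i = 0 \<Longrightarrow> weight_left q i y \<xi> = 0"
  by (simp add: weight_left_def)

text \<open>The increments telescope, so the total rate sees only the occupancy of the site and not
  its composition. Species conversions leave it unchanged.\<close>

lemma sum_weight_below:
  assumes "0 < q" "q < 1"
  shows "(\<Sum>p\<le>n. weight_below q p g) = cint q (\<Sum>j\<le>n. g j)"
proof (induction n)
  case 0
  show ?case by (simp add: weight_below_def)
next
  case (Suc n)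
  then show ?case
    by (simp add: cint_add[OF assms] weight_below_def lessThan_Suc_atMost)
qed

lemma sum_weight_above_aux:
  assumes "0 < q" "q < 1"
  shows "(\<Sum>p\<in>{n-k..n}. weight_above q n p g) = cint q (\<Sum>j\<in>{n-k..n}. g j)"
proof (induction k)
  case 0
  show ?case by (simp add: weight_above_def)
next
  case (Suc k)
  show ?case
  proof (cases "k < n")
    case True
    then have *: "{n - Suc k..n} = insert (n - Suc k) {n - k..n}" "n - Suc k \<notin> {n - k..n}" "n - Suc k + 1 = n - k"
      by auto
    then show ?thesis
      using Suc cint_add[OF assms, of "\<Sum>j\<in>{n-k..n}. g j" "g (n - Suc k)"]
      by (simp add: weight_above_def add.commute)
  next
    \<comment> \<open>For k \<ge> n the lower end n - k has already reached 0 and the range no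
      longer grows.\<close>
    case False
    then show ?thesis using Suc by simp
  qed
qed

lemma sum_weight_above:
  assumes "0 < q" "q < 1"
  shows "(\<Sum>p\<le>n. weight_above q n p g) = cint q (\<Sum>j\<le>n. g j)"
  using sum_weight_above_aux[OF assms, where n = n and k = n] by (simp add: atLeast0AtMost)

text \<open>The converted species are adjacent, so a sum over the species below p separates them
  only for p = i + 1; the cell p itself changes only for p = i and p = i + 1.\<close>

lemma weight_below_conv:
  assumes "p \<noteq> i" "p \<noteq> i + 1" "\<xi> y i \<ge> 1"
  shows "weight_below q p (conv y i (i + 1) \<xi> x) = weight_below q p (\<xi> x)"
proof (cases "x = y")
  case True
  have "sum ((\<xi> y)(i := \<xi> y i - 1, i + 1 := \<xi> y (i + 1) + 1)) {..<p} + of_bool (i \<in> {..<p}) =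
      sum (\<xi> y) {..<p} + of_bool (i + 1 \<in> {..<p})"
    by (rule sum_shift_unit) (use assms in auto)
  moreover have "i \<in> {..<p} \<longleftrightarrow> i + 1 \<in> {..<p}"
    using assms by auto
  ultimately show ?thesis
    using assms True by (simp add: weight_below_def conv_row)
qed (simp add: conv_other_row)

lemma weight_above_conv:
  assumes "p \<noteq> i" "p \<noteq> i + 1" "\<xi> y i \<ge> 1" "i + 1 \<le> n"
  shows "weight_above q n p (conv y i (i + 1) \<xi> x) = weight_above q n p (\<xi> x)"
proof (cases "x = y")
  case True
  have "sum ((\<xi> y)(i := \<xi> y i - 1, i + 1 := \<xi> y (i + 1) + 1)) {p+1..n} + of_bool (i \<in> {p+1..n}) =
      sum (\<xi> y) {p+1..n} + of_bool (i + 1 \<in> {p+1..n})"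
    by (rule sum_shift_unit) (use assms in auto)
  moreover have "i \<in> {p+1..n} \<longleftrightarrow> i + 1 \<in> {p+1..n}"
    using assms by auto
  ultimately show ?thesis
    using assms True by (simp add: weight_above_def conv_row)
qed (simp add: conv_other_row)

text \<open>The same observation for columns: the sites of a hop are neighbours, so a sum over the
  sites left of y contains both or neither unless y is one of them.\<close>

lemma weight_left_hop:
  assumes "p = i \<Longrightarrow> y \<noteq> x \<and> y \<noteq> x'" "\<xi> x p \<ge> 1" "1 \<le> x" "1 \<le> x'" "x' = x + 1 \<or> x = x' + 1"
  shows "weight_left q i y (hop x x' p \<xi>) = weight_left q i y \<xi>"
proof (cases "p = i")
  case True
  have "sum ((\<lambda>z. \<xi> z i)(x := \<xi> x i - 1, x' := \<xi> x' i + 1)) {1..<y} + of_bool (x \<in> {1..<y}) =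
      sum (\<lambda>z. \<xi> z i) {1..<y} + of_bool (x' \<in> {1..<y})"
    by (rule sum_shift_unit) (use assms True in auto)
  moreover have "x \<in> {1..<y} \<longleftrightarrow> x' \<in> {1..<y}"
    using assms True by auto
  moreover have "(\<lambda>z. hop x x' p \<xi> z i) = (\<lambda>z. \<xi> z i)(x := \<xi> x i - 1, x' := \<xi> x' i + 1)"
    using assms(5) unfolding True by (intro hop_column) auto
  ultimately have "(\<Sum>z=1..<y. hop x x' i \<xi> z i) = (\<Sum>z=1..<y. \<xi> z i)"
    using True by (simp only: add_right_cancel)
  moreover have "hop x x' i \<xi> y = \<xi> y"
    using assms True by (simp add: hop_row)
  ultimately show ?thesis
    using True by (simp add: weight_left_def)
qed (simp add: weight_left_def hop_column)

text \<open>The two particle moves commute term by term except when they meet in the same cell; the two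
  exceptional terms cancel each other.\<close>

lemma sum_eq_two_exceptions:
  fixes T T' :: "'a \<Rightarrow> 'b \<Rightarrow> real"
  assumes "finite A" "finite B" "a \<in> A" "a' \<in> A" "b \<in> B" "b' \<in> B" "a \<noteq> a'"
    and "\<And>p y. p \<in> A \<Longrightarrow> y \<in> B \<Longrightarrow> (p, y) \<noteq> (a, b) \<Longrightarrow> (p, y) \<noteq> (a', b') \<Longrightarrow> T p y = T' p y"
    and "T a b + T a' b' = T' a b + T' a' b'"
  shows "(\<Sum>p\<in>A. \<Sum>y\<in>B. T p y) = (\<Sum>y\<in>B. \<Sum>p\<in>A. T' p y)"
proof -
  have "(\<Sum>p\<in>A. \<Sum>y\<in>B. T p y) - (\<Sum>p\<in>A. \<Sum>y\<in>B. T' p y) = (\<Sum>(p,y)\<in>A \<times> B. T p y - T' p y)"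
    by (simp add: sum.cartesian_product case_prod_unfold flip: sum_subtractf)
  also have "\<dots> = (\<Sum>(p,y)\<in>{(a,b),(a',b')}. T p y - T' p y)"
  proof (rule sum.mono_neutral_right)
    show "\<forall>u\<in>A \<times> B - {(a,b),(a',b')}. (case u of (p, y) \<Rightarrow> T p y - T' p y) = 0"
    proof
      fix u assume u: "u \<in> A \<times> B - {(a,b),(a',b')}"
      obtain p y where "u = (p, y)"
        by (cases u)
      then show "(case u of (p, y) \<Rightarrow> T p y - T' p y) = 0"
        using u assms(8)[of p y] by simp
    qed
  qed (use assms(1-6) in auto)
  also have "\<dots> = 0"
    using assms(7,9) by simp
  finally show ?thesis
    by (simp add: sum.swap[of _ B])
qed

section \<open>Hops across a bond commute with species conversion\<close>

context
  fixes q :: real and n L :: nat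
  assumes q: "0 < q" "q < 1"
begin

text \<open>Both exceptional terms replace a particle of species i at x by one of species i + 1 at x
  + 1. The surplus 1 in {m + 1} = 1 + q^2 {m} belongs to a particle that makes both moves itself:
  with the hop first it appears in the term (i, x + 1), with the conversion first in the term (i +
  1, x).\<close>

lemma hop_right_convert:
  assumes x: "1 \<le> x" "x < L" and i: "i < n"
  shows "hop_right q n x (convert q L i f) \<xi> = convert q L i (hop_right q n x f) \<xi>"
proof -
  define T where "T p y = weight_below q p (\<xi> x) * (weight_left q i y (hop x (x + 1) p \<xi>) *
    f (conv y i (i + 1) (hop x (x + 1) p \<xi>)))" for p y
  define T' where "T' p y = weight_left q i y \<xi> * (weight_below q p (conv y i (i + 1) \<xi> x) *
    f (hop x (x + 1) p (conv y i (i + 1) \<xi>)))" for p y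
  have gen: "T p y = T' p y" if ne: "(p, y) \<noteq> (i, x + 1)" "(p, y) \<noteq> (i + 1, x)" for p y
  proof -
    \<comment> \<open>Outside the two exceptional pairs neither move refills a cell from which the
      other draws, so an empty source makes both sides vanish.\<close>
    have cell0: "weight_below q p (conv y i (i + 1) \<xi> x) = 0" if "\<xi> x p = 0"
      using that \<open>(p, y) \<noteq> (i + 1, x)\<close> by (intro weight_below_0) (auto simp: conv_def)
    have cell1: "weight_left q i y (hop x (x + 1) p \<xi>) = 0" if "\<xi> y i = 0"
      using that \<open>(p, y) \<noteq> (i, x + 1)\<close> by (intro weight_left_0) (auto simp: hop_def)
    consider "\<xi> x p = 0" | "\<xi> y i = 0" | "\<xi> x p \<ge> 1" "\<xi> y i \<ge> 1"
      by linarith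
    then show ?thesis
    proof cases
      case 1
      then show ?thesis using cell0 by (simp add: T_def T'_def weight_below_0)
    next
      case 2
      then show ?thesis using cell1 by (simp add: T_def T'_def weight_left_0)
    next
      case 3
      have c: "conv y i (i + 1) (hop x (x + 1) p \<xi>) = hop x (x + 1) p (conv y i (i + 1) \<xi>)"
        by (rule conv_hop_commute) (use ne in auto)
      consider "p = i" "y = x" | "p = i" "y \<noteq> x" "y \<noteq> x + 1" | "p = i + 1" "y \<noteq> x" | "p \<noteq> i" "p \<noteq> i + 1"
        using ne by auto
      then have "weight_below q p (\<xi> x) * weight_left q i y (hop x (x + 1) p \<xi>) =
          weight_left q i y \<xi> * weight_below q p (conv y i (i + 1) \<xi> x)"
      proof cases
        case 1
        have "(\<Sum>z=1..<x. hop x (x + 1) i \<xi> z i) = (\<Sum>z=1..<x. \<xi> z i)"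
          by (intro sum.cong) (auto simp: hop_def)
        moreover have "(\<Sum>j<i. conv x i (i + 1) \<xi> x j) = (\<Sum>j<i. \<xi> x j)"
          by (intro sum.cong) (auto simp: conv_def)
        ultimately show ?thesis
          unfolding 1 by (simp add: weight_below_def weight_left_def conv_row hop_row)
      next
        case 2
        then show ?thesis
          using weight_left_hop[of p i y x "x + 1" \<xi> q] 3 x by (simp add: conv_other_row)
      next
        case 3
        then show ?thesis
          using weight_left_hop[of p i y x "x + 1" \<xi> q] \<open>\<xi> x p \<ge> 1\<close> x by (simp add: conv_other_row)
      next
        case 4
        then show ?thesis
          using weight_left_hop[of p i y x "x + 1" \<xi> q] weight_below_conv[of p i \<xi> y q x] 3 x by simp
      qed
      then show ?thesis
        unfolding T_def T'_def c mult.assoc[symmetric] by simp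
    qed
  qed
  have exc: "T i (x + 1) + T (i + 1) x = T' i (x + 1) + T' (i + 1) x"
  proof (cases "\<xi> x i")
    case 0
    have "conv x i (i + 1) \<xi> x i = 0" using 0 by (simp add: conv_def)
    then show ?thesis
      using 0 by (simp add: T_def T'_def weight_below_0 weight_left_0 conv_other_row hop_column)
  next
    case (Suc a)
    define \<zeta> where "\<zeta> = \<xi>(x := (\<xi> x)(i := \<xi> x i - 1), x + 1 := (\<xi> (x + 1))(i + 1 := \<xi> (x + 1) (i + 1) + 1))"
    define P where "P = (\<Sum>j<i. \<xi> x j)"
    define S where "S = (\<Sum>z=1..<x. \<xi> z i)"
    let ?b = "\<xi> x (i + 1)" and ?c = "\<xi> (x + 1) i"
    have fa: "f (conv (x + 1) i (i + 1) (hop x (x + 1) i \<xi>)) = f \<zeta>"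
      by (rule arg_cong[of _ _ f]) (auto simp: \<zeta>_def conv_def hop_def fun_eq_iff)
    have fb: "?c \<ge> 1 \<Longrightarrow> hop x (x + 1) i (conv (x + 1) i (i + 1) \<xi>) = \<zeta>"
      by (auto simp: \<zeta>_def conv_def hop_def fun_eq_iff)
    have fc: "?b \<ge> 1 \<Longrightarrow> conv x i (i + 1) (hop x (x + 1) (i + 1) \<xi>) = \<zeta>"
      by (auto simp: \<zeta>_def conv_def hop_def fun_eq_iff)
    have fd: "hop x (x + 1) (i + 1) (conv x i (i + 1) \<xi>) = \<zeta>"
      by (auto simp: \<zeta>_def conv_def hop_def fun_eq_iff)
    have s1: "(\<Sum>z=1..<x+1. hop x (x + 1) i \<xi> z i) = S + a"
    proof -
      have "(\<Sum>z=1..<x. hop x (x + 1) i \<xi> z i) = S"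
        unfolding S_def by (intro sum.cong) (auto simp: hop_def)
      then show ?thesis using x Suc by (simp add: hop_row)
    qed
    have s2: "(\<Sum>z=1..<x+1. \<xi> z i) = S + Suc a"
      using x Suc by (simp add: S_def)
    have s3: "(\<Sum>z=1..<x. hop x (x + 1) (i + 1) \<xi> z i) = S"
      by (simp add: S_def hop_column)
    have s4: "(\<Sum>j<i+1. conv x i (i + 1) \<xi> x j) = P + a"
    proof -
      have "(\<Sum>j<i. conv x i (i + 1) \<xi> x j) = P"
        unfolding P_def by (intro sum.cong) (auto simp: conv_def)
      then show ?thesis using Suc by (simp add: conv_row)
    qed
    have s5: "(\<Sum>j<i+1. \<xi> x j) = P + Suc a"
      using Suc by (simp add: P_def)
    have T1: "T i (x + 1) = q ^ (2 * P + 2 * S + 2 * a) * cint q (Suc a) * (1 + q^2 * cint q ?c) * f \<zeta>"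
      unfolding T_def weight_below_def weight_left_def fa s1
      by (simp add: Suc P_def[symmetric] hop_row cint_Suc[OF q] power_add)
    have T2: "T (i + 1) x = q ^ (2 * P + 2 * S + 2 * a) * cint q (Suc a) * (q^2 * cint q ?b) * f \<zeta>"
    proof (cases "?b = 0")
      case False
      then show ?thesis
        using fc unfolding T_def weight_below_def weight_left_def s3 s5
        by (simp add: Suc hop_column power_add power2_eq_square)
    qed (simp add: T_def weight_below_0)
    have T1': "T' i (x + 1) = q ^ (2 * P + 2 * S + 2 * a) * cint q (Suc a) * (q^2 * cint q ?c) * f \<zeta>"
    proof (cases "?c = 0")
      case False
      then show ?thesis
        using fb unfolding T'_def weight_below_def weight_left_def s2
        by (simp add: Suc P_def[symmetric] conv_other_row power_add power2_eq_square)
    qed (simp add: T'_def weight_left_0)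
    have T2': "T' (i + 1) x = q ^ (2 * P + 2 * S + 2 * a) * cint q (Suc a) * (1 + q^2 * cint q ?b) * f \<zeta>"
      unfolding T'_def weight_below_def weight_left_def fd s4
      by (simp add: Suc S_def conv_row cint_Suc[OF q] power_add)
    show ?thesis
      unfolding T1 T2 T1' T2' by (simp add: algebra_simps)
  qed
  show ?thesis
    unfolding hop_right_def convert_def sum_distrib_left
    using sum_eq_two_exceptions[of "{..n}" "{1..L}" i "i + 1" "x + 1" x T T'] gen exc x i
    unfolding T_def T'_def by auto
qed

text \<open>The mirror image, with exceptional pairs (i, x) and (i + 1, x + 1). Since
  \<open>weight_above\<close> counts the other species first, the expansion needed is {m + 1} = {m}
  + q^(2m), and the particle making both moves contributes q to the power 2(a + d), with a and d the
  numbers \<open>?a\<close> and \<open>?d\<close>, in either order.\<close>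

lemma hop_left_convert:
  assumes x: "1 \<le> x" "x < L" and i: "i < n"
  shows "hop_left q n x (convert q L i f) \<xi> = convert q L i (hop_left q n x f) \<xi>"
proof -
  define T where "T p y = weight_above q n p (\<xi> (x + 1)) * (weight_left q i y (hop (x + 1) x p \<xi>) *
    f (conv y i (i + 1) (hop (x + 1) x p \<xi>)))" for p y
  define T' where "T' p y = weight_left q i y \<xi> * (weight_above q n p (conv y i (i + 1) \<xi> (x + 1)) *
    f (hop (x + 1) x p (conv y i (i + 1) \<xi>)))" for p y
  have gen: "T p y = T' p y" if ne: "(p, y) \<noteq> (i, x)" "(p, y) \<noteq> (i + 1, x + 1)" for p y
  proof -
    have cell0: "weight_above q n p (conv y i (i + 1) \<xi> (x + 1)) = 0" if "\<xi> (x + 1) p = 0"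
      using that \<open>(p, y) \<noteq> (i + 1, x + 1)\<close> by (intro weight_above_0) (auto simp: conv_def)
    have cell1: "weight_left q i y (hop (x + 1) x p \<xi>) = 0" if "\<xi> y i = 0"
      using that \<open>(p, y) \<noteq> (i, x)\<close> by (intro weight_left_0) (auto simp: hop_def)
    consider "\<xi> (x + 1) p = 0" | "\<xi> y i = 0" | "\<xi> (x + 1) p \<ge> 1" "\<xi> y i \<ge> 1"
      by linarith
    then show ?thesis
    proof cases
      case 1
      then show ?thesis using cell0 by (simp add: T_def T'_def weight_above_0)
    next
      case 2
      then show ?thesis using cell1 by (simp add: T_def T'_def weight_left_0)
    next
      case 3
      have c: "conv y i (i + 1) (hop (x + 1) x p \<xi>) = hop (x + 1) x p (conv y i (i + 1) \<xi>)"
        by (rule conv_hop_commute) (use ne in auto)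
      consider "p = i" "y = x + 1" | "p = i" "y \<noteq> x" "y \<noteq> x + 1" | "p = i + 1" "y \<noteq> x + 1" | "p \<noteq> i" "p \<noteq> i + 1"
        using ne by auto
      then have "weight_above q n p (\<xi> (x + 1)) * weight_left q i y (hop (x + 1) x p \<xi>) =
          weight_left q i y \<xi> * weight_above q n p (conv y i (i + 1) \<xi> (x + 1))"
      proof cases
        case 1
        \<comment> \<open>Both orders gain one factor q^2: the hop adds a particle of species i to
          the left of x + 1, and the conversion adds one to the species above i.\<close>
        have "(\<Sum>z=1..<x. hop (x + 1) x i \<xi> z i) = (\<Sum>z=1..<x. \<xi> z i)"
          by (intro sum.cong) (auto simp: hop_def)
        then have 2: "(\<Sum>z=1..<x+1. hop (x + 1) x i \<xi> z i) = (\<Sum>z=1..<x+1. \<xi> z i) + 1"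
          using x by (simp add: hop_row)
        have "sum ((\<xi> (x + 1))(i := \<xi> (x + 1) i - 1, i + 1 := \<xi> (x + 1) (i + 1) + 1)) {i+1..n} + of_bool (i \<in> {i+1..n})
            = sum (\<xi> (x + 1)) {i+1..n} + of_bool (i + 1 \<in> {i+1..n})"
          by (rule sum_shift_unit) (use 1 3 in auto)
        then have 3: "(\<Sum>j=i+1..n. conv (x + 1) i (i + 1) \<xi> (x + 1) j) = (\<Sum>j=i+1..n. \<xi> (x + 1) j) + 1"
          using i by (simp add: conv_row)
        show ?thesis
          unfolding 1 weight_above_def weight_left_def 2 3 by (simp add: conv_row hop_row)
      next
        case 2
        then show ?thesis
          using weight_left_hop[of p i y "x + 1" x \<xi> q] 3 x by (simp add: conv_other_row)
      next
        case 3
        then show ?thesis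
          using weight_left_hop[of p i y "x + 1" x \<xi> q] \<open>\<xi> (x + 1) p \<ge> 1\<close> x by (simp add: conv_other_row)
      next
        case 4
        then show ?thesis
          using weight_left_hop[of p i y "x + 1" x \<xi> q] weight_above_conv[of p i \<xi> y n q "x + 1"] 3 x i by simp
      qed
      then show ?thesis
        unfolding T_def T'_def c mult.assoc[symmetric] by simp
    qed
  qed
  have exc: "T i x + T (i + 1) (x + 1) = T' i x + T' (i + 1) (x + 1)"
  proof (cases "\<xi> (x + 1) i = 0")
    case True
    then show ?thesis
      by (simp add: T_def T'_def weight_above_0 weight_left_0 conv_other_row hop_column)
  next
    case False
    define \<zeta> where "\<zeta> = \<xi>(x + 1 := (\<xi> (x + 1))(i := \<xi> (x + 1) i - 1), x := (\<xi> x)(i + 1 := \<xi> x (i + 1) + 1))"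
    define P where "P = (\<Sum>j=i+2..n. \<xi> (x + 1) j)"
    define S where "S = (\<Sum>z=1..<x. \<xi> z i)"
    let ?a = "\<xi> x i" and ?c = "\<xi> (x + 1) i" and ?d = "\<xi> (x + 1) (i + 1)"
    have fa: "f (conv x i (i + 1) (hop (x + 1) x i \<xi>)) = f \<zeta>"
      by (rule arg_cong[of _ _ f]) (auto simp: \<zeta>_def conv_def hop_def fun_eq_iff)
    have fb: "?a \<ge> 1 \<Longrightarrow> hop (x + 1) x i (conv x i (i + 1) \<xi>) = \<zeta>"
      by (auto simp: \<zeta>_def conv_def hop_def fun_eq_iff)
    have fc: "?d \<ge> 1 \<Longrightarrow> conv (x + 1) i (i + 1) (hop (x + 1) x (i + 1) \<xi>) = \<zeta>"
      by (auto simp: \<zeta>_def conv_def hop_def fun_eq_iff)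
    have fd: "hop (x + 1) x (i + 1) (conv (x + 1) i (i + 1) \<xi>) = \<zeta>"
      by (auto simp: \<zeta>_def conv_def hop_def fun_eq_iff)
    have s1: "(\<Sum>z=1..<x. hop (x + 1) x i \<xi> z i) = S"
      unfolding S_def by (intro sum.cong) (auto simp: hop_def)
    have s2: "(\<Sum>z=1..<x+1. \<xi> z i) = S + ?a"
      using x by (simp add: S_def)
    have s3: "(\<Sum>z=1..<x+1. hop (x + 1) x (i + 1) \<xi> z i) = S + ?a"
      using s2 by (simp add: hop_column)
    have s4: "(\<Sum>j=i+1..n. \<xi> (x + 1) j) = ?d + P"
      using i by (simp add: P_def sum.atLeast_Suc_atMost)
    have s5: "(\<Sum>j=i+1+1..n. conv (x + 1) i (i + 1) \<xi> (x + 1) j) = P"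
      unfolding P_def by (intro sum.cong) (auto simp: conv_def)
    have s6: "(\<Sum>j=i+1+1..n. \<xi> (x + 1) j) = P"
      by (simp add: P_def)
    have T1: "T i x = q ^ (2 * P + 2 * S + 2 * ?d) * cint q ?c * (cint q ?a + q ^ (2 * ?a)) * f \<zeta>"
      unfolding T_def weight_above_def weight_left_def fa s1 s4
      using cint_add[OF q, of ?a 1] cint_Suc[OF q, of 0] by (simp add: hop_row power_add)
    have T2: "T (i + 1) (x + 1) = q ^ (2 * P + 2 * S + 2 * ?a) * cint q ?c * cint q ?d * f \<zeta>"
    proof (cases "?d = 0")
      case False
      then show ?thesis
        using fc unfolding T_def weight_above_def weight_left_def s3 s6
        by (simp add: hop_column power_add)
    qed (simp add: T_def weight_above_0)
    have T1': "T' i x = q ^ (2 * P + 2 * S + 2 * ?d) * cint q ?c * cint q ?a * f \<zeta>"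
    proof (cases "?a = 0")
      case False
      have "conv x i (i + 1) \<xi> (x + 1) = \<xi> (x + 1)"
        by (simp add: conv_other_row)
      then show ?thesis
        using fb False unfolding T'_def weight_above_def weight_left_def
        by (simp only: s4 S_def[symmetric]) (simp add: power_add)
    qed (simp add: T'_def weight_left_0)
    have T2': "T' (i + 1) (x + 1) = q ^ (2 * P + 2 * S + 2 * ?a) * cint q ?c * (cint q ?d + q ^ (2 * ?d)) * f \<zeta>"
      unfolding T'_def weight_above_def weight_left_def fd s5 s2
      using cint_add[OF q, of ?d 1] cint_Suc[OF q, of 0] by (simp add: conv_row power_add)
    show ?thesis
      unfolding T1 T2 T1' T2' by (simp add: algebra_simps power_add)
  qed
  show ?thesis
    unfolding hop_left_def convert_def sum_distrib_left
    using sum_eq_two_exceptions[of "{..n}" "{1..L}" i "i + 1" x "x + 1" T T'] gen exc x i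
    unfolding T_def T'_def by auto
qed

end

section \<open>The generator\<close>

lemma power_int_add_nat:
  fixes q :: real
  assumes "0 < q"
  shows "q powi (k + int m) = q powi k * q ^ m"
proof -
  have "q powi (k + int m) = q powi k * q powi int m"
    using assms by (intro power_int_add) auto
  then show ?thesis
    by (simp only: power_int_of_nat)
qed

lemma hop_total:
  assumes "1 \<le> x" "1 \<le> x'" "x \<le> L" "x' \<le> L" "x \<noteq> x'" "\<xi> x p \<ge> 1"
  shows "(\<Sum>z=1..L. hop x x' p \<xi> z j) = (\<Sum>z=1..L. \<xi> z j)"
proof (cases "j = p")
  case True
  have "sum ((\<lambda>z. \<xi> z p)(x := \<xi> x p - 1, x' := \<xi> x' p + 1)) {1..L} + of_bool (x \<in> {1..L}) =
      sum (\<lambda>z. \<xi> z p) {1..L} + of_bool (x' \<in> {1..L})"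
    by (rule sum_shift_unit) (use assms in auto)
  then have "sum (\<lambda>z. hop x x' p \<xi> z p) {1..L} = sum (\<lambda>z. \<xi> z p) {1..L}"
    unfolding hop_column(1)[OF assms(5)] using assms by simp
  then show ?thesis using True by simp
qed (simp add: hop_column)

lemma exch_eq_hop:
  assumes "k \<noteq> l" "\<xi> x k \<ge> 1" "\<xi> (x + 1) l \<ge> 1"
  shows "exch x k l \<xi> = hop (x + 1) x l (hop x (x + 1) k \<xi>)"
  using assms by (intro ext) (auto simp: exch_def hop_def)

lemma hop_back:
  assumes "x \<noteq> x'" "\<xi> x p \<ge> 1"
  shows "hop x' x p (hop x x' p \<xi>) = \<xi>"
  using assms by (intro ext) (auto simp: hop_def)

lemma exch_total:
  assumes "1 \<le> x" "x < L" "k \<noteq> l"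
  shows "(\<Sum>z=1..L. exch x k l \<xi> z j) = (\<Sum>z=1..L. \<xi> z j)"
proof (cases "\<xi> x k \<ge> 1 \<and> \<xi> (x + 1) l \<ge> 1")
  case True
  have "hop x (x + 1) k \<xi> (x + 1) l \<ge> 1"
    using True by (auto simp: hop_def)
  then show ?thesis
    using exch_eq_hop[of k l \<xi> x] hop_total[of "x + 1" x L "hop x (x + 1) k \<xi>" l j]
      hop_total[of x "x + 1" L \<xi> k j] True assms by simp
next
  case False
  then have "exch x k l \<xi> = \<xi>"
    by (auto simp: exch_def)
  then show ?thesis by simp
qed

lemma sum_off_diagonal:
  fixes g :: "nat \<Rightarrow> nat \<Rightarrow> real"
  assumes "\<And>p. g p p = 0"
  shows "(\<Sum>p\<le>n. \<Sum>r\<le>n. g p r) = (\<Sum>(k,l)\<in>{(k,l). k < l \<and> l \<le> n}. g k l + g l k)"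
proof -
  let ?U = "{(k,l). k < l \<and> l \<le> n}"
  have fin: "finite ?U"
    by (rule finite_subset[of _ "{..n} \<times> {..n}"]) auto
  have "(\<Sum>p\<le>n. \<Sum>r\<le>n. g p r) = (\<Sum>(p,r)\<in>{..n} \<times> {..n}. g p r)"
    by (rule sum.cartesian_product)
  also have "\<dots> = (\<Sum>(p,r)\<in>?U \<union> prod.swap ` ?U. g p r)"
  proof (rule sum.mono_neutral_right)
    show "\<forall>u\<in>{..n} \<times> {..n} - (?U \<union> prod.swap ` ?U). (case u of (p, r) \<Rightarrow> g p r) = 0"
    proof
      fix u assume u: "u \<in> {..n} \<times> {..n} - (?U \<union> prod.swap ` ?U)"
      obtain p r where pr: "u = (p, r)"
        by (cases u)
      have "p = r"
        using u unfolding pr by (cases p r rule: linorder_cases) (auto simp: image_iff)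
      then show "(case u of (p, r) \<Rightarrow> g p r) = 0"
        using assms pr by simp
    qed
  qed auto
  also have "\<dots> = (\<Sum>(p,r)\<in>?U. g p r) + (\<Sum>(p,r)\<in>prod.swap ` ?U. g p r)"
    by (rule sum.union_disjoint) (use fin in auto)
  also have "(\<Sum>(p,r)\<in>prod.swap ` ?U. g p r) = (\<Sum>(k,l)\<in>?U. g l k)"
    by (subst sum.reindex) (auto simp: case_prod_unfold)
  finally show ?thesis
    by (simp add: sum.distrib case_prod_unfold)
qed

context
  fixes q :: real and n L :: nat
  assumes q: "0 < q" "q < 1"
begin

text \<open>An exchange is a hop of p to the right followed by a hop of r to the left. For r = p the
  configuration returns and the term vanishes. The prefactors q^(-1) and q of the two rates differ
  by q^2 because for r < p the arriving particle is counted among the species above r.\<close>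

lemma gen_bond_eq_sum:
  "gen_bond q n x f \<xi> = (\<Sum>p\<le>n. \<Sum>r\<le>n. weight_below q p (\<xi> x) * weight_above q n r (hop x (x + 1) p \<xi> (x + 1))
      * (f (hop (x + 1) x r (hop x (x + 1) p \<xi>)) - f \<xi>)) / q"
proof -
  define g where "g p r = weight_below q p (\<xi> x) * weight_above q n r (hop x (x + 1) p \<xi> (x + 1))
      * (f (hop (x + 1) x r (hop x (x + 1) p \<xi>)) - f \<xi>)" for p r
  have diag: "g p p = 0" for p
  proof (cases "\<xi> x p = 0")
    case False
    then have "hop (x + 1) x p (hop x (x + 1) p \<xi>) = \<xi>"
      by (intro hop_back) auto
    then show ?thesis by (simp add: g_def)
  qed (simp add: g_def weight_below_0)
  have rate: "g p r / q = q powi (of_bool (r < p) * 2 - 1) * weight_below q p (\<xi> x) * weight_above q n r (\<xi> (x + 1)) * (f (exch x p r \<xi>) - f \<xi>)"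
    if "p \<noteq> r" "p \<le> n" "r \<le> n" for p r
  proof (cases "\<xi> x p = 0 \<or> \<xi> (x + 1) r = 0")
    case True
    then have "weight_below q p (\<xi> x) = 0 \<or> weight_above q n r (\<xi> (x + 1)) = 0 \<and> weight_above q n r (hop x (x + 1) p \<xi> (x + 1)) = 0"
      using that by (auto simp: weight_below_0 weight_above_0 hop_column)
    then show ?thesis by (auto simp: g_def)
  next
    case False
    have "(\<Sum>j=r+1..n. hop x (x + 1) p \<xi> (x + 1) j) = (\<Sum>j=r+1..n. \<xi> (x + 1) j) + of_bool (p \<in> {r+1..n})"
      unfolding hop_row(2) by (rule sum_incr) simp
    moreover have "p \<in> {r+1..n} \<longleftrightarrow> r < p"
      using that by auto
    ultimately have above: "weight_above q n r (hop x (x + 1) p \<xi> (x + 1)) = q ^ (2 * of_bool (r < p)) * weight_above q n r (\<xi> (x + 1))"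
      using that by (simp add: weight_above_def hop_column power_add)
    have pow: "q powi (of_bool (r < p) * 2 - 1) = q ^ (2 * of_bool (r < p)) / q"
      using q by (simp add: power_int_diff of_bool_def)
    have "exch x p r \<xi> = hop (x + 1) x r (hop x (x + 1) p \<xi>)"
      using False that by (intro exch_eq_hop) auto
    then show ?thesis
      unfolding g_def above pow by (simp only: times_divide_eq_left times_divide_eq_right mult_ac)
  qed
  have "(\<Sum>p\<le>n. \<Sum>r\<le>n. g p r) / q = (\<Sum>(k,l)\<in>{(k,l). k < l \<and> l \<le> n}. g k l / q + g l k / q)"
    unfolding sum_off_diagonal[of g, OF diag] by (simp add: sum_divide_distrib case_prod_unfold add_divide_distrib)
  also have "\<dots> = gen_bond q n x f \<xi>"
    unfolding gen_bond_def
  proof (intro sum.cong refl, clarify)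
    fix k l assume kl: "k < l" "l \<le> n"
    have "q powi (- 1 + int (2 * S)) = q powi (-1) * q ^ (2 * S)" for S
      by (rule power_int_add_nat[OF q(1)])
    then have 1: "q powi (- 1 + 2 * int S) = q powi (-1) * q ^ (2 * S)" for S
      by simp
    show "g k l / q + g l k / q = q powi (- 1 + 2 * int (\<Sum>j<k. \<xi> x j)) * cint q (\<xi> x k) *
        q ^ (2 * (\<Sum>j = l + 1..n. \<xi> (x + 1) j)) * cint q (\<xi> (x + 1) l) * (f (exch x k l \<xi>) - f \<xi>) +
        q ^ (1 + 2 * (\<Sum>j<l. \<xi> x j)) * cint q (\<xi> x l) *
        q ^ (2 * (\<Sum>j = k + 1..n. \<xi> (x + 1) j)) * cint q (\<xi> (x + 1) k) * (f (exch x l k \<xi>) - f \<xi>)"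
      unfolding 1 using kl by (subst (1 2) rate) (auto simp: weight_below_def weight_above_def power_add)
  qed
  finally show ?thesis
    by (simp add: g_def)
qed

text \<open>By the telescoping total rates the loss term is multiplication by a function of the two
  site occupancies; the + 1 is the particle in transit.\<close>

lemma gen_bond_eq_hops:
  "gen_bond q n x f \<xi> = (hop_right q n x (hop_left q n x f) \<xi>
      - cint q (\<Sum>j\<le>n. \<xi> x j) * cint q ((\<Sum>j\<le>n. \<xi> (x + 1) j) + 1) * f \<xi>) / q"
proof -
  have tot: "(\<Sum>r\<le>n. weight_above q n r (hop x (x + 1) p \<xi> (x + 1))) = cint q ((\<Sum>j\<le>n. \<xi> (x + 1) j) + 1)" if "p \<le> n" for p
    unfolding sum_weight_above[OF q] hop_row(2) using sum_incr[of "{..n}" "\<xi> (x + 1)" p] that by simp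
  have "(\<Sum>p\<le>n. \<Sum>r\<le>n. weight_below q p (\<xi> x) * weight_above q n r (hop x (x + 1) p \<xi> (x + 1)) * f \<xi>)
      = (\<Sum>p\<le>n. weight_below q p (\<xi> x) * cint q ((\<Sum>j\<le>n. \<xi> (x + 1) j) + 1) * f \<xi>)"
    using tot by (intro sum.cong refl) (simp flip: sum_distrib_left sum_distrib_right)
  also have "\<dots> = cint q (\<Sum>j\<le>n. \<xi> x j) * cint q ((\<Sum>j\<le>n. \<xi> (x + 1) j) + 1) * f \<xi>"
    by (simp add: sum_weight_below[OF q] flip: sum_distrib_right)
  finally show ?thesis
    unfolding gen_bond_eq_sum hop_right_def hop_left_def right_diff_distrib sum_subtractf
    by (simp add: sum_distrib_left mult.assoc)
qed

lemma convert_cmult: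
  assumes "\<And>\<xi> y. y \<in> {1..L} \<Longrightarrow> \<xi> y i \<ge> 1 \<Longrightarrow> c (conv y i (i + 1) \<xi>) = c \<xi>"
  shows "convert q L i (\<lambda>\<xi>. c \<xi> * f \<xi>) \<xi> = c \<xi> * convert q L i f \<xi>"
  unfolding convert_def sum_distrib_left
proof (intro sum.cong refl)
  fix y assume "y \<in> {1..L}"
  then show "weight_left q i y \<xi> * (c (conv y i (i + 1) \<xi>) * f (conv y i (i + 1) \<xi>)) =
      c \<xi> * (weight_left q i y \<xi> * f (conv y i (i + 1) \<xi>))"
    using assms[of y \<xi>] by (cases "\<xi> y i = 0") (auto simp: weight_left_0)
qed

lemma conv_site_total:
  assumes "i < n" "\<xi> y i \<ge> 1"
  shows "(\<Sum>j\<le>n. conv y i (i + 1) \<xi> x j) = (\<Sum>j\<le>n. \<xi> x j)"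
proof (cases "x = y")
  case True
  have "sum ((\<xi> y)(i := \<xi> y i - 1, i + 1 := \<xi> y (i + 1) + 1)) {..n} + of_bool (i \<in> {..n}) =
      sum (\<xi> y) {..n} + of_bool (i + 1 \<in> {..n})"
    by (rule sum_shift_unit) (use assms in auto)
  then show ?thesis using True assms by (simp add: conv_row)
qed (simp add: conv_other_row)

lemma gen_bond_convert:
  assumes "1 \<le> x" "x < L" "i < n"
  shows "gen_bond q n x (convert q L i f) \<xi> = convert q L i (gen_bond q n x f) \<xi>"
proof -
  define c where "c \<xi> = cint q (\<Sum>j\<le>n. \<xi> x j) * cint q ((\<Sum>j\<le>n. \<xi> (x + 1) j) + 1)" for \<xi> :: conf
  have eq: "gen_bond q n x f = (\<lambda>\<xi>. (hop_right q n x (hop_left q n x f) \<xi> - c \<xi> * f \<xi>) / q)" for f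
    by (intro ext) (simp add: gen_bond_eq_hops c_def)
  have hl: "hop_left q n x (convert q L i f) = convert q L i (hop_left q n x f)"
    using hop_left_convert[OF q assms] by (intro ext)
  have "convert q L i (gen_bond q n x f) \<xi> =
      (convert q L i (hop_right q n x (hop_left q n x f)) \<xi> - convert q L i (\<lambda>\<xi>. c \<xi> * f \<xi>) \<xi>) / q"
    unfolding eq by (simp add: convert_def algebra_simps sum_subtractf diff_divide_distrib sum_divide_distrib)
  also have "convert q L i (\<lambda>\<xi>. c \<xi> * f \<xi>) \<xi> = c \<xi> * convert q L i f \<xi>"
    using assms by (intro convert_cmult) (simp only: c_def conv_site_total)
  finally show ?thesis
    unfolding eq hl by (simp add: hop_right_convert[OF q assms])
qed

lemma gen_convert:
  assumes "i < n"
  shows "gen q n L (convert q L i f) \<xi> = convert q L i (gen q n L f) \<xi>"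
proof -
  have "gen q n L (convert q L i f) \<xi> = (\<Sum>x\<in>{1..<L}. convert q L i (gen_bond q n x f) \<xi>)"
    unfolding gen_def by (intro sum.cong refl) (use gen_bond_convert assms in auto)
  also have "\<dots> = convert q L i (gen q n L f) \<xi>"
    unfolding gen_def convert_def by (subst sum.swap) (simp add: sum_distrib_left)
  finally show ?thesis .
qed

end

text \<open>Forgets the rates. Multiplication by conserved totals and dependence on the state space
  alone only need that the generator is a combination of exchange differences.\<close>

lemma gen_bond_rates:
  "\<exists>c. \<forall>f. gen_bond q n x f \<xi> = (\<Sum>(k,l)\<in>{(k,l). k < l \<and> l \<le> n}.
     c k l * (f (exch x k l \<xi>) - f \<xi>) + c l k * (f (exch x l k \<xi>) - f \<xi>))"
  by (rule exI[of _ "\<lambda>k l. (if k < l then q powi (-1 + 2 * int (\<Sum>j<k. \<xi> x j)) else q ^ (1 + 2 * (\<Sum>j<k. \<xi> x j)))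
        * cint q (\<xi> x k) * q ^ (2 * (\<Sum>j=l+1..n. \<xi> (x + 1) j)) * cint q (\<xi> (x + 1) l)"])
     (auto simp: gen_bond_def intro!: sum.cong)

lemma gen_cmult_total:
  "gen q n L (\<lambda>\<xi>. \<phi> (\<lambda>j. \<Sum>x=1..L. \<xi> x j) * f \<xi>) \<xi> = \<phi> (\<lambda>j. \<Sum>x=1..L. \<xi> x j) * gen q n L f \<xi>"
proof -
  let ?c = "\<lambda>\<xi>. \<phi> (\<lambda>j. \<Sum>x=1..L. \<xi> x j)"
  have "gen_bond q n x (\<lambda>\<xi>. ?c \<xi> * f \<xi>) \<xi> = ?c \<xi> * gen_bond q n x f \<xi>" if x: "x \<in> {1..<L}" for x
  proof -
    have e: "?c (exch x k l \<xi>) = ?c \<xi>" if "k \<noteq> l" for k l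
      using that x exch_total[of x L k l \<xi>] by simp
    obtain c where c: "\<And>f. gen_bond q n x f \<xi> = (\<Sum>(k,l)\<in>{(k,l). k < l \<and> l \<le> n}.
        c k l * (f (exch x k l \<xi>) - f \<xi>) + c l k * (f (exch x l k \<xi>) - f \<xi>))"
      using gen_bond_rates by blast
    show ?thesis
      unfolding c sum_distrib_left
    proof (rule sum.cong[OF refl], clarify)
      fix k l :: nat assume "k < l"
      then have "k \<noteq> l" "l \<noteq> k" by auto
      show "c k l * (?c (exch x k l \<xi>) * f (exch x k l \<xi>) - ?c \<xi> * f \<xi>)
          + c l k * (?c (exch x l k \<xi>) * f (exch x l k \<xi>) - ?c \<xi> * f \<xi>)
        = ?c \<xi> * (c k l * (f (exch x k l \<xi>) - f \<xi>) + c l k * (f (exch x l k \<xi>) - f \<xi>))"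
        unfolding e[OF \<open>k \<noteq> l\<close>] e[OF \<open>l \<noteq> k\<close>] by (simp only: distrib_left right_diff_distrib mult.left_commute)
    qed
  qed
  then show ?thesis
    unfolding gen_def sum_distrib_left by (intro sum.cong) auto
qed

section \<open>Reversibility\<close>

text \<open>The polarised exponent of q in G, taken over the integers: a move adds a difference of
  two \<open>cell\<close>s, and bilinearity gives the change of the exponent.\<close>

definition species_form :: "nat \<Rightarrow> nat \<Rightarrow> (nat \<Rightarrow> nat \<Rightarrow> int) \<Rightarrow> (nat \<Rightarrow> nat \<Rightarrow> int) \<Rightarrow> int" where
  "species_form n L u v = (\<Sum>(y, x)\<in>{(y, x). 1 \<le> y \<and> y < x \<and> x \<le> L}. \<Sum>i<n. u y (i + 1) * (\<Sum>j=0..i. v x j))"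

definition cell :: "nat \<Rightarrow> nat \<Rightarrow> nat \<Rightarrow> nat \<Rightarrow> int" where
  "cell x p = (\<lambda>z j. of_bool (z = x \<and> j = p))"

lemma species_form_diff_left: "species_form n L (\<lambda>x i. u x i - u' x i) v = species_form n L u v - species_form n L u' v"
  by (simp add: species_form_def case_prod_unfold left_diff_distrib sum_subtractf)

lemma species_form_diff_right: "species_form n L u (\<lambda>x i. v x i - v' x i) = species_form n L u v - species_form n L u v'"
  by (simp add: species_form_def case_prod_unfold right_diff_distrib sum_subtractf)

lemma species_form_add_left: "species_form n L (\<lambda>x i. u x i + u' x i) v = species_form n L u v + species_form n L u' v"
  by (simp add: species_form_def case_prod_unfold distrib_right sum.distrib)

lemma species_form_add_right: "species_form n L u (\<lambda>x i. v x i + v' x i) = species_form n L u v + species_form n L u v'"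
  by (simp add: species_form_def case_prod_unfold distrib_left sum.distrib)

lemma finite_site_pairs: "finite {(y, z). 1 \<le> y \<and> y < z \<and> z \<le> (L::nat)}"
  by (rule finite_subset[of _ "{..L} \<times> {..L}"]) auto

lemma species_form_cell_right:
  assumes "1 \<le> x" "x \<le> L"
  shows "species_form n L u (cell x p) = (\<Sum>y=1..<x. \<Sum>l=p+1..n. u y l)"
proof -
  have "species_form n L u (cell x p) = (\<Sum>(y, z)\<in>{(y, z). 1 \<le> y \<and> y < z \<and> z \<le> L}. \<Sum>i<n. u y (i + 1) * of_bool (z = x \<and> p \<le> i))"
    unfolding species_form_def cell_def
    by (intro sum.cong refl; clarify; intro sum.cong refl arg_cong[of _ _ "(*) _"])
       (auto simp: of_bool_def sum.delta)
  also have "\<dots> = (\<Sum>(y, z)\<in>{1..<x} \<times> {x}. \<Sum>i<n. u y (i + 1) * of_bool (z = x \<and> p \<le> i))"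
    using assms by (intro sum.mono_neutral_right)
(auto simp: finite_site_pairs[simplified] intro!: sum.neutral)
  also have "\<dots> = (\<Sum>y=1..<x. \<Sum>i<n. u y (i + 1) * of_bool (p \<le> i))"
    by (simp flip: sum.cartesian_product)
  also have "\<dots> = (\<Sum>y=1..<x. \<Sum>l=p+1..n. u y l)"
  proof (rule sum.cong[OF refl])
    fix y
    have "(\<Sum>i<n. u y (i + 1) * of_bool (p \<le> i)) = (\<Sum>i=p..<n. u y (i + 1))"
      by (intro sum.mono_neutral_cong_right) auto
    also have "\<dots> = (\<Sum>l=p+1..n. u y l)"
      by (rule sum.reindex_bij_witness[of _ "\<lambda>l. l - 1" "\<lambda>i. i + 1"]) auto
    finally show "(\<Sum>i<n. u y (i + 1) * of_bool (p \<le> i)) = (\<Sum>l=p+1..n. u y l)" .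
  qed
  finally show ?thesis .
qed

lemma species_form_cell_left:
  assumes "1 \<le> x" "x \<le> L" "p \<le> n"
  shows "species_form n L (cell x p) v = (\<Sum>z=x+1..L. \<Sum>j<p. v z j)"
proof -
  have "species_form n L (cell x p) v = (\<Sum>(y, z)\<in>{(y, z). 1 \<le> y \<and> y < z \<and> z \<le> L}. of_bool (y = x) * (\<Sum>j<p. v z j))"
    unfolding species_form_def cell_def
  proof (intro sum.cong refl, clarify)
    fix y z
    have "(\<Sum>i<n. of_bool (y = x \<and> i + 1 = p) * (\<Sum>j=0..i. v z j)) = (\<Sum>i<n. of_bool (i + 1 = p) * (of_bool (y = x) * (\<Sum>j<p. v z j)))"
      by (intro sum.cong refl) (auto simp: lessThan_Suc_atMost atLeast0AtMost)
    also have "\<dots> = of_bool (y = x) * (\<Sum>j<p. v z j)"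
    proof (cases p)
      case (Suc p')
      then show ?thesis
        using assms(3) by (simp add: of_bool_def if_distrib[of "\<lambda>c. c * _"] cong: if_cong)
    qed simp
    finally show "(\<Sum>i<n. of_bool (y = x \<and> i + 1 = p) * (\<Sum>j=0..i. v z j)) = of_bool (y = x) * (\<Sum>j<p. v z j)" .
  qed
  also have "\<dots> = (\<Sum>(y, z)\<in>{x} \<times> {x+1..L}. of_bool (y = x) * (\<Sum>j<p. v z j))"
    using assms by (intro sum.mono_neutral_right)
(auto simp: finite_site_pairs[simplified])
  also have "\<dots> = (\<Sum>z=x+1..L. \<Sum>j<p. v z j)"
    by (simp flip: sum.cartesian_product)
  finally show ?thesis .
qed

lemma prod_power_int:
  fixes q :: real
  assumes "q \<noteq> 0"
  shows "(\<Prod>x\<in>A. q powi (f x)) = q powi (\<Sum>x\<in>A. f x)"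
  by (induction A rule: infinite_finite_induct) (auto simp: power_int_add assms)

text \<open>Cross-multiplied, so that no factor has to be nonzero.\<close>

lemma prod_two_cells:
  fixes f g :: "'a \<Rightarrow> real"
  assumes "finite S" "a \<in> S" "b \<in> S" "a \<noteq> b" "\<And>c. c \<in> S \<Longrightarrow> c \<noteq> a \<Longrightarrow> c \<noteq> b \<Longrightarrow> f c = g c"
  shows "prod f S * (g a * g b) = prod g S * (f a * f b)"
proof -
  have S: "S = insert a (insert b (S - {a, b}))"
    using assms by auto
  have "prod f (S - {a, b}) = prod g (S - {a, b})"
    using assms by (intro prod.cong) auto
  then show ?thesis
    using assms by (subst (1 2) S) (simp add: mult_ac)
qed

definition site_prod :: "nat \<Rightarrow> nat \<Rightarrow> (nat \<Rightarrow> real) \<Rightarrow> conf \<Rightarrow> real" where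
  "site_prod n L \<phi> \<xi> = (\<Prod>i=0..n. \<Prod>x=1..L. \<phi> (\<xi> x i))"

lemma site_prod_two_cells:
  assumes "(i, x) \<noteq> (i', x')" "i \<le> n" "i' \<le> n" "x \<in> {1..L}" "x' \<in> {1..L}"
    and "\<And>j z. (j, z) \<noteq> (i, x) \<Longrightarrow> (j, z) \<noteq> (i', x') \<Longrightarrow> \<zeta> z j = \<xi> z j"
  shows "site_prod n L \<phi> \<zeta> * (\<phi> (\<xi> x i) * \<phi> (\<xi> x' i')) = site_prod n L \<phi> \<xi> * (\<phi> (\<zeta> x i) * \<phi> (\<zeta> x' i'))"
proof -
  have "site_prod n L \<phi> \<xi> = (\<Prod>c\<in>{0..n} \<times> {1..L}. \<phi> (\<xi> (snd c) (fst c)))" for \<xi>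
    unfolding site_prod_def by (simp add: prod.cartesian_product case_prod_unfold)
  then show ?thesis
    using prod_two_cells[of "{0..n} \<times> {1..L}" "(i, x)" "(i', x')"
        "\<lambda>c. \<phi> (\<zeta> (snd c) (fst c))" "\<lambda>c. \<phi> (\<xi> (snd c) (fst c))"] assms by force
qed

abbreviation "self_form n L \<xi> \<equiv> species_form n L (\<lambda>x i. int (\<xi> x i)) (\<lambda>x i. int (\<xi> x i))"

text \<open>Bilinear expansion for the displacement u - v. The last summand is the interaction of
  the displacement with itself; it vanishes in both applications, but for different reasons.\<close>

lemma self_form_increment:
  assumes "\<And>z j. int (\<zeta> z j) = int (\<xi> z j) + (u z j - v z j)"
  shows "self_form n L \<zeta> = self_form n L \<xi>
     + (species_form n L (\<lambda>x i. int (\<xi> x i)) u - species_form n L (\<lambda>x i. int (\<xi> x i)) v)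
     + (species_form n L u (\<lambda>x i. int (\<xi> x i)) - species_form n L v (\<lambda>x i. int (\<xi> x i)))
     + (species_form n L (\<lambda>x i. u x i - v x i) u - species_form n L (\<lambda>x i. u x i - v x i) v)"
  unfolding assms
  by (simp add: species_form_add_left species_form_add_right species_form_diff_left species_form_diff_right)

lemma self_form_hop:
  assumes "1 \<le> x" "x < L" "p \<le> n" "\<xi> x p \<ge> 1"
  shows "self_form n L (hop x (x + 1) p \<xi>) = self_form n L \<xi> + int (\<Sum>l=p+1..n. \<xi> x l) - int (\<Sum>j<p. \<xi> (x + 1) j)"
proof -
  have e: "int (hop x (x + 1) p \<xi> z j) = int (\<xi> z j) + (cell (x + 1) p z j - cell x p z j)" for z j
    using assms by (auto simp: hop_def cell_def)
  have s: "{1..<x+1} = insert x {1..<x}" "{x+1..L} = insert (x + 1) {x+1+1..L}"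
    using assms by auto
  have "x + 1 \<le> L" "1 \<le> x + 1" "x \<le> L"
    using assms by auto
  note c = species_form_cell_right[OF assms(1) this(3)] species_form_cell_right[OF this(2,1)]
    species_form_cell_left[OF assms(1) this(3) assms(3)] species_form_cell_left[OF this(2,1) assms(3)]
  \<comment> \<open>The form pairs only distinct species, and both cells of the displacement carry
    species p.\<close>
  have z: "(\<Sum>l=p+1..n. cell (x + 1) p x l - cell x p x l) = 0"
    by (intro sum.neutral) (auto simp: cell_def)
  show ?thesis
    unfolding self_form_increment[of "hop x (x + 1) p \<xi>" \<xi> "cell (x + 1) p" "cell x p", OF e] c s
    using z by simp
qed

lemma self_form_conv:
  assumes "1 \<le> y" "y \<le> L" "i < n" "\<xi> y i \<ge> 1"
  shows "self_form n L (conv y i (i + 1) \<xi>) = self_form n L \<xi> - int (\<Sum>z=1..<y. \<xi> z (i + 1)) + int (\<Sum>z=y+1..L. \<xi> z i)"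
proof -
  have e: "int (conv y i (i + 1) \<xi> z j) = int (\<xi> z j) + (cell y (i + 1) z j - cell y i z j)" for z j
    using assms by (auto simp: conv_def cell_def)
  have s: "{i+1..n} = insert (i + 1) {i+1+1..n}" "{..<i+1} = insert i {..<i}"
    using assms by auto
  have le: "i \<le> n" "i + 1 \<le> n"
    using assms by auto
  note c = species_form_cell_right[OF assms(1,2)]
    species_form_cell_left[OF assms(1,2) le(1)] species_form_cell_left[OF assms(1,2) le(2)]
  \<comment> \<open>The form pairs only distinct sites, and both cells of the displacement lie at
    y.\<close>
  have z: "(\<Sum>z=1..<y. \<Sum>l=p..n. cell y (i + 1) z l - cell y i z l) = 0" for p
    by (intro sum.neutral) (auto simp: cell_def)
  show ?thesis
    unfolding self_form_increment[of "conv y i (i + 1) \<xi>" \<xi> "cell y (i + 1)" "cell y i", OF e] c z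
    unfolding s by (simp add: sum.distrib)
qed

section \<open>The reversible weight and its behaviour under one hop\<close>

lemma qfact_Suc: "qfact q (Suc m) = qfact q m * qint q (Suc m)"
  by (simp add: qfact_def)

lemma cfact_Suc: "cfact q (Suc m) = cfact q m * cint q (Suc m)"
  by (simp add: cfact_def)

context
  fixes q :: real
  assumes q: "0 < q" "q < 1"
begin

lemma qint_Suc: "qint q (Suc m) = cint q (Suc m) / q ^ m"
proof -
  have q2: "1 - q^2 \<noteq> 0"
    by (rule one_minus_square_neq_0[OF q])
  have "q powi (int (Suc m)) - q powi (- int (Suc m)) = (q ^ (2 * Suc m) - 1) / (q * q ^ m)"
    using q by (simp add: power_int_minus power_int_of_nat divide_simps power_add[symmetric] power_Suc[symmetric]
        del: of_nat_Suc power_Suc) (simp add: mult_2)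
  moreover have "q - inverse q = (q^2 - 1) / q"
    using q by (simp add: divide_simps power2_eq_square)
  ultimately have "qint q (Suc m) = (q ^ (2 * Suc m) - 1) / (q^2 - 1) / q ^ m"
    unfolding qint_def using q by simp
  also have "(q ^ (2 * Suc m) - 1) / (q^2 - 1) = cint q (Suc m)"
    unfolding cint_def by (metis minus_diff_eq minus_divide_divide)
  finally show ?thesis .
qed

lemma qint_pos: "m > 0 \<Longrightarrow> qint q m > 0"
  using q cint_pos[OF q] by (cases m) (auto simp: qint_Suc)

lemma qfact_pos: "qfact q m > 0"
  unfolding qfact_def by (intro prod_pos) (auto intro: qint_pos)

lemma cfact_pos: "cfact q m > 0"
  unfolding cfact_def by (intro prod_pos) (auto intro: cint_pos[OF q])

lemma Gd_eq: "Gd q n L \<xi> = site_prod n L (\<lambda>m. 1 / qfact q m) \<xi> * q powi (- self_form n L \<xi>)"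
proof -
  have "(\<Prod>(y, x)\<in>{(y, x). 1 \<le> y \<and> y < x \<and> x \<le> L}. \<Prod>i<n. q powi (- int (\<xi> y (i + 1) * (\<Sum>j=0..i. \<xi> x j))))
      = q powi (- self_form n L \<xi>)"
    using q by (simp add: prod_power_int case_prod_unfold species_form_def sum_negf)
  then show ?thesis
    unfolding Gd_def site_prod_def by simp
qed

lemma site_prod_pos: "(\<And>m. \<phi> m > 0) \<Longrightarrow> site_prod n L \<phi> \<xi> > 0"
  unfolding site_prod_def by (intro prod_pos) auto

lemma Gd_pos: "Gd q n L \<xi> > 0"
  unfolding Gd_eq using q qfact_pos by (intro mult_pos_pos site_prod_pos) auto

lemma Bd_pos: "Bd q n L \<xi> > 0"
  unfolding Bd_def by (intro prod_pos) (auto intro!: prod_pos cfact_pos)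

lemma Bd_square: "inverse ((Bd q n L \<xi>)^2) = site_prod n L (cfact q) \<xi>"
proof -
  have "(Bd q n L \<xi>)^2 = (\<Prod>x=1..L. 1 / (\<Prod>i=0..n. cfact q (\<xi> x i)))"
    unfolding Bd_def prod_power_distrib
    by (intro prod.cong refl) (auto simp: power_divide intro!: prod_nonneg less_imp_le[OF cfact_pos])
  then show ?thesis
    by (simp add: site_prod_def prod_dividef prod.swap[of _ "{0..n}"])
qed

definition rev_weight :: "nat \<Rightarrow> nat \<Rightarrow> conf \<Rightarrow> real" where
  "rev_weight n L \<xi> = (Gd q n L \<xi>)^2 * inverse ((Bd q n L \<xi>)^2)"

lemma rev_weight_pos: "rev_weight n L \<xi> > 0"
  unfolding rev_weight_def by (intro mult_pos_pos positive_imp_inverse_positive zero_less_power Gd_pos Bd_pos)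

lemma rev_weight_eq:
  "rev_weight n L \<xi> = site_prod n L (\<lambda>m. cfact q m / (qfact q m)^2) \<xi> * q powi (- 2 * self_form n L \<xi>)"
proof -
  have "q powi (- 2 * self_form n L \<xi>) = (q powi (- self_form n L \<xi>))^2"
    using q by (simp add: power2_eq_square flip: power_int_add)
  then show ?thesis
    unfolding rev_weight_def Gd_eq Bd_square
    by (simp add: site_prod_def power_mult_distrib prod_dividef power_divide prod_power_distrib)
qed

text \<open>A hop changes the occupancies of both sites, so it balances only up to powers of q:
  twice the occupancy of x before the hop and of x + 1 after it, hence the + 2. An exchange restores
  the occupancies, and the powers drop out.\<close>

lemma hop_detailed_balance:
  assumes "1 \<le> x" "x < L" "p \<le> n" "\<xi> x p \<ge> 1"
  defines "\<zeta> \<equiv> hop x (x + 1) p \<xi>"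
  shows "rev_weight n L \<xi> * weight_below q p (\<xi> x) * q ^ (2 * (\<Sum>j\<le>n. \<xi> (x + 1) j) + 2)
     = q ^ (2 * (\<Sum>j\<le>n. \<xi> x j)) * (rev_weight n L \<zeta> * weight_above q n p (\<zeta> (x + 1)))"
proof -
  define \<phi> where "\<phi> m = cfact q m / (qfact q m)^2" for m
  define SX where "SX = site_prod n L \<phi> \<xi>"
  define SZ where "SZ = site_prod n L \<phi> \<zeta>"
  obtain a where a: "\<xi> x p = Suc a"
    using assms(4) by (cases "\<xi> x p") auto
  let ?b = "\<xi> (x + 1) p"
  have \<phi>_pos: "\<phi> m > 0" for m
    unfolding \<phi>_def by (intro divide_pos_pos zero_less_power qfact_pos cfact_pos)
  have \<phi>_Suc: "\<phi> (Suc m) * cint q (Suc m) = \<phi> m * q ^ (2 * m)" for m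
    using qfact_pos[of m] cint_pos[OF q, of "Suc m"] q
    by (simp add: \<phi>_def qfact_Suc cfact_Suc qint_Suc power_mult_distrib power_divide power2_eq_square power_mult[symmetric] divide_simps)
       (simp add: mult_2_right power_add mult_ac)
  define AL where "AL = (\<Sum>j<p. \<xi> x j)"
  define AR where "AR = (\<Sum>l=p+1..n. \<xi> x l)"
  define BL where "BL = (\<Sum>j<p. \<xi> (x + 1) j)"
  define BR where "BR = (\<Sum>l=p+1..n. \<xi> (x + 1) l)"
  have split: "(\<Sum>j\<le>n. g j) = (\<Sum>j<p. g j) + g p + (\<Sum>l=p+1..n. g l)" for g :: "nat \<Rightarrow> nat"
  proof -
    have "{..n} = insert p ({..<p} \<union> {p+1..n})"
      using assms(3) by auto
    moreover have "sum g ({..<p} \<union> {p+1..n}) = sum g {..<p} + sum g {p+1..n}"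
      by (rule sum.union_disjoint) auto
    ultimately show ?thesis
      by simp
  qed
  have A: "(\<Sum>j\<le>n. \<xi> x j) = AL + Suc a + AR" and B: "(\<Sum>j\<le>n. \<xi> (x + 1) j) = BL + ?b + BR"
    unfolding split AL_def AR_def BL_def BR_def a by (rule refl)+
  have "SZ * (\<phi> (\<xi> x p) * \<phi> ?b) = SX * (\<phi> (\<zeta> x p) * \<phi> (\<zeta> (x + 1) p))"
    unfolding SZ_def SX_def using assms(1-4) by (intro site_prod_two_cells) (auto simp: \<zeta>_def hop_def)
  then have S: "SZ * (\<phi> (Suc a) * \<phi> ?b) = SX * (\<phi> a * \<phi> (Suc ?b))"
    by (simp add: \<zeta>_def hop_row a)
  have "(SZ * q ^ (2 * a) * cint q (Suc ?b)) * (\<phi> a * \<phi> ?b)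
      = SZ * (\<phi> (Suc a) * \<phi> ?b) * (cint q (Suc a) * cint q (Suc ?b))"
    using \<phi>_Suc[of a] by (simp add: mult_ac)
  also have "\<dots> = (SX * q ^ (2 * ?b) * cint q (Suc a)) * (\<phi> a * \<phi> ?b)"
    unfolding S using \<phi>_Suc[of ?b] by (simp add: mult_ac)
  finally have SS: "SZ * q ^ (2 * a) * cint q (Suc ?b) = SX * q ^ (2 * ?b) * cint q (Suc a)"
    using \<phi>_pos[of a] \<phi>_pos[of ?b] by simp
  have "- 2 * self_form n L \<xi> + int (2 * BL) = - 2 * self_form n L \<zeta> + int (2 * AR)"
    unfolding \<zeta>_def AR_def BL_def using self_form_hop[of x L p n \<xi>, OF assms(1-4)] by simp
  then have "q powi (- 2 * self_form n L \<xi> + int (2 * BL)) = q powi (- 2 * self_form n L \<zeta> + int (2 * AR))"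
    by simp
  then have W: "q powi (- 2 * self_form n L \<xi>) * q ^ (2 * BL) = q powi (- 2 * self_form n L \<zeta>) * q ^ (2 * AR)"
    by (simp only: power_int_add_nat[OF q(1)])
  have "weight_above q n p (\<zeta> (x + 1)) = q ^ (2 * BR) * cint q (Suc ?b)"
  proof -
    have "(\<Sum>j=p+1..n. \<zeta> (x + 1) j) = BR"
      unfolding \<zeta>_def BR_def by (intro sum.cong) (auto simp: hop_def)
    then show ?thesis
      by (simp add: weight_above_def \<zeta>_def hop_row)
  qed
  moreover have "weight_below q p (\<xi> x) = q ^ (2 * AL) * cint q (Suc a)"
    by (simp add: weight_below_def AL_def a)
  moreover have "(SX * X) * (q ^ (2 * AL) * cint q (Suc a)) * q ^ (2 * (BL + ?b + BR) + 2)
      = q ^ (2 * (AL + Suc a + AR)) * ((SZ * Z) * (q ^ (2 * BR) * cint q (Suc ?b)))"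
    if "X * q ^ (2 * BL) = Z * q ^ (2 * AR)" for X Z
  proof -
    have "(SX * X) * (q ^ (2 * AL) * cint q (Suc a)) * q ^ (2 * (BL + ?b + BR) + 2)
        = (SX * q ^ (2 * ?b) * cint q (Suc a)) * (X * q ^ (2 * BL)) * (q ^ (2 * AL) * q ^ (2 * BR) * q^2)"
      by (simp only: distrib_left power_add mult_ac)
    also have "\<dots> = q ^ (2 * (AL + Suc a + AR)) * ((SZ * Z) * (q ^ (2 * BR) * cint q (Suc ?b)))"
      unfolding SS[symmetric] that by (simp add: power_add power2_eq_square mult_ac)
    finally show ?thesis .
  qed
  ultimately show ?thesis
    unfolding rev_weight_eq \<phi>_def[symmetric] SX_def[symmetric] SZ_def[symmetric] A B using W by simp
qed

end

section \<open>Self-duality from an intertwining relation\<close>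

lemma finite_confs: "finite (confs n L \<theta>)"
proof -
  let ?M = "\<Sum>x=1..L. \<theta> x"
  let ?B = "{g :: nat \<Rightarrow> nat. \<forall>i. (i \<in> {0..n} \<longrightarrow> g i \<in> {..?M}) \<and> (i \<notin> {0..n} \<longrightarrow> g i = 0)}"
  have "finite ?B"
    by (rule finite_set_of_finite_funs) auto
  then have "finite {\<xi> :: conf. \<forall>x. (x \<in> {1..L} \<longrightarrow> \<xi> x \<in> ?B) \<and> (x \<notin> {1..L} \<longrightarrow> \<xi> x = (\<lambda>_. 0))}"
    by (rule finite_set_of_finite_funs[OF finite_atLeastAtMost])
  moreover have "confs n L \<theta> \<subseteq> {\<xi>. \<forall>x. (x \<in> {1..L} \<longrightarrow> \<xi> x \<in> ?B) \<and> (x \<notin> {1..L} \<longrightarrow> \<xi> x = (\<lambda>_. 0))}"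
  proof (intro subsetI CollectI allI conjI impI)
    fix \<xi> x i
    assume \<xi>: "\<xi> \<in> confs n L \<theta>" and x: "x \<in> {1..L}" and i: "i \<in> {0..n}"
    have "\<xi> x i \<le> (\<Sum>i=0..n. \<xi> x i)"
      using i by (intro member_le_sum) auto
    also have "\<dots> = \<theta> x"
      using \<xi> x by (simp add: confs_def)
    also have "\<dots> \<le> ?M"
      using x by (intro member_le_sum) auto
    finally show "\<xi> x i \<in> {..?M}" by simp
  qed (auto simp: confs_def)
  ultimately show ?thesis
    by (rule finite_subset[rotated])
qed

lemma conv_in_confs:
  assumes "\<xi> \<in> confs n L \<theta>" "y \<in> {1..L}" "i \<le> n" "j \<le> n" "i \<noteq> j" "\<xi> y i \<ge> 1"
  shows "conv y i j \<xi> \<in> confs n L \<theta>"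
proof -
  have "sum ((\<xi> y)(i := \<xi> y i - 1, j := \<xi> y j + 1)) {0..n} + of_bool (i \<in> {0..n}) = sum (\<xi> y) {0..n} + of_bool (j \<in> {0..n})"
    by (rule sum_shift_unit) (use assms in auto)
  then have "sum (conv y i j \<xi> y) {0..n} = sum (\<xi> y) {0..n}"
    using assms by (simp add: conv_row)
  then have "sum (conv y i j \<xi> x) {0..n} = sum (\<xi> x) {0..n}" for x
    by (cases "x = y") (simp_all add: conv_other_row)
  moreover have "conv y i j \<xi> x k = 0" if "x \<notin> {1..L} \<or> k \<notin> {0..n}" for x k
    using that assms by (auto simp: confs_def conv_def)
  ultimately show ?thesis
    using assms(1) by (simp add: confs_def)
qed

lemma exch_in_confs:
  assumes "\<xi> \<in> confs n L \<theta>" "x \<in> {1..<L}" "k \<le> n" "l \<le> n" "k \<noteq> l"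
  shows "exch x k l \<xi> \<in> confs n L \<theta>"
proof (cases "\<xi> x k \<ge> 1 \<and> \<xi> (x + 1) l \<ge> 1")
  case True
  then have "exch x k l \<xi> = conv x k l (conv (x + 1) l k \<xi>)"
    using assms(5) by (intro ext) (auto simp: exch_def conv_def)
  moreover have "conv (x + 1) l k \<xi> x k \<ge> 1"
    using True by (simp add: conv_def)
  ultimately show ?thesis
    using assms True by (auto intro!: conv_in_confs)
next
  case False
  then have "exch x k l \<xi> = \<xi>"
    by (auto simp: exch_def)
  then show ?thesis using assms by simp
qed

section \<open>The generator as a matrix on the finite state space\<close>

lemma gen_add: "gen q n L (\<lambda>\<zeta>. f \<zeta> + g \<zeta>) \<xi> = gen q n L f \<xi> + gen q n L g \<xi>"
  unfolding gen_def gen_bond_def sum.distrib[symmetric]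
  by (intro sum.cong refl) (simp add: case_prod_unfold algebra_simps)

lemma gen_cmult: "gen q n L (\<lambda>\<zeta>. c * f \<zeta>) \<xi> = c * gen q n L f \<xi>"
  using gen_cmult_total[of q n L "\<lambda>_. c" f \<xi>] by simp

lemma gen_sum: "finite S \<Longrightarrow> gen q n L (\<lambda>\<zeta>. \<Sum>\<eta>\<in>S. c \<eta> * f \<eta> \<zeta>) \<xi> = (\<Sum>\<eta>\<in>S. c \<eta> * gen q n L (f \<eta>) \<xi>)"
proof (induction S rule: finite_induct)
  case empty
  then show ?case
    using gen_cmult[of q n L 0 "\<lambda>_. 0" \<xi>] by simp
qed (simp add: gen_add gen_cmult)

lemma gen_cong:
  assumes "\<xi> \<in> confs n L \<theta>" "\<And>\<eta>. \<eta> \<in> confs n L \<theta> \<Longrightarrow> f \<eta> = g \<eta>"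
  shows "gen q n L f \<xi> = gen q n L g \<xi>"
proof -
  have "gen_bond q n x f \<xi> = gen_bond q n x g \<xi>" if "x \<in> {1..<L}" for x
  proof -
    have e: "f (exch x k l \<xi>) = g (exch x k l \<xi>)" if "k \<le> n" "l \<le> n" "k \<noteq> l" for k l
      by (rule assms(2)) (rule exch_in_confs[OF assms(1) \<open>x \<in> {1..<L}\<close> that])
    obtain c where c: "\<And>f. gen_bond q n x f \<xi> = (\<Sum>(k,l)\<in>{(k,l). k < l \<and> l \<le> n}.
        c k l * (f (exch x k l \<xi>) - f \<xi>) + c l k * (f (exch x l k \<xi>) - f \<xi>))"
      using gen_bond_rates by blast
    show ?thesis
      unfolding c using e assms by (intro sum.cong refl) auto
  qed
  then show ?thesis
    unfolding gen_def by (intro sum.cong) auto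
qed

lemma gen_eq_sum_gen_mat:
  assumes "\<xi> \<in> confs n L \<theta>"
  shows "gen q n L f \<xi> = (\<Sum>\<eta>\<in>confs n L \<theta>. gen_mat q n L \<xi> \<eta> * f \<eta>)"
proof -
  have "gen q n L f \<xi> = gen q n L (\<lambda>\<zeta>. \<Sum>\<eta>\<in>confs n L \<theta>. f \<eta> * (if \<zeta> = \<eta> then 1 else 0)) \<xi>"
    using finite_confs by (intro gen_cong[OF assms]) (simp add: if_distrib cong: if_cong)
  also have "\<dots> = (\<Sum>\<eta>\<in>confs n L \<theta>. f \<eta> * gen_mat q n L \<xi> \<eta>)"
    unfolding gen_mat_def by (rule gen_sum[OF finite_confs])
  finally show ?thesis
    by (simp add: mult.commute)
qed

text \<open>The defect of the duality relation is subadditive in time and \<open>o(h)\<close> at time 0.\<close>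

lemma self_duality_if_intertwines:
  assumes D: "\<And>\<xi> \<eta>. \<xi> \<in> confs n L \<theta> \<Longrightarrow> \<eta> \<in> confs n L \<theta> \<Longrightarrow> gen q n L (\<lambda>\<zeta>. D \<zeta> \<eta>) \<xi> = gen q n L (\<lambda>\<zeta>. D \<xi> \<zeta>) \<eta>"
  shows "self_duality q n L \<theta> D"
  unfolding self_duality_def
proof (intro allI impI ballI)
  fix P :: "real \<Rightarrow> conf \<Rightarrow> conf pmf" and t :: real and \<xi> \<eta>
  let ?\<Omega> = "confs n L \<theta>"
  assume P: "asep_laws q n L \<theta> P" and t: "0 \<le> t" and "\<xi> \<in> ?\<Omega>" "\<eta> \<in> ?\<Omega>"
  have fin: "finite ?\<Omega>"
    by (rule finite_confs)
  have supp: "set_pmf (P s \<xi>) \<subseteq> ?\<Omega>" if "s \<ge> 0" "\<xi> \<in> ?\<Omega>" for s \<xi>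
    using P that unfolding asep_laws_def by blast
  define p where "p s \<xi> \<zeta> = pmf (P s \<xi>) \<zeta>" for s \<xi> \<zeta>
  have exp: "measure_pmf.expectation (P s \<xi>) f = (\<Sum>\<zeta>\<in>?\<Omega>. p s \<xi> \<zeta> * f \<zeta>)" if "s \<ge> 0" "\<xi> \<in> ?\<Omega>" for s \<xi> f
    using supp[OF that] unfolding p_def by (subst integral_measure_pmf[OF fin]) auto
  have p_sum: "(\<Sum>\<zeta>\<in>?\<Omega>. p s \<xi> \<zeta>) = 1" if "s \<ge> 0" "\<xi> \<in> ?\<Omega>" for s \<xi>
    unfolding p_def by (rule sum_pmf_eq_1[OF fin supp[OF that]])
  have p_nonneg: "p s \<xi> \<zeta> \<ge> 0" for s \<xi> \<zeta>
    by (simp add: p_def)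
  have p_add: "p (s + u) \<xi> \<zeta> = (\<Sum>\<nu>\<in>?\<Omega>. p s \<xi> \<nu> * p u \<nu> \<zeta>)" if "s \<ge> 0" "u \<ge> 0" "\<xi> \<in> ?\<Omega>" for s u \<xi> \<zeta>
  proof -
    have "P (s + u) \<xi> = bind_pmf (P s \<xi>) (P u)"
      using P that unfolding asep_laws_def by blast
    then show ?thesis
      using exp[OF that(1,3), of "\<lambda>\<nu>. p u \<nu> \<zeta>"] by (simp add: p_def pmf_bind)
  qed
  define d where "d s \<xi> \<eta> = (\<Sum>\<zeta>\<in>?\<Omega>. p s \<xi> \<zeta> * D \<zeta> \<eta>) - (\<Sum>\<zeta>\<in>?\<Omega>. p s \<eta> \<zeta> * D \<xi> \<zeta>)" for s \<xi> \<eta>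
  have d_add: "d (s + u) \<xi> \<eta> = (\<Sum>\<nu>\<in>?\<Omega>. p s \<xi> \<nu> * d u \<nu> \<eta>) + (\<Sum>\<nu>\<in>?\<Omega>. p u \<eta> \<nu> * d s \<xi> \<nu>)"
    if "s \<ge> 0" "u \<ge> 0" "\<xi> \<in> ?\<Omega>" "\<eta> \<in> ?\<Omega>" for s u \<xi> \<eta>
  proof -
    have 1: "(\<Sum>\<zeta>\<in>?\<Omega>. p (s + u) \<xi> \<zeta> * D \<zeta> \<eta>) = (\<Sum>\<nu>\<in>?\<Omega>. p s \<xi> \<nu> * (\<Sum>\<zeta>\<in>?\<Omega>. p u \<nu> \<zeta> * D \<zeta> \<eta>))"
      unfolding p_add[OF that(1-3)] sum_distrib_left sum_distrib_right
      by (subst sum.swap) (simp add: mult.assoc)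
    have 2: "(\<Sum>\<zeta>\<in>?\<Omega>. p (s + u) \<eta> \<zeta> * D \<xi> \<zeta>) = (\<Sum>\<nu>\<in>?\<Omega>. p u \<eta> \<nu> * (\<Sum>\<zeta>\<in>?\<Omega>. p s \<nu> \<zeta> * D \<xi> \<zeta>))"
      unfolding add.commute[of s u] p_add[OF that(2,1,4)] sum_distrib_left sum_distrib_right
      by (subst sum.swap) (simp add: mult.assoc)
    \<comment> \<open>The expectation with time s in the first and u in the second variable is the
      common middle term of the two differences.\<close>
    have 3: "(\<Sum>\<nu>\<in>?\<Omega>. p s \<xi> \<nu> * (\<Sum>\<zeta>\<in>?\<Omega>. p u \<eta> \<zeta> * D \<nu> \<zeta>)) = (\<Sum>\<nu>\<in>?\<Omega>. p u \<eta> \<nu> * (\<Sum>\<zeta>\<in>?\<Omega>. p s \<xi> \<zeta> * D \<zeta> \<nu>))"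
      unfolding sum_distrib_left by (subst sum.swap) (simp add: mult_ac)
    show ?thesis
      using 3 by (simp add: d_def 1 2 right_diff_distrib sum_subtractf)
  qed
  have avg: "\<bar>\<Sum>\<nu>\<in>?\<Omega>. p s \<xi> \<nu> * g \<nu>\<bar> \<le> c" if "s \<ge> 0" "\<xi> \<in> ?\<Omega>" "\<And>\<nu>. \<nu> \<in> ?\<Omega> \<Longrightarrow> \<bar>g \<nu>\<bar> \<le> c" for s \<xi> g c
  proof -
    have "\<bar>\<Sum>\<nu>\<in>?\<Omega>. p s \<xi> \<nu> * g \<nu>\<bar> \<le> (\<Sum>\<nu>\<in>?\<Omega>. \<bar>p s \<xi> \<nu> * g \<nu>\<bar>)"
      by (rule sum_abs)
    also have "\<dots> \<le> (\<Sum>\<nu>\<in>?\<Omega>. p s \<xi> \<nu> * c)"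
      using that(3) p_nonneg by (intro sum_mono) (auto simp: abs_mult intro!: mult_left_mono)
    also have "\<dots> = c"
      using p_sum[OF that(1,2)] by (simp flip: sum_distrib_right)
    finally show ?thesis .
  qed
  \<comment> \<open>One step of length h is split off: by \<open>d_add\<close> the defect is an
    average of earlier defects plus an average of defects over h, and averaging does not increase a
    bound.\<close>
  have d_mult: "\<bar>d (real (Suc N) * h) \<xi> \<eta>\<bar> \<le> real (Suc N) * c"
    if "h \<ge> 0" "\<And>\<xi> \<eta>. \<xi> \<in> ?\<Omega> \<Longrightarrow> \<eta> \<in> ?\<Omega> \<Longrightarrow> \<bar>d h \<xi> \<eta>\<bar> \<le> c" "\<xi> \<in> ?\<Omega>" "\<eta> \<in> ?\<Omega>" for N h c \<xi> \<eta>
    using that(3,4)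
  proof (induction N arbitrary: \<xi> \<eta>)
    case 0
    then show ?case using that(2) by simp
  next
    case (Suc N)
    have "real (Suc (Suc N)) * h = h + real (Suc N) * h"
      by (simp add: algebra_simps)
    then have "d (real (Suc (Suc N)) * h) \<xi> \<eta> = (\<Sum>\<nu>\<in>?\<Omega>. p h \<xi> \<nu> * d (real (Suc N) * h) \<nu> \<eta>) + (\<Sum>\<nu>\<in>?\<Omega>. p (real (Suc N) * h) \<eta> \<nu> * d h \<xi> \<nu>)"
      using d_add[of h "real (Suc N) * h" \<xi> \<eta>] that(1) Suc.prems by simp
    moreover have "\<bar>\<Sum>\<nu>\<in>?\<Omega>. p h \<xi> \<nu> * d (real (Suc N) * h) \<nu> \<eta>\<bar> \<le> real (Suc N) * c"
      using that(1) Suc by (intro avg) auto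
    moreover have "\<bar>\<Sum>\<nu>\<in>?\<Omega>. p (real (Suc N) * h) \<eta> \<nu> * d h \<xi> \<nu>\<bar> \<le> c"
      using that(1,2) Suc.prems by (intro avg) auto
    ultimately show ?case
      by (simp add: algebra_simps)
  qed
  have lim: "((\<lambda>h. d h \<xi> \<eta> / h) \<longlongrightarrow> 0) (at_right 0)" if "\<xi> \<in> ?\<Omega>" "\<eta> \<in> ?\<Omega>" for \<xi> \<eta>
  proof -
    have "((\<lambda>h. (measure_pmf.expectation (P h \<xi>) (\<lambda>\<zeta>. D \<zeta> \<eta>) - D \<xi> \<eta>) / h) \<longlongrightarrow> gen q n L (\<lambda>\<zeta>. D \<zeta> \<eta>) \<xi>) (at_right 0)"
      "((\<lambda>h. (measure_pmf.expectation (P h \<eta>) (\<lambda>\<zeta>. D \<xi> \<zeta>) - D \<xi> \<eta>) / h) \<longlongrightarrow> gen q n L (\<lambda>\<zeta>. D \<xi> \<zeta>) \<eta>) (at_right 0)"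
      using P that unfolding asep_laws_def by blast+
    from tendsto_diff[OF this] have "((\<lambda>h. (measure_pmf.expectation (P h \<xi>) (\<lambda>\<zeta>. D \<zeta> \<eta>) - D \<xi> \<eta>) / h
        - (measure_pmf.expectation (P h \<eta>) (\<lambda>\<zeta>. D \<xi> \<zeta>) - D \<xi> \<eta>) / h) \<longlongrightarrow> 0) (at_right 0)"
      using D[OF that] by simp
    moreover have "\<forall>\<^sub>F h in at_right 0. (measure_pmf.expectation (P h \<xi>) (\<lambda>\<zeta>. D \<zeta> \<eta>) - D \<xi> \<eta>) / h
        - (measure_pmf.expectation (P h \<eta>) (\<lambda>\<zeta>. D \<xi> \<zeta>) - D \<xi> \<eta>) / h = d h \<xi> \<eta> / h"
      using eventually_at_right_less[of 0]
      by eventually_elim (simp add: exp that d_def flip: diff_divide_distrib)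
    ultimately show ?thesis
      by (rule Lim_transform_eventually)
  qed
  have "\<bar>d t \<xi> \<eta>\<bar> \<le> e" if "e > 0" for e
  proof (cases "t = 0")
    case True
    have P0: "P 0 \<xi> = return_pmf \<xi>" if "\<xi> \<in> ?\<Omega>" for \<xi>
      using P that unfolding asep_laws_def by blast
    have "(\<Sum>\<zeta>\<in>?\<Omega>. p 0 \<xi> \<zeta> * f \<zeta>) = f \<xi>" if "\<xi> \<in> ?\<Omega>" for f \<xi>
      using exp[of 0 \<xi> f] P0[OF that] that by simp
    then show ?thesis
      using True \<open>e > 0\<close> \<open>\<xi> \<in> ?\<Omega>\<close> \<open>\<eta> \<in> ?\<Omega>\<close> by (simp add: d_def)
  next
    case False
    define e' where "e' = e / t"
    have "e' > 0" using False t \<open>e > 0\<close> by (simp add: e'_def)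
    \<comment> \<open>Finiteness of the state space makes the o(h) bound uniform in both
      configurations, as \<open>d_mult\<close> requires.\<close>
    have "\<forall>\<^sub>F h in at_right 0. \<forall>\<xi>\<in>?\<Omega>. \<forall>\<eta>\<in>?\<Omega>. \<bar>d h \<xi> \<eta> / h\<bar> < e'"
      using fin lim \<open>e' > 0\<close> by (simp add: eventually_ball_finite_distrib tendsto_iff dist_real_def)
    then obtain h0 where h0: "h0 > 0" "\<And>h \<xi> \<eta>. 0 < h \<Longrightarrow> h < h0 \<Longrightarrow> \<xi> \<in> ?\<Omega> \<Longrightarrow> \<eta> \<in> ?\<Omega> \<Longrightarrow> \<bar>d h \<xi> \<eta> / h\<bar> < e'"
      unfolding eventually_at_right_field by blast
    obtain N where N: "t / h0 < real N"
      using reals_Archimedean2 by blast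
    define h where "h = t / real (Suc N)"
    have h: "0 < h" "h < h0" "t = real (Suc N) * h"
    proof -
      show "0 < h" using t False by (simp add: h_def)
      have "t < real N * h0"
        using N h0(1) by (simp add: divide_less_eq)
      also have "\<dots> \<le> real (Suc N) * h0"
        using h0(1) by (intro mult_right_mono) auto
      finally show "h < h0"
        by (simp add: h_def divide_less_eq mult.commute)
      show "t = real (Suc N) * h"
        by (simp add: h_def)
    qed
    have "\<bar>d h \<xi> \<eta>\<bar> \<le> e' * h" if "\<xi> \<in> ?\<Omega>" "\<eta> \<in> ?\<Omega>" for \<xi> \<eta>
      using h0(2)[OF h(1,2) that] h(1) by (simp add: abs_divide divide_less_eq)
    then have "\<bar>d (real (Suc N) * h) \<xi> \<eta>\<bar> \<le> real (Suc N) * (e' * h)"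
      using h(1) \<open>\<xi> \<in> ?\<Omega>\<close> \<open>\<eta> \<in> ?\<Omega>\<close> by (intro d_mult) auto
    also have "\<dots> = e' * t"
      unfolding h(3) by simp
    finally show ?thesis
      using False h(3) by (simp add: e'_def)
  qed
  then have "d t \<xi> \<eta> = 0"
    by (metis abs_ge_zero abs_le_zero_iff field_le_epsilon add_0 order_antisym)
  then show "measure_pmf.expectation (P t \<xi>) (\<lambda>\<zeta>. D \<zeta> \<eta>) = measure_pmf.expectation (P t \<eta>) (\<lambda>\<zeta>. D \<xi> \<zeta>)"
    using t \<open>\<xi> \<in> ?\<Omega>\<close> \<open>\<eta> \<in> ?\<Omega>\<close> by (simp add: exp d_def)
qed

section \<open>Detailed balance for exchanges\<close>

context
  fixes q :: real
  assumes q: "0 < q" "q < 1"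
begin

definition hop_rate :: "nat \<Rightarrow> nat \<Rightarrow> nat \<Rightarrow> nat \<Rightarrow> conf \<Rightarrow> conf \<Rightarrow> real" where
  "hop_rate n x p r \<xi> \<eta> = weight_below q p (\<xi> x) * weight_above q n r (hop x (x + 1) p \<xi> (x + 1))
      * of_bool (hop (x + 1) x r (hop x (x + 1) p \<xi>) = \<eta>)"

text \<open>Sending p to the right and r back is reversed by sending r to the right and p back, and
  both pass through the same intermediate configuration \<zeta>. The half balances of \<xi> and of
  \<eta> against \<zeta> carry equal powers of q, because \<xi> and \<eta> have equal occupancies at
  the two sites.\<close>

lemma hop_rate_balance_aux:
  assumes x: "1 \<le> x" "x < L" and p: "p \<le> n" "r \<le> n" and nz: "hop_rate n x p r \<xi> \<eta> \<noteq> 0"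
  shows "rev_weight q n L \<xi> * hop_rate n x p r \<xi> \<eta> = rev_weight q n L \<eta> * hop_rate n x r p \<eta> \<xi>"
proof -
  define \<zeta> where "\<zeta> = hop x (x + 1) p \<xi>"
  have \<eta>: "\<eta> = hop (x + 1) x r \<zeta>"
    using nz by (auto simp: hop_rate_def \<zeta>_def)
  have ge: "\<xi> x p \<ge> 1" "\<zeta> (x + 1) r \<ge> 1"
    using nz by (auto simp: hop_rate_def \<zeta>_def weight_below_0 weight_above_0 intro!: Suc_leI gr0I)
  have \<zeta>: "\<zeta> = hop x (x + 1) r \<eta>"
    unfolding \<eta> using ge by (subst hop_back) auto
  have "\<eta> x r \<ge> 1"
    unfolding \<eta> by (simp add: hop_row)
  have return: "hop (x + 1) x p \<zeta> = \<xi>"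
    unfolding \<zeta>_def using ge by (subst hop_back) auto
  have xy: "x \<noteq> x + 1" by simp
  have sx: "sum (\<zeta> x) {..n} + 1 = sum (\<xi> x) {..n}"
    unfolding \<zeta>_def hop_row(1)[OF xy] using sum_decr[of "{..n}" "\<xi> x" p] ge p by simp
  have sx': "sum (\<zeta> x) {..n} + 1 = sum (\<eta> x) {..n}"
    unfolding \<zeta> hop_row(1)[OF xy] using sum_decr[of "{..n}" "\<eta> x" r] \<open>\<eta> x r \<ge> 1\<close> p by simp
  have sy: "sum (\<zeta> (x + 1)) {..n} = sum (\<xi> (x + 1)) {..n} + 1"
    unfolding \<zeta>_def hop_row(2) using sum_incr[of "{..n}" "\<xi> (x + 1)" p] p by simp
  have sy': "sum (\<zeta> (x + 1)) {..n} = sum (\<eta> (x + 1)) {..n} + 1"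
    unfolding \<zeta> hop_row(2) using sum_incr[of "{..n}" "\<eta> (x + 1)" r] p by simp
  define A where "A = q ^ (2 * (\<Sum>j\<le>n. \<xi> x j))"
  define B where "B = q ^ (2 * (\<Sum>j\<le>n. \<xi> (x + 1) j) + 2)"
  have A': "A = q ^ (2 * (\<Sum>j\<le>n. \<eta> x j))" and B': "B = q ^ (2 * (\<Sum>j\<le>n. \<eta> (x + 1) j) + 2)"
    unfolding A_def B_def using sx sx' sy sy' by simp_all
  have 1: "rev_weight q n L \<xi> * weight_below q p (\<xi> x) * B = A * (rev_weight q n L \<zeta> * weight_above q n p (\<zeta> (x + 1)))"
    unfolding A_def B_def \<zeta>_def by (rule hop_detailed_balance[where \<xi> = \<xi>]) (use q x p ge in auto)
  have 2: "rev_weight q n L \<eta> * weight_below q r (\<eta> x) * B = A * (rev_weight q n L \<zeta> * weight_above q n r (\<zeta> (x + 1)))"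
    unfolding A' B' \<zeta> by (rule hop_detailed_balance[where \<xi> = \<eta>]) (use q x p \<open>\<eta> x r \<ge> 1\<close> in auto)
  have r1: "hop_rate n x p r \<xi> \<eta> = weight_below q p (\<xi> x) * weight_above q n r (\<zeta> (x + 1))"
    unfolding hop_rate_def \<zeta>_def[symmetric] \<eta>[symmetric] by simp
  have r2: "hop_rate n x r p \<eta> \<xi> = weight_below q r (\<eta> x) * weight_above q n p (\<zeta> (x + 1))"
    unfolding hop_rate_def \<zeta>[symmetric] return by simp
  have "(rev_weight q n L \<xi> * hop_rate n x p r \<xi> \<eta>) * B = (rev_weight q n L \<eta> * hop_rate n x r p \<eta> \<xi>) * B"
  proof -
    have "(rev_weight q n L \<xi> * hop_rate n x p r \<xi> \<eta>) * B
        = (rev_weight q n L \<xi> * weight_below q p (\<xi> x) * B) * weight_above q n r (\<zeta> (x + 1))"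
      unfolding r1 by (simp only: mult_ac)
    also have "\<dots> = (rev_weight q n L \<eta> * weight_below q r (\<eta> x) * B) * weight_above q n p (\<zeta> (x + 1))"
      unfolding 1 2 by (simp only: mult_ac)
    also have "\<dots> = (rev_weight q n L \<eta> * hop_rate n x r p \<eta> \<xi>) * B"
      unfolding r2 by (simp only: mult_ac)
    finally show ?thesis .
  qed
  moreover have "B \<noteq> 0"
    using q by (simp add: B_def)
  ultimately show ?thesis by simp
qed

lemma hop_rate_balance:
  assumes "1 \<le> x" "x < L" "p \<le> n" "r \<le> n"
  shows "rev_weight q n L \<xi> * hop_rate n x p r \<xi> \<eta> = rev_weight q n L \<eta> * hop_rate n x r p \<eta> \<xi>"
proof (cases "hop_rate n x p r \<xi> \<eta> = 0 \<and> hop_rate n x r p \<eta> \<xi> = 0")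
  case False
  then show ?thesis
    using hop_rate_balance_aux[OF assms, of \<xi> \<eta>] hop_rate_balance_aux[OF assms(1,2,4,3), of \<eta> \<xi>] by auto
qed simp

lemma gen_mat_balance:
  "rev_weight q n L \<xi> * gen_mat q n L \<xi> \<eta> = rev_weight q n L \<eta> * gen_mat q n L \<eta> \<xi>"
proof (cases "\<xi> = \<eta>")
  case False
  \<comment> \<open>Off the diagonal the loss terms of the generator vanish.\<close>
  have mat: "gen_mat q n L \<xi> \<eta> = (\<Sum>x\<in>{1..<L}. (\<Sum>p\<le>n. \<Sum>r\<le>n. hop_rate n x p r \<xi> \<eta>) / q)" if "\<xi> \<noteq> \<eta>" for \<xi> \<eta>
    using that unfolding gen_mat_def gen_def gen_bond_eq_sum[OF q] hop_rate_def of_bool_def by simp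
  have "rev_weight q n L \<xi> * gen_mat q n L \<xi> \<eta> = (\<Sum>x\<in>{1..<L}. (\<Sum>p\<le>n. \<Sum>r\<le>n. rev_weight q n L \<xi> * hop_rate n x p r \<xi> \<eta>) / q)"
    unfolding mat[OF False] by (simp add: sum_distrib_left)
  also have "\<dots> = (\<Sum>x\<in>{1..<L}. (\<Sum>p\<le>n. \<Sum>r\<le>n. rev_weight q n L \<eta> * hop_rate n x r p \<eta> \<xi>) / q)"
    by (intro sum.cong refl arg_cong[of _ _ "\<lambda>u. u / q"] hop_rate_balance) auto
  also have "\<dots> = (\<Sum>x\<in>{1..<L}. (\<Sum>p\<le>n. \<Sum>r\<le>n. rev_weight q n L \<eta> * hop_rate n x p r \<eta> \<xi>) / q)"
    by (subst sum.swap) (rule refl)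
  also have "\<dots> = rev_weight q n L \<eta> * gen_mat q n L \<eta> \<xi>"
    unfolding mat[OF False[symmetric]] by (simp add: sum_distrib_left)
  finally show ?thesis .
qed simp

end

section \<open>The action of the quantum group\<close>

lemma act_Ct:
  assumes "q \<noteq> 0"
  shows "act q n L (Ct h) \<xi>' \<xi> =
    (if \<forall>x\<in>{1..L}. \<xi>' x = \<xi> x then q powi (\<Sum>x=1..L. \<Sum>j=0..n. h j * int (\<xi> x j)) else 0)"
proof (induction L)
  case (Suc L)
  have "{1..Suc L} = insert (Suc L) {1..L}"
    by auto
  then show ?case
    using Suc assms by (auto simp: power_int_add algebra_simps)
qed simp

lemma sum_wt: "i \<le> n \<Longrightarrow> (\<Sum>j=0..n. wt i c j * int (\<mu> j)) = c * int (\<mu> i)"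
  by (simp add: wt_def if_distrib[of "\<lambda>c. c * _"] cong: if_cong)

lemma sum_rt: "i < n \<Longrightarrow> (\<Sum>j=0..n. rt i j * int (\<mu> j)) = int (\<mu> i) - int (\<mu> (i + 1))"
  unfolding rt_def left_diff_distrib sum_subtractf by (subst (1 2) sum_wt) auto

text \<open>The iterated coproduct puts the group-like factor \<open>Ct (rt i)\<close> on every site
  to the left of the one where the generator acts.\<close>

lemma act_Up:
  assumes "q \<noteq> 0" "i < n"
  shows "act q n L (Up i) \<xi>' \<xi> = (\<Sum>y=1..L.
     if (\<forall>x\<in>{1..L}-{y}. \<xi>' x = \<xi> x) \<and> \<xi> y (i + 1) \<ge> 1 \<and> \<xi>' y = (\<xi> y)(i := \<xi> y i + 1, i + 1 := \<xi> y (i + 1) - 1)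
     then q powi (\<Sum>z=1..<y. int (\<xi> z i) - int (\<xi> z (i + 1))) * qint q (\<xi> y (i + 1)) else 0)"
    (is "_ = (\<Sum>y=1..L. ?T L y)")
proof (induction L)
  case (Suc L)
  have "?T (Suc L) y = ?T L y * site_act q n (Ct (\<lambda>_. 0)) (\<xi>' (Suc L)) (\<xi> (Suc L))" if "y \<in> {1..L}" for y
  proof -
    have "{1..Suc L} - {y} = insert (Suc L) ({1..L} - {y})"
      using that by auto
    then show ?thesis by auto
  qed
  then have "(\<Sum>y=1..L. ?T (Suc L) y) = (\<Sum>y=1..L. ?T L y) * site_act q n (Ct (\<lambda>_. 0)) (\<xi>' (Suc L)) (\<xi> (Suc L))"
    unfolding sum_distrib_right by (intro sum.cong refl)
  moreover have "?T (Suc L) (Suc L) = act q n L (Ct (rt i)) \<xi>' \<xi> * site_act q n (Up i) (\<xi>' (Suc L)) (\<xi> (Suc L))"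
  proof -
    have "{1..Suc L} - {Suc L} = {1..L}" "{1..<Suc L} = {1..L}"
      by auto
    then show ?thesis
      unfolding act_Ct[OF assms(1)] sum_rt[OF assms(2)] by auto
  qed
  ultimately show ?case
    using Suc.IH by simp
qed simp

text \<open>For the lowering generator the inverse group-like factor stands on every site to the
  right.\<close>

lemma act_Dn:
  assumes "q \<noteq> 0" "i < n"
  shows "act q n L (Dn i) \<xi>' \<xi> = (\<Sum>y=1..L.
     if (\<forall>x\<in>{1..L}-{y}. \<xi>' x = \<xi> x) \<and> \<xi> y i \<ge> 1 \<and> \<xi>' y = (\<xi> y)(i := \<xi> y i - 1, i + 1 := \<xi> y (i + 1) + 1)
     then q powi (- (\<Sum>z=y+1..L. int (\<xi> z i) - int (\<xi> z (i + 1)))) * qint q (\<xi> y i) else 0)"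
    (is "_ = (\<Sum>y=1..L. ?T L y)")
proof (induction L)
  case (Suc L)
  have "?T (Suc L) y = ?T L y * site_act q n (Ct (\<lambda>j. - rt i j)) (\<xi>' (Suc L)) (\<xi> (Suc L))" if "y \<in> {1..L}" for y
  proof -
    have s: "{1..Suc L} - {y} = insert (Suc L) ({1..L} - {y})" "{y+1..Suc L} = insert (Suc L) {y+1..L}"
      using that by auto
    have "site_act q n (Ct (\<lambda>j. - rt i j)) (\<xi>' (Suc L)) (\<xi> (Suc L)) =
        (if \<xi>' (Suc L) = \<xi> (Suc L) then q powi (- (int (\<xi> (Suc L) i) - int (\<xi> (Suc L) (i + 1)))) else 0)"
      using sum_rt[OF assms(2), of "\<xi> (Suc L)"] by (simp add: sum_negf)
    moreover have "q powi (- (\<Sum>z=y+1..Suc L. int (\<xi> z i) - int (\<xi> z (i + 1)))) =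
        q powi (- (\<Sum>z=y+1..L. int (\<xi> z i) - int (\<xi> z (i + 1)))) * q powi (- (int (\<xi> (Suc L) i) - int (\<xi> (Suc L) (i + 1))))"
      unfolding s(2) using assms(1) by (subst power_int_add[symmetric]) auto
    ultimately show ?thesis
      unfolding s(1) by auto
  qed
  then have "(\<Sum>y=1..L. ?T (Suc L) y) = (\<Sum>y=1..L. ?T L y) * site_act q n (Ct (\<lambda>j. - rt i j)) (\<xi>' (Suc L)) (\<xi> (Suc L))"
    unfolding sum_distrib_right by (intro sum.cong refl)
  moreover have "?T (Suc L) (Suc L) = act q n L (Ct (\<lambda>_. 0)) \<xi>' \<xi> * site_act q n (Dn i) (\<xi>' (Suc L)) (\<xi> (Suc L))"
  proof -
    have "{1..Suc L} - {Suc L} = {1..L}"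
      by auto
    then show ?thesis
      unfolding act_Ct[OF assms(1)] by auto
  qed
  ultimately show ?case
    using Suc.IH by simp
qed simp

section \<open>Explicit matrices of the raising and lowering operators\<close>

lemma confs_eq_iff:
  assumes "\<xi> \<in> confs n L \<theta>" "\<eta> \<in> confs n L \<theta>"
  shows "(\<forall>x\<in>{1..L}. \<xi> x = \<eta> x) \<longleftrightarrow> \<xi> = \<eta>"
proof
  assume "\<forall>x\<in>{1..L}. \<xi> x = \<eta> x"
  then have "\<xi> x i = \<eta> x i" for x i
    using assms by (cases "x \<in> {1..L}") (auto simp: confs_def)
  then show "\<xi> = \<eta>" by (intro ext)
qed simp

text \<open>The left side is the test made by \<open>site_act\<close>, which computes \<xi> from
  \<eta>; the right side computes \<eta> from \<xi>. Along a row the conversion is thus the inverse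
  one: E(i,i+1) turns species i + 1 into i on basis vectors but i into i + 1 in the argument of a
  function.\<close>

lemma conv_eq_iff:
  assumes "\<xi> \<in> confs n L \<theta>" "\<eta> \<in> confs n L \<theta>" "y \<in> {1..L}" "i \<noteq> j"
  shows "(\<forall>x\<in>{1..L}-{y}. \<xi> x = \<eta> x) \<and> \<eta> y j \<ge> 1 \<and> \<xi> y = (\<eta> y)(i := \<eta> y i + 1, j := \<eta> y j - 1)
     \<longleftrightarrow> \<xi> y i \<ge> 1 \<and> \<eta> = conv y i j \<xi>" (is "?l \<longleftrightarrow> ?r")
proof
  assume l: ?l
  have "\<eta> x k = conv y i j \<xi> x k" for x k
  proof (cases "x = y")
    case True
    then show ?thesis
      using l assms(4) by (simp add: conv_row)
  next
    case False
    then have "\<eta> x k = \<xi> x k"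
      using l assms(1,2) by (cases "x \<in> {1..L}") (auto simp: confs_def)
    then show ?thesis
      using False by (simp add: conv_other_row)
  qed
  then have "\<eta> = conv y i j \<xi>"
    by (intro ext)
  moreover have "\<xi> y i = \<eta> y i + 1"
  proof -
    have e: "\<xi> y = (\<eta> y)(i := \<eta> y i + 1, j := \<eta> y j - 1)"
      using l by blast
    show ?thesis
      unfolding e using assms(4) by simp
  qed
  ultimately show ?r
    by simp
next
  assume r: ?r
  then show ?l
    using assms(4) by (auto simp: conv_row conv_other_row fun_eq_iff)
qed

lemma conv_conv:
  assumes "i \<noteq> j" "\<xi> y i \<ge> 1"
  shows "conv y j i (conv y i j \<xi>) = \<xi>" "conv y i j \<xi> y j \<ge> 1"
  using assms by (auto simp: conv_def intro!: ext)

text \<open>The exponent that remains when the Cartan factor, which sees all sites, cancels the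
  one-sided factors of the coproduct. It is the same for raising and lowering and ignores site y, so
  a move at y leaves it unchanged.\<close>

definition side :: "nat \<Rightarrow> nat \<Rightarrow> nat \<Rightarrow> conf \<Rightarrow> nat" where
  "side L i y \<xi> = (\<Sum>z=1..<y. \<xi> z i) + (\<Sum>z=y+1..L. \<xi> z (i + 1))"

text \<open>This is the operator A of the overview and \<open>lower_mat\<close> its adjoint, both
  written by rows.\<close>

definition raise_mat :: "real \<Rightarrow> nat \<Rightarrow> nat \<Rightarrow> opr" where
  "raise_mat q L i = (\<lambda>\<xi> \<eta>. \<Sum>y=1..L. of_bool (\<xi> y i \<ge> 1 \<and> \<eta> = conv y i (i + 1) \<xi>) *
      (q ^ side L i y \<xi> * cint q (\<xi> y (i + 1) + 1)))"

definition lower_mat :: "real \<Rightarrow> nat \<Rightarrow> nat \<Rightarrow> opr" where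
  "lower_mat q L i = (\<lambda>\<xi> \<eta>. \<Sum>y=1..L. of_bool (\<xi> y (i + 1) \<ge> 1 \<and> \<eta> = conv y (i + 1) i \<xi>) *
      (q ^ side L i y \<xi> * cint q (\<xi> y i + 1)))"

lemma sum_sites_split:
  fixes g :: "nat \<Rightarrow> nat"
  assumes "y \<in> {1..L}"
  shows "(\<Sum>x=1..L. g x) = (\<Sum>z=1..<y. g z) + g y + (\<Sum>z=y+1..L. g z)"
proof -
  have "{1..L} = insert y ({1..<y} \<union> {y+1..L})"
    using assms by auto
  moreover have "sum g ({1..<y} \<union> {y+1..L}) = sum g {1..<y} + sum g {y+1..L}"
    by (rule sum.union_disjoint) auto
  ultimately show ?thesis
    by simp
qed

lemma act_Ct_confs:
  assumes "q \<noteq> 0" "\<xi> \<in> confs n L \<theta>" "\<eta> \<in> confs n L \<theta>" "i \<le> n"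
  shows "act q n L (Ct (wt i c)) \<xi> \<eta> = (if \<xi> = \<eta> then q powi (c * int (\<Sum>x=1..L. \<xi> x i)) else 0)"
  unfolding act_Ct[OF assms(1)] sum_wt[OF assms(4)] confs_eq_iff[OF assms(2,3)]
  by (simp flip: sum_distrib_left)

lemma mmul_diag_left:
  assumes "finite \<Omega>" "\<xi> \<in> \<Omega>" "\<And>\<zeta>. \<zeta> \<in> \<Omega> \<Longrightarrow> A \<xi> \<zeta> = (if \<xi> = \<zeta> then c else 0)"
  shows "(A \<star>\<^bsub>\<Omega>\<^esub> B) \<xi> \<eta> = c * B \<xi> \<eta>"
proof -
  have "(A \<star>\<^bsub>\<Omega>\<^esub> B) \<xi> \<eta> = (\<Sum>\<zeta>\<in>\<Omega>. if \<xi> = \<zeta> then c * B \<xi> \<eta> else 0)"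
    unfolding mmul_def by (intro sum.cong refl) (auto simp: assms(3))
  then show ?thesis
    using assms(1,2) by simp
qed

lemma mmul_diag_right:
  assumes "finite \<Omega>" "\<eta> \<in> \<Omega>" "\<And>\<zeta>. \<zeta> \<in> \<Omega> \<Longrightarrow> B \<zeta> \<eta> = (if \<zeta> = \<eta> then c else 0)"
  shows "(A \<star>\<^bsub>\<Omega>\<^esub> B) \<xi> \<eta> = A \<xi> \<eta> * c"
proof -
  have "(A \<star>\<^bsub>\<Omega>\<^esub> B) \<xi> \<eta> = (\<Sum>\<zeta>\<in>\<Omega>. if \<zeta> = \<eta> then A \<xi> \<eta> * c else 0)"
    unfolding mmul_def by (intro sum.cong refl) (auto simp: assms(3))
  then show ?thesis
    using assms(1,2) by simp
qed

context
  fixes q :: real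
  assumes q: "0 < q" "q < 1"
begin

text \<open>Besides \<open>side\<close>, the exponents leave q^k with k the number of particles of
  species i + 1 at y; it turns [k + 1] into {k + 1}.\<close>

lemma act_raise:
  assumes "\<xi> \<in> confs n L \<theta>" "\<eta> \<in> confs n L \<theta>" "i < n"
  shows "(act q n L (Ct (wt (i + 1) 1)) \<star>\<^bsub>confs n L \<theta>\<^esub> act q n L (Up i)) \<xi> \<eta> = raise_mat q L i \<xi> \<eta>"
proof -
  have q0: "q \<noteq> 0" using q by simp
  let ?N = "int (\<Sum>x=1..L. \<xi> x (i + 1))"
  have "(act q n L (Ct (wt (i + 1) 1)) \<star>\<^bsub>confs n L \<theta>\<^esub> act q n L (Up i)) \<xi> \<eta> = q powi (1 * ?N) * act q n L (Up i) \<xi> \<eta>"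
    by (rule mmul_diag_left[OF finite_confs assms(1)]) (rule act_Ct_confs[OF q0 assms(1)], use assms in auto)
  also have "\<dots> = raise_mat q L i \<xi> \<eta>"
    unfolding act_Up[OF q0 assms(3)] raise_mat_def sum_distrib_left
  proof (rule sum.cong[OF refl])
    fix y assume y: "y \<in> {1..L}"
    show "q powi (1 * ?N) * (if (\<forall>x\<in>{1..L}-{y}. \<xi> x = \<eta> x) \<and> \<eta> y (i + 1) \<ge> 1 \<and> \<xi> y = (\<eta> y)(i := \<eta> y i + 1, i + 1 := \<eta> y (i + 1) - 1)
        then q powi (\<Sum>z=1..<y. int (\<eta> z i) - int (\<eta> z (i + 1))) * qint q (\<eta> y (i + 1)) else 0)
      = of_bool (\<xi> y i \<ge> 1 \<and> \<eta> = conv y i (i + 1) \<xi>) * (q ^ side L i y \<xi> * cint q (\<xi> y (i + 1) + 1))"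
    proof (cases "\<xi> y i \<ge> 1 \<and> \<eta> = conv y i (i + 1) \<xi>")
      case True
      then have \<eta>: "\<eta> = conv y i (i + 1) \<xi>" by simp
      let ?k = "\<xi> y (i + 1)"
      have s: "(\<Sum>z=1..<y. int (\<eta> z i) - int (\<eta> z (i + 1))) = int (\<Sum>z=1..<y. \<xi> z i) - int (\<Sum>z=1..<y. \<xi> z (i + 1))"
        unfolding \<eta> of_nat_sum sum_subtractf[symmetric] by (intro sum.cong) (auto simp: conv_other_row)
      have k: "\<eta> y (i + 1) = Suc ?k"
        unfolding \<eta> by (simp add: conv_row)
      have e: "1 * ?N + (int (\<Sum>z=1..<y. \<xi> z i) - int (\<Sum>z=1..<y. \<xi> z (i + 1))) = int (side L i y \<xi>) + int ?k"
        unfolding sum_sites_split[OF y] side_def by simp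
      have "q powi (1 * ?N) * q powi (\<Sum>z=1..<y. int (\<eta> z i) - int (\<eta> z (i + 1))) = q powi (int (side L i y \<xi>) + int ?k)"
        unfolding s e[symmetric] using q0 by (subst power_int_add) auto
      also have "\<dots> = q ^ side L i y \<xi> * q ^ ?k"
        by (simp only: power_int_add_nat[OF q(1)] power_int_of_nat)
      finally have "q powi (1 * ?N) * (q powi (\<Sum>z=1..<y. int (\<eta> z i) - int (\<eta> z (i + 1))) * qint q (\<eta> y (i + 1)))
          = q ^ side L i y \<xi> * q ^ ?k * (cint q (Suc ?k) / q ^ ?k)"
        unfolding k qint_Suc[OF q] by (simp only: mult.assoc[symmetric])
      also have "\<dots> = q ^ side L i y \<xi> * cint q (?k + 1)"
        using q0 by simp
      finally show ?thesis
        unfolding conv_eq_iff[OF assms(1,2) y, of i "i + 1", simplified] using True conv_eq_iff[OF assms(1,2) y, of i "i + 1"] by simp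
    next
      case False
      then show ?thesis
        using conv_eq_iff[OF assms(1,2) y, of i "i + 1"] by auto
    qed
  qed
  finally show ?thesis .
qed

text \<open>Here the Cartan factor is evaluated at \<eta>, where the cell (y, i) holds k + 1
  particles, so one factor q is left over after [k + 1] has become {k + 1}. It turns \<gamma>(1 -
  q^2)(q - 1/q) into \<gamma>(1 - q^2)(q^2 - 1) = \<lambda>.\<close>

lemma act_lower:
  assumes "\<xi> \<in> confs n L \<theta>" "\<eta> \<in> confs n L \<theta>" "i < n"
  shows "(act q n L (Dn i) \<star>\<^bsub>confs n L \<theta>\<^esub> act q n L (Ct (wt i 1))) \<xi> \<eta> = q * lower_mat q L i \<xi> \<eta>"
proof -
  have q0: "q \<noteq> 0" using q by simp
  let ?N = "int (\<Sum>x=1..L. \<eta> x i)"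
  have "(act q n L (Dn i) \<star>\<^bsub>confs n L \<theta>\<^esub> act q n L (Ct (wt i 1))) \<xi> \<eta> = act q n L (Dn i) \<xi> \<eta> * q powi (1 * ?N)"
    by (rule mmul_diag_right[OF finite_confs assms(2)]) (subst act_Ct_confs[OF q0], use assms in auto)
  also have "\<dots> = q * lower_mat q L i \<xi> \<eta>"
    unfolding act_Dn[OF q0 assms(3)] lower_mat_def sum_distrib_left sum_distrib_right
  proof (rule sum.cong[OF refl])
    fix y assume y: "y \<in> {1..L}"
    have iff: "(\<forall>x\<in>{1..L}-{y}. \<xi> x = \<eta> x) \<and> \<eta> y i \<ge> 1 \<and> \<xi> y = (\<eta> y)(i := \<eta> y i - 1, i + 1 := \<eta> y (i + 1) + 1)
       \<longleftrightarrow> \<xi> y (i + 1) \<ge> 1 \<and> \<eta> = conv y (i + 1) i \<xi>"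
      using conv_eq_iff[OF assms(1,2) y, of "i + 1" i] by (simp add: fun_upd_twist)
    show "(if (\<forall>x\<in>{1..L}-{y}. \<xi> x = \<eta> x) \<and> \<eta> y i \<ge> 1 \<and> \<xi> y = (\<eta> y)(i := \<eta> y i - 1, i + 1 := \<eta> y (i + 1) + 1)
        then q powi (- (\<Sum>z=y+1..L. int (\<eta> z i) - int (\<eta> z (i + 1)))) * qint q (\<eta> y i) else 0) * q powi (1 * ?N)
      = q * (of_bool (\<xi> y (i + 1) \<ge> 1 \<and> \<eta> = conv y (i + 1) i \<xi>) * (q ^ side L i y \<xi> * cint q (\<xi> y i + 1)))"
    proof (cases "\<xi> y (i + 1) \<ge> 1 \<and> \<eta> = conv y (i + 1) i \<xi>")
      case True
      then have \<eta>: "\<eta> = conv y (i + 1) i \<xi>" by simp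
      let ?k = "\<xi> y i"
      have s: "(\<Sum>z=y+1..L. int (\<eta> z i) - int (\<eta> z (i + 1))) = int (\<Sum>z=y+1..L. \<xi> z i) - int (\<Sum>z=y+1..L. \<xi> z (i + 1))"
        unfolding \<eta> of_nat_sum sum_subtractf[symmetric] by (intro sum.cong) (auto simp: conv_other_row)
      have k: "\<eta> y i = Suc ?k"
        unfolding \<eta> by (simp add: conv_row)
      have "(\<Sum>z=1..<y. \<eta> z i) = (\<Sum>z=1..<y. \<xi> z i)" "(\<Sum>z=y+1..L. \<eta> z i) = (\<Sum>z=y+1..L. \<xi> z i)"
        unfolding \<eta> by (intro sum.cong; simp add: conv_other_row)+
      then have e: "- (int (\<Sum>z=y+1..L. \<xi> z i) - int (\<Sum>z=y+1..L. \<xi> z (i + 1))) + 1 * ?N = int (side L i y \<xi>) + int (Suc ?k)"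
        unfolding sum_sites_split[OF y] side_def k by simp
      have "q powi (- (\<Sum>z=y+1..L. int (\<eta> z i) - int (\<eta> z (i + 1)))) * q powi (1 * ?N) = q powi (int (side L i y \<xi>) + int (Suc ?k))"
        unfolding s e[symmetric] using q0 by (subst power_int_add) auto
      also have "\<dots> = q ^ side L i y \<xi> * q ^ Suc ?k"
        by (simp only: power_int_add_nat[OF q(1)] power_int_of_nat)
      finally have *: "q powi (- (\<Sum>z=y+1..L. int (\<eta> z i) - int (\<eta> z (i + 1)))) * q powi (1 * ?N) = q ^ side L i y \<xi> * q ^ Suc ?k" .
      have "q powi (- (\<Sum>z=y+1..L. int (\<eta> z i) - int (\<eta> z (i + 1)))) * qint q (\<eta> y i) * q powi (1 * ?N)
          = q ^ side L i y \<xi> * q ^ Suc ?k * (cint q (Suc ?k) / q ^ ?k)"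
        unfolding *[symmetric] k qint_Suc[OF q] by (simp only: mult_ac)
      also have "\<dots> = q * (q ^ side L i y \<xi> * cint q (?k + 1))"
        using q0 by simp
      finally show ?thesis
        unfolding iff using True by simp
    next
      case False
      then show ?thesis
        unfolding iff by auto
    qed
  qed
  finally show ?thesis .
qed

text \<open>B^(-2) is the product of the factorials {m}! over all cells. Moving one particle changes
  two of them, by the same q-integers by which the two matrix entries differ.\<close>

lemma lower_mat_adjoint:
  assumes "\<xi> \<in> confs n L \<theta>" "\<eta> \<in> confs n L \<theta>" "i < n"
  shows "lower_mat q L i \<xi> \<eta> = (Bd q n L \<xi>)^2 * raise_mat q L i \<eta> \<xi> * inverse ((Bd q n L \<eta>)^2)"
  unfolding lower_mat_def raise_mat_def sum_distrib_left sum_distrib_right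
proof (rule sum.cong[OF refl])
  fix y assume y: "y \<in> {1..L}"
  have iff: "\<xi> y (i + 1) \<ge> 1 \<and> \<eta> = conv y (i + 1) i \<xi> \<longleftrightarrow> \<eta> y i \<ge> 1 \<and> \<xi> = conv y i (i + 1) \<eta>"
    using conv_conv[of "i + 1" i \<xi> y] conv_conv[of i "i + 1" \<eta> y] by auto
  show "of_bool (\<xi> y (i + 1) \<ge> 1 \<and> \<eta> = conv y (i + 1) i \<xi>) * (q ^ side L i y \<xi> * cint q (\<xi> y i + 1))
     = (Bd q n L \<xi>)^2 * (of_bool (\<eta> y i \<ge> 1 \<and> \<xi> = conv y i (i + 1) \<eta>) * (q ^ side L i y \<eta> * cint q (\<eta> y (i + 1) + 1))) * inverse ((Bd q n L \<eta>)^2)"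
  proof (cases "\<eta> y i \<ge> 1 \<and> \<xi> = conv y i (i + 1) \<eta>")
    case True
    then have \<xi>: "\<xi> = conv y i (i + 1) \<eta>" by simp
    obtain a where a: "\<eta> y i = Suc a"
      using True by (cases "\<eta> y i") auto
    let ?b = "\<eta> y (i + 1)"
    let ?P = "site_prod n L (cfact q)"
    have cells: "\<xi> y i = a" "\<xi> y (i + 1) = Suc ?b"
      unfolding \<xi> by (simp_all add: conv_row a)
    have "?P \<xi> * (cfact q (\<eta> y i) * cfact q ?b) = ?P \<eta> * (cfact q (\<xi> y i) * cfact q (\<xi> y (i + 1)))"
      using assms(3) y unfolding \<xi> by (intro site_prod_two_cells) (auto simp: conv_def)
    then have "(?P \<xi> * cint q (Suc a)) * (cfact q a * cfact q ?b) = (?P \<eta> * cint q (Suc ?b)) * (cfact q a * cfact q ?b)"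
      unfolding cells a cfact_Suc by (simp only: mult_ac)
    moreover have "cfact q a * cfact q ?b \<noteq> 0"
      using cfact_pos[OF q, of a] cfact_pos[OF q, of ?b] by simp
    ultimately have P: "?P \<xi> * cint q (Suc a) = ?P \<eta> * cint q (Suc ?b)"
      by simp
    have Pinv: "(Bd q n L \<xi>)^2 * ?P \<xi> = 1"
      unfolding Bd_square[OF q, symmetric] using Bd_pos[OF q, of n L \<xi>] by simp
    have "side L i y \<xi> = side L i y \<eta>"
      unfolding side_def \<xi> by (intro arg_cong2[of _ _ _ _ "(+)"] sum.cong) (auto simp: conv_other_row)
    moreover have "(Bd q n L \<xi>)^2 * cint q (Suc ?b) * ?P \<eta> = cint q (Suc a)"
    proof -
      have "(Bd q n L \<xi>)^2 * cint q (Suc ?b) * ?P \<eta> = (Bd q n L \<xi>)^2 * (?P \<eta> * cint q (Suc ?b))"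
        by (simp only: mult_ac)
      also have "\<dots> = ((Bd q n L \<xi>)^2 * ?P \<xi>) * cint q (Suc a)"
        unfolding P[symmetric] by (simp only: mult.assoc)
      finally have "(Bd q n L \<xi>)^2 * cint q (Suc ?b) * ?P \<eta> = ((Bd q n L \<xi>)^2 * ?P \<xi>) * cint q (Suc a)" .
      then show ?thesis using Pinv by simp
    qed
    ultimately show ?thesis
      unfolding Bd_square[OF q] cells using True conv_conv(1)[of i "i + 1" \<eta> y] by (simp add: mult_ac)
  next
    case False
    then show ?thesis
      unfolding iff by auto
  qed
qed

lemma raise_mat_row:
  assumes "\<xi> \<in> confs n L \<theta>" "i < n"
  shows "(\<Sum>\<eta>\<in>confs n L \<theta>. raise_mat q L i \<xi> \<eta> * f \<eta>) =
    (\<Sum>y=1..L. of_bool (\<xi> y i \<ge> 1) * (q ^ side L i y \<xi> * cint q (\<xi> y (i + 1) + 1)) * f (conv y i (i + 1) \<xi>))"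
  unfolding raise_mat_def sum_distrib_right
proof (subst sum.swap, rule sum.cong[OF refl])
  fix y assume y: "y \<in> {1..L}"
  show "(\<Sum>\<eta>\<in>confs n L \<theta>. of_bool (\<xi> y i \<ge> 1 \<and> \<eta> = conv y i (i + 1) \<xi>) * (q ^ side L i y \<xi> * cint q (\<xi> y (i + 1) + 1)) * f \<eta>)
      = of_bool (\<xi> y i \<ge> 1) * (q ^ side L i y \<xi> * cint q (\<xi> y (i + 1) + 1)) * f (conv y i (i + 1) \<xi>)"
  proof (cases "\<xi> y i \<ge> 1")
    case True
    then have "conv y i (i + 1) \<xi> \<in> confs n L \<theta>"
      using assms y by (intro conv_in_confs) auto
    then show ?thesis
      using True finite_confs by (simp add: of_bool_def if_distrib[of "\<lambda>c. c * _"] cong: if_cong)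
  qed simp
qed

lemma lower_mat_row:
  assumes "\<xi> \<in> confs n L \<theta>" "i < n"
  shows "(\<Sum>\<eta>\<in>confs n L \<theta>. lower_mat q L i \<xi> \<eta> * f \<eta>) =
    (\<Sum>y=1..L. of_bool (\<xi> y (i + 1) \<ge> 1) * (q ^ side L i y \<xi> * cint q (\<xi> y i + 1)) * f (conv y (i + 1) i \<xi>))"
  unfolding lower_mat_def sum_distrib_right
proof (subst sum.swap, rule sum.cong[OF refl])
  fix y assume y: "y \<in> {1..L}"
  show "(\<Sum>\<eta>\<in>confs n L \<theta>. of_bool (\<xi> y (i + 1) \<ge> 1 \<and> \<eta> = conv y (i + 1) i \<xi>) * (q ^ side L i y \<xi> * cint q (\<xi> y i + 1)) * f \<eta>)
      = of_bool (\<xi> y (i + 1) \<ge> 1) * (q ^ side L i y \<xi> * cint q (\<xi> y i + 1)) * f (conv y (i + 1) i \<xi>)"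
  proof (cases "\<xi> y (i + 1) \<ge> 1")
    case True
    then have "conv y (i + 1) i \<xi> \<in> confs n L \<theta>"
      using assms y by (intro conv_in_confs) auto
    then show ?thesis
      using True finite_confs by (simp add: of_bool_def if_distrib[of "\<lambda>c. c * _"] cong: if_cong)
  qed simp
qed

text \<open>The factorials in G exchange [b + 1] for [a + 1] at the two cells, and the quadratic
  exponent makes \<open>side\<close> one-sided as in \<open>weight_left\<close>. The power of q that
  remains depends only on the totals of species i and i + 1, so it commutes with the
  generator.\<close>

lemma gauged_raise_mat_row:
  assumes "\<xi> \<in> confs n L \<theta>" "i < n"
  shows "(\<Sum>\<eta>\<in>confs n L \<theta>. inverse (Gd q n L \<xi>) * raise_mat q L i \<xi> \<eta> * Gd q n L \<eta> * f \<eta>) =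
    q powi (int (\<Sum>x=1..L. \<xi> x (i + 1)) - int (\<Sum>x=1..L. \<xi> x i) + 1) * convert q L i f \<xi>"
proof -
  have q0: "q \<noteq> 0" using q by simp
  have "(\<Sum>\<eta>\<in>confs n L \<theta>. inverse (Gd q n L \<xi>) * raise_mat q L i \<xi> \<eta> * Gd q n L \<eta> * f \<eta>)
      = inverse (Gd q n L \<xi>) * (\<Sum>\<eta>\<in>confs n L \<theta>. raise_mat q L i \<xi> \<eta> * (Gd q n L \<eta> * f \<eta>))"
    by (simp add: sum_distrib_left mult.assoc)
  also have "\<dots> = q powi (int (\<Sum>x=1..L. \<xi> x (i + 1)) - int (\<Sum>x=1..L. \<xi> x i) + 1) * convert q L i f \<xi>"
    unfolding raise_mat_row[OF assms] convert_def sum_distrib_left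
  proof (rule sum.cong[OF refl])
    fix y assume y: "y \<in> {1..L}"
    show "inverse (Gd q n L \<xi>) * (of_bool (\<xi> y i \<ge> 1) * (q ^ side L i y \<xi> * cint q (\<xi> y (i + 1) + 1)) *
          (Gd q n L (conv y i (i + 1) \<xi>) * f (conv y i (i + 1) \<xi>)))
        = q powi (int (\<Sum>x=1..L. \<xi> x (i + 1)) - int (\<Sum>x=1..L. \<xi> x i) + 1) * (weight_left q i y \<xi> * f (conv y i (i + 1) \<xi>))"
    proof (cases "\<xi> y i \<ge> 1")
      case True
      define \<eta> where "\<eta> = conv y i (i + 1) \<xi>"
      obtain a where a: "\<xi> y i = Suc a"
        using True by (cases "\<xi> y i") auto
      let ?b = "\<xi> y (i + 1)"
      define P where "P = site_prod n L (\<lambda>m. 1 / qfact q m)"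
      have cells: "\<eta> y i = a" "\<eta> y (i + 1) = Suc ?b"
        by (simp_all add: \<eta>_def conv_row a)
      have "P \<eta> * (1 / qfact q (\<xi> y i) * (1 / qfact q ?b)) = P \<xi> * (1 / qfact q (\<eta> y i) * (1 / qfact q (\<eta> y (i + 1))))"
        using assms(2) y unfolding \<eta>_def P_def by (intro site_prod_two_cells) (auto simp: conv_def)
      then have "P \<eta> * (1 / (qfact q a * qint q (Suc a)) * (1 / qfact q ?b)) = P \<xi> * (1 / qfact q a * (1 / (qfact q ?b * qint q (Suc ?b))))"
        by (simp only: cells a qfact_Suc)
      moreover have "X * (1 / (A * u) * (1 / B)) = Y * (1 / A * (1 / (B * v))) \<Longrightarrow> A \<noteq> 0 \<Longrightarrow> B \<noteq> 0 \<Longrightarrow> u \<noteq> 0 \<Longrightarrow> v \<noteq> 0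
          \<Longrightarrow> X * v = Y * u" for X Y A B u v :: real
        by (simp add: divide_simps)
      moreover have "qfact q a \<noteq> 0" "qfact q ?b \<noteq> 0" "qint q (Suc a) \<noteq> 0" "qint q (Suc ?b) \<noteq> 0"
        using qfact_pos[OF q] qint_pos[OF q] by (metis less_irrefl zero_less_Suc)+
      ultimately have P: "P \<eta> * qint q (Suc ?b) = P \<xi> * qint q (Suc a)"
        by blast
      define l where "l = (\<Sum>z=1..<y. \<xi> z i)"
      define l' where "l' = (\<Sum>z=1..<y. \<xi> z (i + 1))"
      define r where "r = (\<Sum>z=y+1..L. \<xi> z i)"
      define r' where "r' = (\<Sum>z=y+1..L. \<xi> z (i + 1))"
      have form: "self_form n L \<eta> = self_form n L \<xi> - int l' + int r"
        unfolding \<eta>_def l'_def r_def using y assms(2) True by (intro self_form_conv) auto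
      have G\<eta>: "Gd q n L \<eta> = P \<eta> * (q powi (- self_form n L \<xi>) * q powi (int l' - int r))"
        unfolding Gd_eq[OF q] form P_def using q0 by (subst power_int_add[symmetric]) (auto simp: algebra_simps)
      have G\<xi>: "Gd q n L \<xi> = P \<xi> * q powi (- self_form n L \<xi>)"
        unfolding Gd_eq[OF q] P_def ..
      have P\<xi>: "P \<xi> > 0"
        unfolding P_def using qfact_pos[OF q] by (intro site_prod_pos[OF q]) auto
      have cb: "cint q (Suc ?b) = q ^ ?b * qint q (Suc ?b)"
        using q0 by (simp add: qint_Suc[OF q])
      have "inverse (Gd q n L \<xi>) * (q ^ side L i y \<xi> * cint q (Suc ?b)) * Gd q n L \<eta>
          = (P \<eta> * qint q (Suc ?b)) * (q powi (- self_form n L \<xi>) / q powi (- self_form n L \<xi>)) / P \<xi> * (q ^ side L i y \<xi> * q ^ ?b * q powi (int l' - int r))"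
        unfolding G\<xi> G\<eta> cb by (simp add: divide_inverse mult_ac)
      also have "\<dots> = qint q (Suc a) * (q ^ side L i y \<xi> * q ^ ?b * q powi (int l' - int r))"
        unfolding P using P\<xi> q0 by simp
      also have "\<dots> = cint q (Suc a) * (q powi (int (l + r') + int ?b + (int l' - int r)) / q ^ a)"
        using q0 unfolding side_def l_def[symmetric] r'_def[symmetric]
        by (simp add: qint_Suc[OF q] power_int_add power_int_of_nat power_add)
      also have "q powi (int (l + r') + int ?b + (int l' - int r)) / q ^ a = q powi (int (l + r') + int ?b + (int l' - int r) - int a)"
        using q0 by (simp add: power_int_diff power_int_of_nat)
      \<comment> \<open>The totals are l' + b + r' for species i + 1 and l + (a + 1) + r for species
        i; their difference accounts for all but 2l.\<close>
      also have "int (l + r') + int ?b + (int l' - int r) - int a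
          = (int (\<Sum>x=1..L. \<xi> x (i + 1)) - int (\<Sum>x=1..L. \<xi> x i) + 1) + int (2 * l)"
        unfolding sum_sites_split[OF y, of "\<lambda>x. \<xi> x i"] sum_sites_split[OF y, of "\<lambda>x. \<xi> x (i + 1)"]
        by (simp add: l_def l'_def r_def r'_def a)
      also have "cint q (Suc a) * q powi \<dots> = q powi (int (\<Sum>x=1..L. \<xi> x (i + 1)) - int (\<Sum>x=1..L. \<xi> x i) + 1) * weight_left q i y \<xi>"
        unfolding power_int_add_nat[OF q(1)] by (simp add: weight_left_def l_def a mult_ac)
      finally have *: "inverse (Gd q n L \<xi>) * (q ^ side L i y \<xi> * cint q (Suc ?b)) * Gd q n L \<eta>
          = q powi (int (\<Sum>x=1..L. \<xi> x (i + 1)) - int (\<Sum>x=1..L. \<xi> x i) + 1) * weight_left q i y \<xi>" .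
      have "inverse (Gd q n L \<xi>) * (q ^ side L i y \<xi> * cint q (Suc ?b) * (Gd q n L \<eta> * f \<eta>))
          = q powi (int (\<Sum>x=1..L. \<xi> x (i + 1)) - int (\<Sum>x=1..L. \<xi> x i) + 1) * (weight_left q i y \<xi> * f \<eta>)"
        unfolding mult.assoc[symmetric] using * by (simp only: mult_ac)
      then show ?thesis
        using True by (simp add: \<eta>_def)
    next
      case False
      then show ?thesis by (simp add: weight_left_0)
    qed
  qed
  finally show ?thesis .
qed

end

section \<open>The commutator of raising and lowering, and commutation with the generator\<close>

lemma conv_total:
  assumes "y \<in> {1..L}" "i \<noteq> j" "\<xi> y i \<ge> 1"
  shows "(\<Sum>x=1..L. conv y i j \<xi> x i) + 1 = (\<Sum>x=1..L. \<xi> x i)"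
    and "(\<Sum>x=1..L. conv y i j \<xi> x j) = (\<Sum>x=1..L. \<xi> x j) + 1"
proof -
  have e: "(\<lambda>x. conv y i j \<xi> x i) = (\<lambda>x. \<xi> x i)(y := \<xi> y i - 1)" "(\<lambda>x. conv y i j \<xi> x j) = (\<lambda>x. \<xi> x j)(y := \<xi> y j + 1)"
    using assms(2) by (auto simp: conv_def)
  show "(\<Sum>x=1..L. conv y i j \<xi> x i) + 1 = (\<Sum>x=1..L. \<xi> x i)"
    "(\<Sum>x=1..L. conv y i j \<xi> x j) = (\<Sum>x=1..L. \<xi> x j) + 1"
    unfolding e using assms sum_decr[of "{1..L}" "\<lambda>x. \<xi> x i" y] sum_incr[of "{1..L}" "\<lambda>x. \<xi> x j" y] by simp_all
qed

lemma side_conv: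
  assumes "y \<in> {1..L}" "y \<noteq> y'" "y' \<in> {1..L}"
  shows "\<xi> y i \<ge> 1 \<Longrightarrow> side L i y' (conv y i (i + 1) \<xi>) + of_bool (y < y') = side L i y' \<xi> + of_bool (y' < y)"
    and "\<xi> y (i + 1) \<ge> 1 \<Longrightarrow> side L i y' (conv y (i + 1) i \<xi>) + of_bool (y' < y) = side L i y' \<xi> + of_bool (y < y')"
proof -
  have 1: "(\<lambda>x. conv y i (i + 1) \<xi> x i) = (\<lambda>x. \<xi> x i)(y := \<xi> y i - 1)"
    "(\<lambda>x. conv y i (i + 1) \<xi> x (i + 1)) = (\<lambda>x. \<xi> x (i + 1))(y := \<xi> y (i + 1) + 1)"
    "(\<lambda>x. conv y (i + 1) i \<xi> x i) = (\<lambda>x. \<xi> x i)(y := \<xi> y i + 1)"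
    "(\<lambda>x. conv y (i + 1) i \<xi> x (i + 1)) = (\<lambda>x. \<xi> x (i + 1))(y := \<xi> y (i + 1) - 1)"
    by (auto simp: conv_def)
  have 2: "y \<in> {1..<y'} \<longleftrightarrow> y < y'" "y \<in> {y'+1..L} \<longleftrightarrow> y' < y"
    using assms by auto
  show "side L i y' (conv y i (i + 1) \<xi>) + of_bool (y < y') = side L i y' \<xi> + of_bool (y' < y)" if "\<xi> y i \<ge> 1"
    using that sum_decr[of "{1..<y'}" "\<lambda>x. \<xi> x i" y] sum_incr[of "{y'+1..L}" "\<lambda>x. \<xi> x (i + 1)" y]
    unfolding side_def 1 2 by simp
  show "side L i y' (conv y (i + 1) i \<xi>) + of_bool (y' < y) = side L i y' \<xi> + of_bool (y < y')" if "\<xi> y (i + 1) \<ge> 1"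
    using that sum_incr[of "{1..<y'}" "\<lambda>x. \<xi> x i" y] sum_decr[of "{y'+1..L}" "\<lambda>x. \<xi> x (i + 1)" y]
    unfolding side_def 1 2 by simp
qed

lemma side_conv_same: "side L i y (conv y i j \<xi>) = side L i y \<xi>" "side L i y (conv y j i \<xi>) = side L i y \<xi>"
  unfolding side_def by (intro arg_cong2[of _ _ _ _ "(+)"] sum.cong; auto simp: conv_other_row)+

lemma conv_conv_commute:
  assumes "y \<noteq> y'"
  shows "conv y' j i (conv y i j \<xi>) = conv y i j (conv y' j i \<xi>)"
  using assms by (auto simp: conv_def intro!: ext)

context
  fixes q :: real
  assumes q: "0 < q" "q < 1"
begin

lemma cint_diff: "cint q a * cint q (b + 1) - cint q b * cint q (a + 1) = (q ^ (2 * b) - q ^ (2 * a)) / (1 - q^2)"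
proof -
  have "cint q a * cint q (b + 1) - cint q b * cint q (a + 1) = cint q a - cint q b"
    by (simp add: cint_Suc[OF q] algebra_simps)
  then show ?thesis
    by (simp add: cint_def diff_divide_distrib)
qed

text \<open>Moves at different sites commute. At one site the commutator is q^(2
  \<open>side\<close>) times (q^(2b) - q^(2a)) / (1 - q^2), where a and b count species i and i + 1
  there, and these local terms telescope over the sites.\<close>

lemma raise_lower_commutator:
  assumes "\<xi> \<in> confs n L \<theta>" "\<eta> \<in> confs n L \<theta>" "i < n"
  shows "(raise_mat q L i \<star>\<^bsub>confs n L \<theta>\<^esub> lower_mat q L i) \<xi> \<eta> - (lower_mat q L i \<star>\<^bsub>confs n L \<theta>\<^esub> raise_mat q L i) \<xi> \<eta>
    = (if \<xi> = \<eta> then (q ^ (2 * (\<Sum>x=1..L. \<xi> x (i + 1))) - q ^ (2 * (\<Sum>x=1..L. \<xi> x i))) / (1 - q^2) else 0)"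
proof -
  define T where "T y y' = of_bool (\<xi> y i \<ge> 1) * (q ^ side L i y \<xi> * cint q (\<xi> y (i + 1) + 1)) *
     (of_bool (conv y i (i + 1) \<xi> y' (i + 1) \<ge> 1 \<and> \<eta> = conv y' (i + 1) i (conv y i (i + 1) \<xi>)) *
        (q ^ side L i y' (conv y i (i + 1) \<xi>) * cint q (conv y i (i + 1) \<xi> y' i + 1)))" for y y'
  define T' where "T' y y' = of_bool (\<xi> y' (i + 1) \<ge> 1) * (q ^ side L i y' \<xi> * cint q (\<xi> y' i + 1)) *
     (of_bool (conv y' (i + 1) i \<xi> y i \<ge> 1 \<and> \<eta> = conv y i (i + 1) (conv y' (i + 1) i \<xi>)) *
        (q ^ side L i y (conv y' (i + 1) i \<xi>) * cint q (conv y' (i + 1) i \<xi> y (i + 1) + 1)))" for y y'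
  have RL: "(raise_mat q L i \<star>\<^bsub>confs n L \<theta>\<^esub> lower_mat q L i) \<xi> \<eta> = (\<Sum>y=1..L. \<Sum>y'=1..L. T y y')"
    unfolding mmul_def raise_mat_row[OF q assms(1,3)] unfolding lower_mat_def T_def sum_distrib_left ..
  have LR: "(lower_mat q L i \<star>\<^bsub>confs n L \<theta>\<^esub> raise_mat q L i) \<xi> \<eta> = (\<Sum>y=1..L. \<Sum>y'=1..L. T' y y')"
    unfolding mmul_def lower_mat_row[OF q assms(1,3)] unfolding raise_mat_def T'_def sum_distrib_left by (rule sum.swap)
  have off: "T y y' = T' y y'" if y: "y \<in> {1..L}" "y' \<in> {1..L}" "y \<noteq> y'" for y y'
  proof (cases "\<xi> y i \<ge> 1 \<and> \<xi> y' (i + 1) \<ge> 1")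
    case True
    have c: "conv y i (i + 1) \<xi> y' = \<xi> y'" "conv y' (i + 1) i \<xi> y = \<xi> y"
      using y(3) by (simp_all add: conv_other_row)
    \<comment> \<open>Each of the two moves changes the exponent seen by the other by the same unit,
      whose sign depends on the order of the sites.\<close>
    have "side L i y \<xi> + side L i y' (conv y i (i + 1) \<xi>) = side L i y' \<xi> + side L i y (conv y' (i + 1) i \<xi>)"
      using side_conv(1)[of y L y' \<xi> i] side_conv(2)[of y' L y \<xi> i] True y
      by (cases "y < y'") auto
    then have "q ^ side L i y \<xi> * q ^ side L i y' (conv y i (i + 1) \<xi>) = q ^ side L i y' \<xi> * q ^ side L i y (conv y' (i + 1) i \<xi>)"
      by (simp only: power_add[symmetric])
    then have "(X * A) * (Y * B) = (Z * B) * (W * A)"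
      if "X = q ^ side L i y \<xi>" "Y = q ^ side L i y' (conv y i (i + 1) \<xi>)" "Z = q ^ side L i y' \<xi>" "W = q ^ side L i y (conv y' (i + 1) i \<xi>)"
      for X Y Z W A B :: real
      using that by (simp add: algebra_simps)
    then show ?thesis
      unfolding T_def T'_def c conv_conv_commute[OF y(3)] using True by simp
  next
    case False
    then show ?thesis
      using y(3) by (auto simp: T_def T'_def conv_other_row)
  qed
  have diag: "T y y - T' y y = of_bool (\<xi> = \<eta>) * (q ^ (2 * side L i y \<xi>) * ((q ^ (2 * \<xi> y (i + 1)) - q ^ (2 * \<xi> y i)) / (1 - q^2)))" for y
  proof -
    have "T y y = of_bool (\<xi> = \<eta>) * (q ^ (2 * side L i y \<xi>) * (cint q (\<xi> y i) * cint q (\<xi> y (i + 1) + 1)))"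
    proof (cases "\<xi> y i \<ge> 1")
      case True
      then have "conv y i (i + 1) \<xi> y i + 1 = \<xi> y i" "conv y i (i + 1) \<xi> y (i + 1) \<ge> 1"
        by (simp_all add: conv_row)
      then show ?thesis
        unfolding T_def side_conv_same using True conv_conv(1)[of i "i + 1" \<xi> y]
        by (auto simp: mult_2 power_add)
    next
      case False
      then have "\<xi> y i = 0" by simp
      then show ?thesis by (simp add: T_def)
    qed
    moreover have "T' y y = of_bool (\<xi> = \<eta>) * (q ^ (2 * side L i y \<xi>) * (cint q (\<xi> y (i + 1)) * cint q (\<xi> y i + 1)))"
    proof (cases "\<xi> y (i + 1) \<ge> 1")
      case True
      then have "conv y (i + 1) i \<xi> y (i + 1) + 1 = \<xi> y (i + 1)" "conv y (i + 1) i \<xi> y i \<ge> 1"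
        by (simp_all add: conv_row)
      then show ?thesis
        unfolding T'_def side_conv_same using True conv_conv(1)[of "i + 1" i \<xi> y]
        by (auto simp: mult_2 power_add)
    next
      case False
      then have "\<xi> y (i + 1) = 0" by simp
      then show ?thesis by (simp add: T'_def)
    qed
    ultimately show ?thesis
      unfolding cint_diff[symmetric] by (simp only: right_diff_distrib)
  qed
  \<comment> \<open>Counts species i up to y and species i + 1 beyond y, so it interpolates between
    the total of species i + 1 at y = 0 and that of species i at y = L.\<close>
  define S where "S y = q ^ (2 * ((\<Sum>z=1..y. \<xi> z i) + (\<Sum>z=y+1..L. \<xi> z (i + 1))))" for y
  have S: "q ^ (2 * side L i y \<xi>) * (q ^ (2 * \<xi> y (i + 1)) - q ^ (2 * \<xi> y i)) = - (S y - S (y - 1))" if "y \<in> {1..L}" for y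
  proof -
    have "(\<Sum>z=y..L. \<xi> z (i + 1)) = \<xi> y (i + 1) + (\<Sum>z=y+1..L. \<xi> z (i + 1))"
      using that by (simp add: sum.atLeast_Suc_atMost)
    moreover have "(\<Sum>z=1..y. \<xi> z i) = (\<Sum>z=1..<y. \<xi> z i) + \<xi> y i"
      using that by (cases y) (auto simp: atLeastLessThanSuc_atLeastAtMost)
    moreover have "{1..y-1} = {1..<y}" "y - 1 + 1 = y"
      using that by auto
    ultimately have "(\<Sum>z=1..y. \<xi> z i) + (\<Sum>z=y+1..L. \<xi> z (i + 1)) = side L i y \<xi> + \<xi> y i"
      "(\<Sum>z=1..y-1. \<xi> z i) + (\<Sum>z=y-1+1..L. \<xi> z (i + 1)) = side L i y \<xi> + \<xi> y (i + 1)"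
      unfolding side_def by simp_all
    then show ?thesis
      unfolding S_def by (simp only: distrib_left power_add right_diff_distrib minus_diff_eq)
  qed
  have "(\<Sum>y=1..L. \<Sum>y'=1..L. T y y') - (\<Sum>y=1..L. \<Sum>y'=1..L. T' y y') = (\<Sum>y=1..L. \<Sum>y'=1..L. T y y' - T' y y')"
    by (simp add: sum_subtractf)
  also have "\<dots> = (\<Sum>y=1..L. T y y - T' y y)"
  proof (rule sum.cong[OF refl])
    fix y assume y: "y \<in> {1..L}"
    have "(\<Sum>y'=1..L. T y y' - T' y y') = (\<Sum>y'=1..L. if y' = y then T y y - T' y y else 0)"
      using off[OF y] by (intro sum.cong refl) auto
    then show "(\<Sum>y'=1..L. T y y' - T' y y') = T y y - T' y y"
      using y by simp
  qed
  also have "\<dots> = (\<Sum>y=1..L. of_bool (\<xi> = \<eta>) / (1 - q^2) * (- (S y - S (y - 1))))"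
    unfolding diag by (rule sum.cong[OF refl]) (simp only: S[symmetric] times_divide_eq_left times_divide_eq_right mult.assoc)
  also have "\<dots> = of_bool (\<xi> = \<eta>) / (1 - q^2) * (S 0 - S L)"
    using sum_telescope''[of 0 L S] unfolding sum_distrib_left[symmetric] sum_negf by simp
  finally show ?thesis
    unfolding RL LR by (simp add: S_def)
qed

lemma gen_mat_gauged_raise:
  assumes "\<xi> \<in> confs n L \<theta>" "\<eta> \<in> confs n L \<theta>" "i < n"
  defines "K \<equiv> \<lambda>\<xi> \<eta>. inverse (Gd q n L \<xi>) * raise_mat q L i \<xi> \<eta> * Gd q n L \<eta>"
  shows "(gen_mat q n L \<star>\<^bsub>confs n L \<theta>\<^esub> K) \<xi> \<eta> = (K \<star>\<^bsub>confs n L \<theta>\<^esub> gen_mat q n L) \<xi> \<eta>"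
proof -
  define \<phi> where "\<phi> N = q powi (int (N (i + 1)) - int (N i) + 1)" for N :: "nat \<Rightarrow> nat"
  define \<delta> where "\<delta> \<zeta> = (if \<zeta> = \<eta> then 1 else (0::real))" for \<zeta> :: conf
  have row: "(\<Sum>\<nu>\<in>confs n L \<theta>. K \<zeta> \<nu> * f \<nu>) = \<phi> (\<lambda>j. \<Sum>x=1..L. \<zeta> x j) * convert q L i f \<zeta>" if "\<zeta> \<in> confs n L \<theta>" for \<zeta> f
    unfolding K_def \<phi>_def by (rule gauged_raise_mat_row[OF q that assms(3)])
  have "(gen_mat q n L \<star>\<^bsub>confs n L \<theta>\<^esub> K) \<xi> \<eta> = gen q n L (\<lambda>\<zeta>. K \<zeta> \<eta>) \<xi>"
    unfolding mmul_def gen_eq_sum_gen_mat[OF assms(1)] ..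
  also have "\<dots> = gen q n L (\<lambda>\<zeta>. \<phi> (\<lambda>j. \<Sum>x=1..L. \<zeta> x j) * convert q L i \<delta> \<zeta>) \<xi>"
  proof (rule gen_cong[OF assms(1)])
    fix \<zeta> assume "\<zeta> \<in> confs n L \<theta>"
    then have "\<phi> (\<lambda>j. \<Sum>x=1..L. \<zeta> x j) * convert q L i \<delta> \<zeta> = (\<Sum>\<nu>\<in>confs n L \<theta>. K \<zeta> \<nu> * \<delta> \<nu>)"
      using row by simp
    also have "\<dots> = K \<zeta> \<eta>"
      using assms(2) finite_confs by (simp add: \<delta>_def if_distrib[of "\<lambda>c. _ * c"] cong: if_cong)
    finally show "K \<zeta> \<eta> = \<phi> (\<lambda>j. \<Sum>x=1..L. \<zeta> x j) * convert q L i \<delta> \<zeta>" ..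
  qed
  also have "\<dots> = \<phi> (\<lambda>j. \<Sum>x=1..L. \<xi> x j) * convert q L i (gen q n L \<delta>) \<xi>"
    unfolding gen_cmult_total gen_convert[OF q assms(3)] ..
  also have "\<dots> = (\<Sum>\<nu>\<in>confs n L \<theta>. K \<xi> \<nu> * gen q n L \<delta> \<nu>)"
    using row[OF assms(1)] by simp
  also have "\<dots> = (K \<star>\<^bsub>confs n L \<theta>\<^esub> gen_mat q n L) \<xi> \<eta>"
    unfolding mmul_def gen_mat_def \<delta>_def ..
  finally show ?thesis .
qed

end

text \<open>On the indicator of \<eta>, multiplication by the total of species j is multiplication
  by its value at \<eta>. Taking it out of the generator in both readings makes the values at \<xi>
  and \<eta> multiply the same nonzero entry.\<close>

lemma gen_mat_total:
  assumes "gen_mat q n L \<xi> \<eta> \<noteq> 0"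
  shows "(\<Sum>x=1..L. \<xi> x j) = (\<Sum>x=1..L. \<eta> x j)"
proof -
  let ?\<phi> = "\<lambda>N. real (N j)"
  let ?\<delta> = "\<lambda>\<zeta>. if \<zeta> = \<eta> then 1 else (0::real)"
  have "real (\<Sum>x=1..L. \<xi> x j) * gen_mat q n L \<xi> \<eta> = gen q n L (\<lambda>\<zeta>. real (\<Sum>x=1..L. \<zeta> x j) * ?\<delta> \<zeta>) \<xi>"
    unfolding gen_mat_def using gen_cmult_total[where \<phi> = ?\<phi> and f = ?\<delta>] by simp
  also have "(\<lambda>\<zeta>. real (\<Sum>x=1..L. \<zeta> x j) * ?\<delta> \<zeta>) = (\<lambda>\<zeta>. real (\<Sum>x=1..L. \<eta> x j) * ?\<delta> \<zeta>)"
    by auto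
  also have "gen q n L \<dots> \<xi> = real (\<Sum>x=1..L. \<eta> x j) * gen_mat q n L \<xi> \<eta>"
    unfolding gen_mat_def by (rule gen_cmult)
  finally show ?thesis
    using assms by (simp del: of_nat_sum)
qed

section \<open>Adjoints and orthogonality\<close>

text \<open>With \<open>c = 1\<close> this is multiplicative and unital, with \<open>c = 0\<close> it is linear.\<close>

definition ext_mat :: "real \<Rightarrow> conf set \<Rightarrow> opr \<Rightarrow> conf rmat" where
  "ext_mat c \<Omega> M = Rmat (\<lambda>\<xi> \<eta>. if \<xi> \<in> \<Omega> \<and> \<eta> \<in> \<Omega> then M \<xi> \<eta> else if \<xi> = \<eta> then c else 0)"

text \<open>Diagonal entries outside \<Omega> are allowed so that 1 and the extensions with
  \<open>c = 1\<close> qualify. Products still reduce to sums over the finite set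
  \<open>insert \<xi> \<Omega>\<close>.\<close>

definition supported :: "conf set \<Rightarrow> conf rmat \<Rightarrow> bool" where
  "supported \<Omega> X \<longleftrightarrow> (\<forall>\<xi> \<eta>. entry X \<xi> \<eta> \<noteq> 0 \<longrightarrow> \<xi> = \<eta> \<or> \<xi> \<in> \<Omega> \<and> \<eta> \<in> \<Omega>)"

lemma entry_one: "entry 1 x y = (if x = y then 1 else 0)"
  by transfer simp

lemma entry_diff: "entry (A - B) x y = entry A x y - entry B x y"
  using entry_plus[of A "- B" x y] by (simp add: entry_uminus)

lemma entry_sum: "entry (\<Sum>k\<in>K. f k) x y = (\<Sum>k\<in>K. entry (f k) x y)"
  by (induction K rule: infinite_finite_induct) (auto simp: entry_zero entry_plus)

context
  fixes \<Omega> :: "conf set"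
  assumes fin: "finite \<Omega>"
begin

lemma entry_ext_mat:
  "entry (ext_mat c \<Omega> M) \<xi> \<eta> = (if \<xi> \<in> \<Omega> \<and> \<eta> \<in> \<Omega> then M \<xi> \<eta> else if \<xi> = \<eta> then c else 0)"
proof -
  have "finite {\<eta>. (if \<xi> \<in> \<Omega> \<and> \<eta> \<in> \<Omega> then M \<xi> \<eta> else if \<xi> = \<eta> then c else 0) \<noteq> 0}" for \<xi>
    by (rule finite_subset[of _ "insert \<xi> \<Omega>"]) (auto simp: fin split: if_splits)
  then show ?thesis
    unfolding ext_mat_def by (subst Rmat_inverse) auto
qed

lemma supported_ext_mat: "supported \<Omega> (ext_mat c \<Omega> M)"
  by (simp add: supported_def entry_ext_mat)

lemma entry_times_supported:
  assumes "supported \<Omega> X" "finite S" "insert \<xi> \<Omega> \<subseteq> S"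
  shows "entry (X * Y) \<xi> \<eta> = (\<Sum>\<zeta>\<in>S. entry X \<xi> \<zeta> * entry Y \<zeta> \<eta>)"
  using assms by (intro entry_times) (auto simp: supported_def)

lemma supported_mult:
  assumes "supported \<Omega> X" "supported \<Omega> Y"
  shows "supported \<Omega> (X * Y)"
  unfolding supported_def
proof (intro allI impI)
  fix \<xi> \<eta> assume "entry (X * Y) \<xi> \<eta> \<noteq> 0"
  then have "(\<Sum>\<zeta>\<in>insert \<xi> \<Omega>. entry X \<xi> \<zeta> * entry Y \<zeta> \<eta>) \<noteq> 0"
    using entry_times_supported[OF assms(1), of "insert \<xi> \<Omega>" \<xi> Y \<eta>] fin by simp
  then obtain \<zeta> where "entry X \<xi> \<zeta> \<noteq> 0" "entry Y \<zeta> \<eta> \<noteq> 0"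
    by (auto elim!: sum.not_neutral_contains_not_neutral)
  then show "\<xi> = \<eta> \<or> \<xi> \<in> \<Omega> \<and> \<eta> \<in> \<Omega>"
    using assms unfolding supported_def by metis
qed

lemma ext_mat_mmul: "ext_mat c \<Omega> A * ext_mat d \<Omega> B = ext_mat (c * d) \<Omega> (A \<star>\<^bsub>\<Omega>\<^esub> B)"
proof (rule rmat_eqI)
  fix \<xi> \<eta>
  show "entry (ext_mat c \<Omega> A * ext_mat d \<Omega> B) \<xi> \<eta> = entry (ext_mat (c * d) \<Omega> (A \<star>\<^bsub>\<Omega>\<^esub> B)) \<xi> \<eta>"
  proof (cases "\<xi> \<in> \<Omega>")
    case True
    then have "insert \<xi> \<Omega> = \<Omega>" by auto
    then have "entry (ext_mat c \<Omega> A * ext_mat d \<Omega> B) \<xi> \<eta> = (\<Sum>\<zeta>\<in>\<Omega>. entry (ext_mat c \<Omega> A) \<xi> \<zeta> * entry (ext_mat d \<Omega> B) \<zeta> \<eta>)"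
      by (intro entry_times_supported[OF supported_ext_mat fin]) auto
    also have "\<dots> = entry (ext_mat (c * d) \<Omega> (A \<star>\<^bsub>\<Omega>\<^esub> B)) \<xi> \<eta>"
    proof (cases "\<eta> \<in> \<Omega>")
      case True
      then show ?thesis
        using \<open>\<xi> \<in> \<Omega>\<close> by (simp add: entry_ext_mat mmul_def)
    next
      case False
      then have "\<zeta> \<in> \<Omega> \<Longrightarrow> entry (ext_mat d \<Omega> B) \<zeta> \<eta> = 0" for \<zeta>
        by (auto simp: entry_ext_mat)
      then show ?thesis
        using False \<open>\<xi> \<in> \<Omega>\<close> by (auto simp: entry_ext_mat)
    qed
    finally show ?thesis .
  next
    case False
    have "entry (ext_mat c \<Omega> A * ext_mat d \<Omega> B) \<xi> \<eta> = (\<Sum>\<zeta>\<in>{\<xi>}. entry (ext_mat c \<Omega> A) \<xi> \<zeta> * entry (ext_mat d \<Omega> B) \<zeta> \<eta>)"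
      using False by (intro entry_times) (auto simp: entry_ext_mat)
    then show ?thesis
      using False by (simp add: entry_ext_mat)
  qed
qed

lemma ext_mat_eq_iff: "ext_mat c \<Omega> A = ext_mat c \<Omega> B \<longleftrightarrow> eq_on \<Omega> A B"
proof
  assume *: "ext_mat c \<Omega> A = ext_mat c \<Omega> B"
  show "eq_on \<Omega> A B"
    unfolding eq_on_def
  proof (intro ballI)
    fix \<xi> \<eta> assume "\<xi> \<in> \<Omega>" "\<eta> \<in> \<Omega>"
    then show "A \<xi> \<eta> = B \<xi> \<eta>"
      using arg_cong[OF *, of "\<lambda>X. entry X \<xi> \<eta>"] by (simp add: entry_ext_mat)
  qed
next
  assume "eq_on \<Omega> A B"
  then show "ext_mat c \<Omega> A = ext_mat c \<Omega> B"
    by (intro rmat_eqI) (simp add: entry_ext_mat eq_on_def)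
qed

lemma ext_mat_scale: "r *\<^sub>R ext_mat c \<Omega> A = ext_mat (r * c) \<Omega> (scale r A)"
  by (rule rmat_eqI) (simp add: entry_ext_mat entry_scaleR scale_def)

lemma ext_mat_one: "ext_mat 1 \<Omega> (diagm (\<lambda>_. 1)) = 1"
  by (rule rmat_eqI) (auto simp: entry_ext_mat entry_one diagm_def)

lemma ext_mat_power: "ext_mat 0 \<Omega> A ^ k = ext_mat (0 ^ k) \<Omega> (mpow \<Omega> A k)"
  by (induction k) (simp_all add: ext_mat_one ext_mat_mmul)

text \<open>Outside \<Omega> only the constant term is visible, which is why the argument is
  extended with \<open>c = 0\<close> and the value with \<open>c = 1\<close>.\<close>

lemma coeff_poly_ext_mat:
  assumes "N > 0" "c 0 = 1"
  shows "(\<Sum>k<N. c k *\<^sub>R ext_mat 0 \<Omega> A ^ k) = ext_mat 1 \<Omega> (\<lambda>\<xi> \<eta>. \<Sum>k<N. c k * mpow \<Omega> A k \<xi> \<eta>)"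
proof (rule rmat_eqI)
  fix \<xi> \<eta>
  have "(\<Sum>k<N. c k * 0 ^ k) = (\<Sum>k\<in>{0}. c k * 0 ^ k)"
    using assms(1) by (intro sum.mono_neutral_right) auto
  then show "entry (\<Sum>k<N. c k *\<^sub>R ext_mat 0 \<Omega> A ^ k) \<xi> \<eta> = entry (ext_mat 1 \<Omega> (\<lambda>\<xi> \<eta>. \<Sum>k<N. c k * mpow \<Omega> A k \<xi> \<eta>)) \<xi> \<eta>"
    using assms by (cases "\<xi> \<in> \<Omega> \<and> \<eta> \<in> \<Omega>"; cases "\<xi> = \<eta>")
      (auto simp: entry_sum entry_scaleR ext_mat_power entry_ext_mat intro!: sum.neutral)
qed

lemma ext_mat_exp:
  assumes "ext_mat 0 \<Omega> X ^ N = 0"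
  shows "ext_mat 1 \<Omega> (e_exp q \<Omega> X) = e_poly q N (ext_mat 0 \<Omega> X)"
    and "ext_mat 1 \<Omega> (E_exp q \<Omega> X) = E_poly q N (ext_mat 0 \<Omega> X)"
proof -
  have N: "N > 0"
    using assms by (cases N) auto
  have zero: "mpow \<Omega> X k \<xi> \<eta> = 0" if "\<xi> \<in> \<Omega>" "\<eta> \<in> \<Omega>" "k \<ge> N" for k \<xi> \<eta>
  proof -
    have "entry (ext_mat 0 \<Omega> X ^ k) \<xi> \<eta> = 0"
      using nilpotent_power_eq_0[OF assms that(3)] by (simp add: entry_zero)
    then show ?thesis
      using that by (simp add: ext_mat_power entry_ext_mat)
  qed
  have "e_exp q \<Omega> X \<xi> \<eta> = (\<Sum>k<N. e_coeff q k * mpow \<Omega> X k \<xi> \<eta>)" "E_exp q \<Omega> X \<xi> \<eta> = (\<Sum>k<N. E_coeff q k * mpow \<Omega> X k \<xi> \<eta>)"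
    if "\<xi> \<in> \<Omega>" "\<eta> \<in> \<Omega>" for \<xi> \<eta>
    unfolding e_exp_def E_exp_def e_coeff_def E_coeff_def
    by (subst suminf_finite[of "{..<N}"]; use zero[OF that] in \<open>simp add: not_less\<close>)+
  then show "ext_mat 1 \<Omega> (e_exp q \<Omega> X) = e_poly q N (ext_mat 0 \<Omega> X)"
    "ext_mat 1 \<Omega> (E_exp q \<Omega> X) = E_poly q N (ext_mat 0 \<Omega> X)"
    unfolding e_poly_def E_poly_def by (simp_all add: coeff_poly_ext_mat[OF N] ext_mat_eq_iff eq_on_def)
qed

lemma exp_diag:
  assumes "\<And>\<xi> \<eta>. \<xi> \<in> \<Omega> \<Longrightarrow> \<eta> \<in> \<Omega> \<Longrightarrow> X \<xi> \<eta> = (if \<xi> = \<eta> then d \<xi> else 0)" "\<xi> \<in> \<Omega>" "\<eta> \<in> \<Omega>"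
  shows "e_exp q \<Omega> X \<xi> \<eta> = (if \<xi> = \<eta> then e_fun q (d \<xi>) else 0)"
    and "E_exp q \<Omega> X \<xi> \<eta> = (if \<xi> = \<eta> then E_fun q (d \<xi>) else 0)"
proof -
  have "mpow \<Omega> X k \<xi> \<eta> = (if \<xi> = \<eta> then d \<xi> ^ k else 0)" if "\<xi> \<in> \<Omega>" for k \<xi>
  proof (induction k)
    case (Suc k)
    have "(X \<star>\<^bsub>\<Omega>\<^esub> mpow \<Omega> X k) \<xi> \<eta> = d \<xi> * mpow \<Omega> X k \<xi> \<eta>"
      using assms(1) that by (intro mmul_diag_left[OF fin that]) auto
    then show ?case
      using Suc by simp
  qed (simp add: diagm_def)
  then show "e_exp q \<Omega> X \<xi> \<eta> = (if \<xi> = \<eta> then e_fun q (d \<xi>) else 0)"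
    "E_exp q \<Omega> X \<xi> \<eta> = (if \<xi> = \<eta> then E_fun q (d \<xi>) else 0)"
    using assms(2) by (simp_all add: e_exp_def E_exp_def e_fun_def E_fun_def e_coeff_def E_coeff_def)
qed

text \<open>A grading argument: each factor raises \<open>deg\<close> by one, and there is no room
  below N for N steps.\<close>

lemma ext_mat_nilpotent:
  fixes deg :: "conf \<Rightarrow> nat"
  assumes "\<And>\<xi> \<eta>. \<xi> \<in> \<Omega> \<Longrightarrow> \<eta> \<in> \<Omega> \<Longrightarrow> A \<xi> \<eta> \<noteq> 0 \<Longrightarrow> deg \<eta> = deg \<xi> + 1" "\<And>\<xi>. \<xi> \<in> \<Omega> \<Longrightarrow> deg \<xi> < N" "N > 0"
  shows "ext_mat 0 \<Omega> A ^ N = 0"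
proof -
  have deg: "deg \<eta> = deg \<xi> + k" if "mpow \<Omega> A k \<xi> \<eta> \<noteq> 0" "\<xi> \<in> \<Omega>" "\<eta> \<in> \<Omega>" for k \<xi> \<eta>
    using that
  proof (induction k arbitrary: \<xi>)
    case 0
    then show ?case by (simp add: diagm_def split: if_splits)
  next
    case (Suc k)
    then obtain \<zeta> where "\<zeta> \<in> \<Omega>" "A \<xi> \<zeta> \<noteq> 0" "mpow \<Omega> A k \<zeta> \<eta> \<noteq> 0"
      by (auto simp: mmul_def elim!: sum.not_neutral_contains_not_neutral)
    then show ?case
      using Suc.IH[of \<zeta>] Suc.prems assms(1)[of \<xi> \<zeta>] by simp
  qed
  show ?thesis
  proof (rule rmat_eqI)
    fix \<xi> \<eta>
    have "mpow \<Omega> A N \<xi> \<eta> = 0" if "\<xi> \<in> \<Omega>" "\<eta> \<in> \<Omega>"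
      using deg[OF _ that] assms(2)[OF that(2)] by force
    then show "entry (ext_mat 0 \<Omega> A ^ N) \<xi> \<eta> = entry 0 \<xi> \<eta>"
      using assms(3) by (simp add: ext_mat_power entry_ext_mat entry_zero)
  qed
qed

text \<open>No topology is put on \<open>rmat\<close>. Entrywise limits pass through a product
  because the support of the left factors keeps the range of summation fixed and finite.\<close>

lemma tendsto_mult_entry:
  assumes "\<And>s. supported \<Omega> (X s)" "supported \<Omega> l"
    "\<And>\<xi> \<eta>. (\<lambda>s. entry (X s) \<xi> \<eta>) \<longlonglongrightarrow> entry l \<xi> \<eta>" "\<And>\<xi> \<eta>. (\<lambda>s. entry (Y s) \<xi> \<eta>) \<longlonglongrightarrow> entry m \<xi> \<eta>"
  shows "(\<lambda>s. entry (X s * Y s) \<xi> \<eta>) \<longlonglongrightarrow> entry (l * m) \<xi> \<eta>"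
proof -
  have f: "finite (insert \<xi> \<Omega>)"
    using fin by simp
  show ?thesis
    unfolding entry_times_supported[OF assms(1) f order.refl] entry_times_supported[OF assms(2) f order.refl]
    by (intro tendsto_sum tendsto_mult assms(3,4))
qed

lemma tendsto_coeff_poly_entry:
  assumes "t \<longlonglongrightarrow> 0" "N > 0" "c 0 = 1"
  shows "(\<lambda>s. entry (\<Sum>k<N. c k *\<^sub>R (t s *\<^sub>R x) ^ k) \<xi> \<eta>) \<longlonglongrightarrow> entry 1 \<xi> \<eta>"
proof -
  have "(\<lambda>s. \<Sum>k<N. c k * (t s ^ k * entry (x ^ k) \<xi> \<eta>)) \<longlonglongrightarrow> (\<Sum>k<N. c k * (0 ^ k * entry (x ^ k) \<xi> \<eta>))"
    by (intro tendsto_intros assms(1))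
  also have "(\<Sum>k<N. c k * (0 ^ k * entry (x ^ k) \<xi> \<eta>)) = (\<Sum>k\<in>{0}. c k * (0 ^ k * entry (x ^ k) \<xi> \<eta>))"
    using assms(2) by (intro sum.mono_neutral_right) auto
  finally show ?thesis
    using assms(3) by (simp add: entry_sum entry_scaleR scaleR_power mult.assoc)
qed

end

text \<open>Y is \<beta> times the transpose of X times \<beta>^(-1). It is a relation and not an
  operation because transposition does not preserve finiteness of rows; the condition on X repairs
  this.\<close>

definition adjoint_pair :: "conf set \<Rightarrow> (conf \<Rightarrow> real) \<Rightarrow> conf rmat \<Rightarrow> conf rmat \<Rightarrow> bool" where
  "adjoint_pair \<Omega> \<beta> X Y \<longleftrightarrow> supported \<Omega> X \<and> (\<forall>\<xi> \<eta>. entry Y \<xi> \<eta> = \<beta> \<xi> * entry X \<eta> \<xi> * inverse (\<beta> \<eta>))"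

context
  fixes \<Omega> :: "conf set" and \<beta> :: "conf \<Rightarrow> real"
  assumes fin: "finite \<Omega>" and \<beta>: "\<And>\<xi>. \<beta> \<xi> > 0"
begin

lemma \<beta>_neq_0: "\<beta> \<xi> \<noteq> 0"
  using \<beta>[of \<xi>] by simp

lemma adjoint_pair_unique: "adjoint_pair \<Omega> \<beta> X Y \<Longrightarrow> adjoint_pair \<Omega> \<beta> X Z \<Longrightarrow> Y = Z"
  by (rule rmat_eqI) (simp add: adjoint_pair_def)

lemma adjoint_pair_sym:
  assumes "adjoint_pair \<Omega> \<beta> X Y"
  shows "adjoint_pair \<Omega> \<beta> Y X"
proof -
  have Y: "entry Y \<xi> \<eta> = \<beta> \<xi> * entry X \<eta> \<xi> * inverse (\<beta> \<eta>)" for \<xi> \<eta>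
    using assms by (simp add: adjoint_pair_def)
  have "entry X \<xi> \<eta> = \<beta> \<xi> * entry Y \<eta> \<xi> * inverse (\<beta> \<eta>)" for \<xi> \<eta>
    unfolding Y using \<beta>_neq_0[of \<xi>] \<beta>_neq_0[of \<eta>] by (simp add: field_simps)
  moreover have "supported \<Omega> Y"
    unfolding supported_def
  proof (intro allI impI)
    fix \<xi> \<eta> assume "entry Y \<xi> \<eta> \<noteq> 0"
    then have "entry X \<eta> \<xi> \<noteq> 0"
      unfolding Y by simp
    then show "\<xi> = \<eta> \<or> \<xi> \<in> \<Omega> \<and> \<eta> \<in> \<Omega>"
      using assms unfolding adjoint_pair_def supported_def by metis
  qed
  ultimately show ?thesis
    by (simp add: adjoint_pair_def)
qed

lemma adjoint_pair_one: "adjoint_pair \<Omega> \<beta> 1 1"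
  using \<beta>_neq_0 by (simp add: adjoint_pair_def supported_def entry_one)

lemma adjoint_pair_zero: "adjoint_pair \<Omega> \<beta> 0 0"
  by (simp add: adjoint_pair_def supported_def entry_zero)

lemma adjoint_pair_add: "adjoint_pair \<Omega> \<beta> X Y \<Longrightarrow> adjoint_pair \<Omega> \<beta> X' Y' \<Longrightarrow> adjoint_pair \<Omega> \<beta> (X + X') (Y + Y')"
  unfolding adjoint_pair_def supported_def entry_plus
  by (simp add: distrib_left distrib_right) (metis add.right_neutral)

lemma adjoint_pair_scaleR: "adjoint_pair \<Omega> \<beta> X Y \<Longrightarrow> adjoint_pair \<Omega> \<beta> (r *\<^sub>R X) (r *\<^sub>R Y)"
  by (simp add: adjoint_pair_def supported_def entry_scaleR)

lemma adjoint_pair_mult: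
  assumes "adjoint_pair \<Omega> \<beta> X Y" "adjoint_pair \<Omega> \<beta> X' Y'"
  shows "adjoint_pair \<Omega> \<beta> (X * X') (Y' * Y)"
proof -
  have s: "supported \<Omega> X" "supported \<Omega> X'" "supported \<Omega> Y'"
    using assms adjoint_pair_sym[OF assms(2)] by (simp_all add: adjoint_pair_def)
  have "entry (Y' * Y) \<xi> \<eta> = \<beta> \<xi> * entry (X * X') \<eta> \<xi> * inverse (\<beta> \<eta>)" for \<xi> \<eta>
  proof -
    let ?S = "insert \<xi> (insert \<eta> \<Omega>)"
    have S: "finite ?S" "insert \<xi> \<Omega> \<subseteq> ?S" "insert \<eta> \<Omega> \<subseteq> ?S"
      using fin by auto
    have "entry (Y' * Y) \<xi> \<eta> = (\<Sum>\<zeta>\<in>?S. \<beta> \<xi> * entry X' \<zeta> \<xi> * inverse (\<beta> \<zeta>) * (\<beta> \<zeta> * entry X \<eta> \<zeta> * inverse (\<beta> \<eta>)))"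
      unfolding entry_times_supported[OF fin s(3) S(1,2)] using assms by (simp add: adjoint_pair_def)
    also have "\<dots> = (\<Sum>\<zeta>\<in>?S. \<beta> \<xi> * (entry X \<eta> \<zeta> * entry X' \<zeta> \<xi>) * inverse (\<beta> \<eta>))"
      using \<beta>_neq_0 by (intro sum.cong refl) simp
    also have "\<dots> = \<beta> \<xi> * entry (X * X') \<eta> \<xi> * inverse (\<beta> \<eta>)"
      unfolding entry_times_supported[OF fin s(1) S(1,3)] sum_distrib_left sum_distrib_right ..
    finally show ?thesis .
  qed
  then show ?thesis
    using supported_mult[OF fin s(1,2)] by (simp add: adjoint_pair_def)
qed

lemma adjoint_pair_power: "adjoint_pair \<Omega> \<beta> X Y \<Longrightarrow> adjoint_pair \<Omega> \<beta> (X ^ k) (Y ^ k)"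
proof (induction k)
  case (Suc k)
  then show ?case
    using adjoint_pair_mult[of X Y "X ^ k" "Y ^ k"] by (simp add: power_commutes)
qed (simp add: adjoint_pair_one)

lemma adjoint_pair_sum: "(\<And>k. adjoint_pair \<Omega> \<beta> (f k) (g k)) \<Longrightarrow> adjoint_pair \<Omega> \<beta> (\<Sum>k<N. f k) (\<Sum>k<N. g k)" for N :: nat
  by (induction N) (simp_all add: adjoint_pair_zero adjoint_pair_add)

lemma adjoint_pair_e_poly: "adjoint_pair \<Omega> \<beta> X Y \<Longrightarrow> adjoint_pair \<Omega> \<beta> (e_poly q N X) (e_poly q N Y)"
  unfolding e_poly_def by (intro adjoint_pair_sum adjoint_pair_scaleR adjoint_pair_power)

lemma adjoint_pair_E_poly: "adjoint_pair \<Omega> \<beta> X Y \<Longrightarrow> adjoint_pair \<Omega> \<beta> (E_poly q N X) (E_poly q N Y)"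
  unfolding E_poly_def by (intro adjoint_pair_sum adjoint_pair_scaleR adjoint_pair_power)

lemma adjoint_pair_diag: "adjoint_pair \<Omega> \<beta> (ext_mat c \<Omega> (diagm d)) (ext_mat c \<Omega> (diagm d))"
  using \<beta>_neq_0 by (auto simp: adjoint_pair_def supported_ext_mat[OF fin] entry_ext_mat[OF fin] diagm_def)

lemma adjoint_pair_ext_mat:
  assumes "\<And>\<xi> \<eta>. \<xi> \<in> \<Omega> \<Longrightarrow> \<eta> \<in> \<Omega> \<Longrightarrow> B \<xi> \<eta> = \<beta> \<xi> * A \<eta> \<xi> * inverse (\<beta> \<eta>)"
  shows "adjoint_pair \<Omega> \<beta> (ext_mat c \<Omega> A) (ext_mat c \<Omega> B)"
  using \<beta>_neq_0 assms by (auto simp: adjoint_pair_def supported_ext_mat[OF fin] entry_ext_mat[OF fin])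

end

lemma commute_e_poly: "h * x = x * h \<Longrightarrow> h * e_poly q N x = e_poly q N x * (h :: 'a::real_algebra_1)"
  unfolding e_poly_def sum_distrib_left sum_distrib_right
  by (intro sum.cong refl) (simp add: power_commuting_commutes[of x h] mult.assoc)

lemma commute_E_poly: "h * x = x * h \<Longrightarrow> h * E_poly q N x = E_poly q N x * (h :: 'a::real_algebra_1)"
  unfolding E_poly_def sum_distrib_left sum_distrib_right
  by (intro sum.cong refl) (simp add: power_commuting_commutes[of x h] mult.assoc)

lemma mmul_diagm_left: "finite \<Omega> \<Longrightarrow> \<xi> \<in> \<Omega> \<Longrightarrow> (diagm f \<star>\<^bsub>\<Omega>\<^esub> A) \<xi> \<eta> = f \<xi> * A \<xi> \<eta>"
  by (rule mmul_diag_left) (auto simp: diagm_def)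

lemma mmul_diagm_right: "finite \<Omega> \<Longrightarrow> \<eta> \<in> \<Omega> \<Longrightarrow> (A \<star>\<^bsub>\<Omega>\<^esub> diagm f) \<xi> \<eta> = A \<xi> \<eta> * f \<eta>"
  by (rule mmul_diag_right) (auto simp: diagm_def)

lemma total_less:
  assumes "\<xi> \<in> confs n L \<theta>" "j \<le> n"
  shows "(\<Sum>x=1..L. \<xi> x j) < Suc (\<Sum>x=1..L. \<theta> x)"
proof -
  have "(\<Sum>x=1..L. \<xi> x j) \<le> (\<Sum>x=1..L. \<Sum>i=0..n. \<xi> x i)"
    using assms(2) by (intro sum_mono member_le_sum) auto
  also have "\<dots> = (\<Sum>x=1..L. \<theta> x)"
    using assms(1) by (intro sum.cong) (auto simp: confs_def)
  finally show ?thesis by simp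
qed

lemma raise_mat_neq_0D:
  assumes "raise_mat q L i \<xi> \<eta> \<noteq> 0"
  shows "(\<Sum>x=1..L. \<eta> x (i + 1)) = (\<Sum>x=1..L. \<xi> x (i + 1)) + 1"
    and "(\<Sum>x=1..L. \<xi> x i) = (\<Sum>x=1..L. \<eta> x i) + 1"
proof -
  obtain y where "y \<in> {1..L}" "\<xi> y i \<ge> 1" "\<eta> = conv y i (i + 1) \<xi>"
    using assms unfolding raise_mat_def by (auto elim!: sum.not_neutral_contains_not_neutral)
  then show "(\<Sum>x=1..L. \<eta> x (i + 1)) = (\<Sum>x=1..L. \<xi> x (i + 1)) + 1" "(\<Sum>x=1..L. \<xi> x i) = (\<Sum>x=1..L. \<eta> x i) + 1"
    using conv_total[of y L i "i + 1" \<xi>] by simp_all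
qed

section \<open>The identity for one factor of U and its orthogonality\<close>

context
  fixes q :: real and n L :: nat and \<theta> :: "nat \<Rightarrow> nat"
  assumes q: "0 < q" "q < 1"
begin

abbreviation (input) "states \<equiv> confs n L \<theta>"

abbreviation (input) total :: "nat \<Rightarrow> conf \<Rightarrow> nat" where
  "total j \<xi> \<equiv> \<Sum>x=1..L. \<xi> x j"

abbreviation (input) "weight_B \<equiv> \<lambda>\<xi>. (Bd q n L \<xi>)^2"

text \<open>One more than the number of all particles, hence above every species total, which serves
  as the grading for nilpotency.\<close>

abbreviation (input) "nilp \<equiv> Suc (\<Sum>x=1..L. \<theta> x)"

abbreviation (input) raising :: "nat \<Rightarrow> conf rmat" where
  "raising i \<equiv> ext_mat 0 states (raise_mat q L i)"

abbreviation (input) lowering :: "nat \<Rightarrow> conf rmat" where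
  "lowering i \<equiv> ext_mat 0 states (lower_mat q L i)"

lemma weight_B_pos: "weight_B \<xi> > 0"
  by (intro zero_less_power Bd_pos[OF q])

lemma lowering_adjoint: "i < n \<Longrightarrow> adjoint_pair states weight_B (raising i) (lowering i)"
  by (rule adjoint_pair_ext_mat[OF finite_confs weight_B_pos]) (rule lower_mat_adjoint[OF q])

lemma raising_neq_0D:
  assumes "entry (raising i) \<xi> \<eta> \<noteq> 0"
  shows "\<xi> \<in> states" "\<eta> \<in> states" "total (i + 1) \<eta> = total (i + 1) \<xi> + 1" "total i \<xi> = total i \<eta> + 1"
proof -
  show "\<xi> \<in> states" "\<eta> \<in> states"
    using assms by (auto simp: entry_ext_mat[OF finite_confs] split: if_splits)
  then have "raise_mat q L i \<xi> \<eta> \<noteq> 0"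
    using assms by (simp add: entry_ext_mat[OF finite_confs])
  from raise_mat_neq_0D[OF this] show "total (i + 1) \<eta> = total (i + 1) \<xi> + 1" "total i \<xi> = total i \<eta> + 1" .
qed

lemma raising_nilpotent:
  assumes "i < n"
  shows "raising i ^ nilp = 0"
proof (rule ext_mat_nilpotent[OF finite_confs, where deg = "total (i + 1)"])
  show "total (i + 1) \<xi> < nilp" if "\<xi> \<in> states" for \<xi>
    by (rule total_less[OF that]) (use assms in simp)
qed (use raise_mat_neq_0D in auto)

lemma lowering_nilpotent:
  assumes "i < n"
  shows "lowering i ^ nilp = 0"
proof -
  have "adjoint_pair states weight_B (raising i ^ nilp) (lowering i ^ nilp)"
    by (rule adjoint_pair_power[OF finite_confs weight_B_pos lowering_adjoint[OF assms]])
  moreover have "adjoint_pair states weight_B (raising i ^ nilp) 0"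
    unfolding raising_nilpotent[OF assms] by (rule adjoint_pair_zero[OF finite_confs weight_B_pos])
  ultimately show ?thesis
    by (rule adjoint_pair_unique[OF finite_confs weight_B_pos])
qed

lemma entry_mult_diag: "entry (X * ext_mat c states (diagm d)) \<xi> \<eta> = entry X \<xi> \<eta> * (if \<eta> \<in> states then d \<eta> else c)"
proof -
  have "entry (X * ext_mat c states (diagm d)) \<xi> \<eta> =
      (\<Sum>\<zeta>\<in>insert \<eta> {\<zeta>. entry X \<xi> \<zeta> \<noteq> 0}. entry X \<xi> \<zeta> * entry (ext_mat c states (diagm d)) \<zeta> \<eta>)"
    by (rule entry_times) (auto simp: finite_row)
  also have "\<dots> = (\<Sum>\<zeta>\<in>{\<eta>}. entry X \<xi> \<zeta> * entry (ext_mat c states (diagm d)) \<zeta> \<eta>)"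
    by (intro sum.mono_neutral_right) (auto simp: finite_row entry_ext_mat[OF finite_confs] diagm_def)
  finally show ?thesis
    by (simp add: entry_ext_mat[OF finite_confs] diagm_def)
qed

lemma entry_diag_mult: "entry (ext_mat c states (diagm d) * X) \<xi> \<eta> = (if \<xi> \<in> states then d \<xi> else c) * entry X \<xi> \<eta>"
proof -
  have "entry (ext_mat c states (diagm d) * X) \<xi> \<eta> = (\<Sum>\<zeta>\<in>{\<xi>}. entry (ext_mat c states (diagm d)) \<xi> \<zeta> * entry X \<zeta> \<eta>)"
    by (rule entry_times) (auto simp: entry_ext_mat[OF finite_confs] diagm_def split: if_splits)
  then show ?thesis
    by (simp add: entry_ext_mat[OF finite_confs] diagm_def)
qed

lemma diag_mult_diag: "ext_mat c states (diagm d) * ext_mat c' states (diagm d') = ext_mat (c * c') states (diagm (\<lambda>\<xi>. d \<xi> * d' \<xi>))"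
  by (rule rmat_eqI) (simp add: entry_diag_mult, simp add: entry_ext_mat[OF finite_confs] diagm_def)

lemma diag_eq_one: "(\<And>\<xi>. \<xi> \<in> states \<Longrightarrow> d \<xi> = 1) \<Longrightarrow> ext_mat 1 states (diagm d) = 1"
  by (rule rmat_eqI) (auto simp: entry_ext_mat[OF finite_confs] entry_one diagm_def)

lemma E_fun_neq_0: "\<bar>z\<bar> < 1 \<Longrightarrow> E_fun q z \<noteq> 0"
  using e_fun_mult_E_fun[OF q, of z] by auto

text \<open>The left side is the quotient of \<open>E_quotient_constant\<close> at s = 0. It equals
  its limit for s \<longrightarrow> \<infinity>, where every factor except
  \<open>e_poly q nilp (l *\<^sub>R lowering i)\<close> tends to 1.\<close>

lemma e_poly_conjugation:
  assumes i: "i < n" and l: "l = - (g * (1 - q^2)^2)" and gl: "\<bar>g * l\<bar> < 1"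
  shows "e_poly q nilp (l *\<^sub>R raising i) * ext_mat 1 states (diagm (\<lambda>\<xi>. inverse (E_fun q (g * l * q ^ (2 * total i \<xi>)))))
      * e_poly q nilp (l *\<^sub>R lowering i) * E_poly q nilp (- (l *\<^sub>R raising i))
      * ext_mat 1 states (diagm (\<lambda>\<xi>. E_fun q (g * l * q ^ (2 * total (i + 1) \<xi>)))) = e_poly q nilp (l *\<^sub>R lowering i)"
proof -
  note entry_simps = entry_ext_mat[OF finite_confs] diagm_def
  define a where "a = raising i"
  define b where "b = lowering i"
  define k where "k = ext_mat 0 states (diagm (\<lambda>\<xi>. q ^ (2 * total (i + 1) \<xi>)))"
  define k' where "k' = ext_mat 0 states (diagm (\<lambda>\<xi>. q ^ (2 * total i \<xi>)))"
  \<comment> \<open>The argument of \<phi> after rescaling by t = q^(2s), at a configuration with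
    the given total of species j.\<close>
  define z where "z s j \<xi> = q ^ (2 * s) * (g * l * q ^ (2 * total j \<xi>))" for s j \<xi>
  define f where "f s = ext_mat 1 states (diagm (\<lambda>\<xi>. E_fun q (z s (i + 1) \<xi>)))" for s
  define f' where "f' s = ext_mat 1 states (diagm (\<lambda>\<xi>. E_fun q (z s i \<xi>)))" for s
  define g' where "g' s = ext_mat 1 states (diagm (\<lambda>\<xi>. inverse (E_fun q (z s i \<xi>))))" for s
  define e where "e = e_poly q nilp (l *\<^sub>R b)"
  have small: "\<bar>z s j \<xi>\<bar> < 1" for s j \<xi>
  proof -
    have "q ^ (2 * s) * q ^ (2 * total j \<xi>) \<le> 1"
      using q by (simp only: power_add[symmetric] power_le_one)
    then have "\<bar>g * l\<bar> * (q ^ (2 * s) * q ^ (2 * total j \<xi>)) \<le> \<bar>g * l\<bar> * 1"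
      by (intro mult_left_mono) auto
    then show ?thesis
      using gl q by (simp add: z_def abs_mult power_abs mult_ac)
  qed
  have ab: "a * b - b * a = (1 / (1 - q^2)) *\<^sub>R (k - k')"
  proof (rule rmat_eqI)
    fix \<xi> \<eta>
    show "entry (a * b - b * a) \<xi> \<eta> = entry ((1 / (1 - q^2)) *\<^sub>R (k - k')) \<xi> \<eta>"
      using raise_lower_commutator[OF q, of \<xi> n L \<theta> \<eta> i] i
      unfolding a_def b_def k_def k'_def ext_mat_mmul[OF finite_confs]
      by (simp add: entry_diff entry_scaleR entry_simps)
  qed
  have ka: "a * k = q^2 *\<^sub>R (k * a)"
  proof (rule rmat_eqI)
    fix \<xi> \<eta>
    show "entry (a * k) \<xi> \<eta> = entry (q^2 *\<^sub>R (k * a)) \<xi> \<eta>"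
    proof (cases "entry a \<xi> \<eta> = 0")
      case False
      then show ?thesis
        using raising_neq_0D[of i \<xi> \<eta>]
        by (simp add: a_def k_def entry_scaleR entry_mult_diag entry_diag_mult power2_eq_square)
    qed (simp add: a_def k_def entry_scaleR entry_mult_diag entry_diag_mult)
  qed
  have k'a: "k' * a = q^2 *\<^sub>R (a * k')"
  proof (rule rmat_eqI)
    fix \<xi> \<eta>
    show "entry (k' * a) \<xi> \<eta> = entry (q^2 *\<^sub>R (a * k')) \<xi> \<eta>"
    proof (cases "entry a \<xi> \<eta> = 0")
      case False
      then show ?thesis
        using raising_neq_0D[of i \<xi> \<eta>]
        by (simp add: a_def k'_def entry_scaleR entry_mult_diag entry_diag_mult power2_eq_square)
    qed (simp add: a_def k'_def entry_scaleR entry_mult_diag entry_diag_mult)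
  qed
  have adj_k: "adjoint_pair states weight_B k k" "adjoint_pair states weight_B k' k'"
    unfolding k_def k'_def by (intro adjoint_pair_diag finite_confs weight_B_pos)+
  have adj_ab: "adjoint_pair states weight_B a b"
    unfolding a_def b_def by (rule lowering_adjoint[OF i])
  note adj_mult = adjoint_pair_mult[OF finite_confs weight_B_pos]
  \<comment> \<open>The relations for b are the adjoints of those for a, since the Cartan elements
    are self-adjoint.\<close>
  have kb: "k * b = q^2 *\<^sub>R (b * k)"
    using adj_mult[OF adj_ab adj_k(1)] adjoint_pair_scaleR[OF finite_confs weight_B_pos adj_mult[OF adj_k(1) adj_ab], of "q^2"]
    unfolding ka by (rule adjoint_pair_unique[OF finite_confs weight_B_pos])
  have k'b: "b * k' = q^2 *\<^sub>R (k' * b)"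
    using adj_mult[OF adj_k(2) adj_ab] adjoint_pair_scaleR[OF finite_confs weight_B_pos adj_mult[OF adj_ab adj_k(2)], of "q^2"]
    unfolding k'a by (rule adjoint_pair_unique[OF finite_confs weight_B_pos])
  have f_step: "f s = (1 + (q ^ (2 * s) * (g * l)) *\<^sub>R k) * f (Suc s)"
    and f'_step: "f' s = (1 + (q ^ (2 * s) * (g * l)) *\<^sub>R k') * f' (Suc s)" for s
  proof -
    have E: "E_fun q (z s j \<xi>) = (1 + z s j \<xi>) * E_fun q (z (Suc s) j \<xi>)" for j \<xi>
      using E_fun_step[OF q, of "z s j \<xi>"] by (simp add: z_def power2_eq_square mult_ac)
    have "1 + (q ^ (2 * s) * (g * l)) *\<^sub>R k = ext_mat 1 states (diagm (\<lambda>\<xi>. 1 + z s (i + 1) \<xi>))"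
      "1 + (q ^ (2 * s) * (g * l)) *\<^sub>R k' = ext_mat 1 states (diagm (\<lambda>\<xi>. 1 + z s i \<xi>))"
      by (rule rmat_eqI; simp add: k_def k'_def entry_plus entry_one entry_scaleR entry_simps z_def)+
    then show "f s = (1 + (q ^ (2 * s) * (g * l)) *\<^sub>R k) * f (Suc s)"
      "f' s = (1 + (q ^ (2 * s) * (g * l)) *\<^sub>R k') * f' (Suc s)"
      by (simp_all only: f_def f'_def diag_mult_diag E[symmetric] mult_1)
  qed
  have f'a: "a * f' (Suc s) = f' s * a" for s
  proof (rule rmat_eqI)
    fix \<xi> \<eta>
    show "entry (a * f' (Suc s)) \<xi> \<eta> = entry (f' s * a) \<xi> \<eta>"
    proof (cases "entry a \<xi> \<eta> = 0")
      case False
      then have "\<xi> \<in> states" "\<eta> \<in> states" "total i \<xi> = total i \<eta> + 1"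
        using raising_neq_0D[of i \<xi> \<eta>] by (auto simp: a_def)
      \<comment> \<open>Along a row, raising lowers the total of species i by one, which compensates
        the shift from s + 1 to s exactly.\<close>
      moreover from this have "z (Suc s) i \<eta> = z s i \<xi>"
        by (simp add: z_def)
      ultimately show ?thesis
        by (simp add: f'_def entry_mult_diag entry_diag_mult)
    qed (simp add: f'_def entry_mult_diag entry_diag_mult)
  qed
  have inv: "g' s * f' s = 1" "f' s * g' s = 1" for s
    unfolding g'_def f'_def diag_mult_diag mult_1 using E_fun_neq_0[OF small]
    by (auto intro!: diag_eq_one)
  have e_step: "e * ((g * l) *\<^sub>R k - l *\<^sub>R a) = ((g * l) *\<^sub>R k' - l *\<^sub>R a) * e"
    unfolding e_def
    by (rule e_poly_intertwines[OF q ab kb k'b _ l]) (unfold b_def, rule lowering_nilpotent[OF i])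
  define t where "t s = q ^ (2 * s) * l" for s
  have const: "e_poly q nilp (t s *\<^sub>R a) * g' s * e * E_poly q nilp (- (t s *\<^sub>R a)) * f s
      = e_poly q nilp (t 0 *\<^sub>R a) * g' 0 * e * E_poly q nilp (- (t 0 *\<^sub>R a)) * f 0" for s
    unfolding t_def
    by (rule E_quotient_constant[OF q _ ka f_step f'_step f'a inv e_step])
       (unfold a_def, rule raising_nilpotent[OF i])
  have t0: "t \<longlonglongrightarrow> 0"
    unfolding t_def using tendsto_mult_left_zero[OF q_power_tendsto_0[OF q]] by blast
  have supp_poly: "supported states (e_poly q nilp (r *\<^sub>R a))" "supported states (E_poly q nilp (r *\<^sub>R a))" "supported states (e_poly q nilp (r *\<^sub>R b))" for r
    unfolding a_def b_def e_poly_def E_poly_def ext_mat_scale[OF finite_confs] mult_zero_right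
    by (simp_all add: coeff_poly_ext_mat[OF finite_confs] supported_ext_mat[OF finite_confs] del: sum.lessThan_Suc)
  have supp_one: "supported states 1"
    by (simp add: supported_def entry_one)
  have diag_lim: "(\<lambda>s. entry (ext_mat 1 states (diagm (d s))) \<xi> \<eta>) \<longlonglongrightarrow> entry 1 \<xi> \<eta>"
    if "\<And>\<xi>. (\<lambda>s. d s \<xi>) \<longlonglongrightarrow> 1" for d :: "nat \<Rightarrow> conf \<Rightarrow> real" and \<xi> \<eta>
    using that[of \<xi>] by (cases "\<xi> = \<eta>"; cases "\<xi> \<in> states"; cases "\<eta> \<in> states") (simp_all add: entry_simps entry_one)
  have z_lim: "(\<lambda>s. E_fun q (z s j \<xi>)) \<longlonglongrightarrow> 1" for j \<xi>
    unfolding z_def by (rule E_fun_tendsto_1[OF q])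
  \<comment> \<open>Bracketed to the right, because \<open>tendsto_mult_entry\<close> requires
    support of the left factors only.\<close>
  have "(\<lambda>s. entry (e_poly q nilp (t s *\<^sub>R a) * (g' s * (e * (E_poly q nilp ((- t s) *\<^sub>R a) * f s)))) \<xi> \<eta>) \<longlonglongrightarrow> entry (1 * (1 * (e * (1 * 1)))) \<xi> \<eta>" for \<xi> \<eta>
  proof (intro tendsto_mult_entry[OF finite_confs[of n L \<theta>]])
    show "(\<lambda>s. entry (e_poly q nilp (t s *\<^sub>R a)) \<xi> \<eta>) \<longlonglongrightarrow> entry 1 \<xi> \<eta>" for \<xi> \<eta>
      unfolding e_poly_def by (rule tendsto_coeff_poly_entry) (use t0 in auto)
    show "(\<lambda>s. entry (E_poly q nilp ((- t s) *\<^sub>R a)) \<xi> \<eta>) \<longlonglongrightarrow> entry 1 \<xi> \<eta>" for \<xi> \<eta>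
      unfolding E_poly_def by (rule tendsto_coeff_poly_entry) (use tendsto_minus[OF t0] in auto)
    show "(\<lambda>s. entry (g' s) \<xi> \<eta>) \<longlonglongrightarrow> entry 1 \<xi> \<eta>" for \<xi> \<eta>
      unfolding g'_def using tendsto_inverse[OF z_lim] by (intro diag_lim) simp
    show "(\<lambda>s. entry (f s) \<xi> \<eta>) \<longlonglongrightarrow> entry 1 \<xi> \<eta>" for \<xi> \<eta>
      unfolding f_def by (intro diag_lim z_lim)
  qed (unfold e_def g'_def, (rule supp_poly supp_one supported_ext_mat[OF finite_confs] tendsto_const)+)
  then have "(\<lambda>s. entry (e_poly q nilp (t s *\<^sub>R a) * g' s * e * E_poly q nilp (- (t s *\<^sub>R a)) * f s) \<xi> \<eta>) \<longlonglongrightarrow> entry e \<xi> \<eta>" for \<xi> \<eta>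
    by (simp only: mult.assoc scaleR_minus_left mult_1_left mult_1_right)
  moreover have "(\<lambda>s. entry (e_poly q nilp (t s *\<^sub>R a) * g' s * e * E_poly q nilp (- (t s *\<^sub>R a)) * f s) \<xi> \<eta>)
      = (\<lambda>s. entry (e_poly q nilp (t 0 *\<^sub>R a) * g' 0 * e * E_poly q nilp (- (t 0 *\<^sub>R a)) * f 0) \<xi> \<eta>)" for \<xi> \<eta>
    by (rule ext) (rule arg_cong[OF const])
  ultimately have "(\<lambda>s. entry (e_poly q nilp (t 0 *\<^sub>R a) * g' 0 * e * E_poly q nilp (- (t 0 *\<^sub>R a)) * f 0) \<xi> \<eta>) \<longlonglongrightarrow> entry e \<xi> \<eta>" for \<xi> \<eta>
    by (simp only:)
  then have "e_poly q nilp (t 0 *\<^sub>R a) * g' 0 * e * E_poly q nilp (- (t 0 *\<^sub>R a)) * f 0 = e"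
    by (intro rmat_eqI) (simp only: LIMSEQ_const_iff)
  then show ?thesis
    by (simp add: t_def z_def f_def g'_def e_def a_def b_def)
qed

lemma ext_mat_U_mat:
  assumes i: "i < n" and l: "gamma_lambda q g l"
  shows "ext_mat 1 states (U_mat q n L \<theta> g l R S i) =
    ext_mat 1 states R * e_poly q nilp (l *\<^sub>R lowering i) * E_poly q nilp (- (l *\<^sub>R raising i)) * ext_mat 1 states S"
proof -
  define X where "X = scale (g * (1 - q^2) * (q - inverse q)) (act q n L (Dn i) \<star>\<^bsub>states\<^esub> act q n L (Ct (wt i 1)))"
  define Y where "Y = scale (- l) (act q n L (Ct (wt (i + 1) 1)) \<star>\<^bsub>states\<^esub> act q n L (Up i))"
  \<comment> \<open>The last factor q is the one produced by \<open>act_lower\<close>.\<close>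
  have "g * (1 - q^2) * (q - inverse q) * q = l"
    using l q by (simp add: gamma_lambda_def algebra_simps power2_eq_square)
  then have "g * (1 - q^2) * (q - inverse q) * (q * c) = l * c" for c
    by (simp only: mult.assoc[symmetric])
  then have X: "ext_mat 0 states X = l *\<^sub>R lowering i"
    unfolding ext_mat_scale[OF finite_confs] mult_zero_right ext_mat_eq_iff[OF finite_confs] eq_on_def
    by (simp add: X_def scale_def act_lower[OF q _ _ i])
  have Y: "ext_mat 0 states Y = - (l *\<^sub>R raising i)"
  proof -
    have "- (l *\<^sub>R raising i) = (- l) *\<^sub>R raising i"
      by simp
    also have "\<dots> = ext_mat 0 states (scale (- l) (raise_mat q L i))"
      unfolding ext_mat_scale[OF finite_confs] by simp
    finally have neg: "- (l *\<^sub>R raising i) = ext_mat 0 states (scale (- l) (raise_mat q L i))" .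
    show ?thesis
      unfolding neg Y_def ext_mat_eq_iff[OF finite_confs] eq_on_def scale_def
      by (intro ballI) (simp only: act_raise[OF q _ _ i])
  qed
  have nil: "ext_mat 0 states X ^ nilp = 0" "ext_mat 0 states Y ^ nilp = 0"
    unfolding X Y scaleR_minus_left[symmetric] scaleR_power lowering_nilpotent[OF i] raising_nilpotent[OF i] by simp_all
  show ?thesis
    unfolding U_mat_def Let_def X_def[symmetric] Y_def[symmetric]
    using ext_mat_exp(1)[OF finite_confs nil(1)] ext_mat_exp(2)[OF finite_confs nil(2)]
    by (simp only: X Y ext_mat_mmul[OF finite_confs, where c = 1 and d = 1, unfolded mult_1, symmetric])
qed

lemma commute_mult:
  fixes h x y :: "'a::ring_1"
  assumes "h * x = x * h" "h * y = y * h"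
  shows "h * (x * y) = (x * y) * h"
proof -
  have "h * (x * y) = x * (h * y)"
    using assms(1) by (simp only: mult.assoc[symmetric])
  then show ?thesis
    using assms(2) by (simp only: mult.assoc)
qed

text \<open>The conjugation identity delivers Y S^2 = 1, whereas orthogonality asks for S Y S = 1.
  The left and right inverses of S^2 coincide, which lets Y pass one factor S.\<close>

lemma sandwich_eq_one:
  fixes s Y z :: "'a::ring_1"
  assumes "Y * (s * s) = 1" "(s * s) * z = 1"
  shows "s * Y * s = 1"
proof -
  have "Y = z"
    using assms by (metis mult.assoc mult_1_left mult_1_right)
  moreover have "Y * s = s * z"
    using assms by (metis mult.assoc mult_1_left mult_1_right)
  ultimately show ?thesis
    using assms(2) by (simp add: mult.assoc)
qed

lemma act_Ct_double:
  assumes "\<xi> \<in> states" "\<eta> \<in> states" "j \<le> n"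
  shows "act q n L (Ct (wt j 2)) \<xi> \<eta> = (if \<xi> = \<eta> then q ^ (2 * total j \<xi>) else 0)"
proof -
  have q0: "q \<noteq> 0"
    using q by simp
  have pow: "q powi (2 * int (total j \<xi>)) = q ^ (2 * total j \<xi>)"
    by (metis of_nat_mult of_nat_numeral power_int_of_nat)
  show ?thesis
    unfolding act_Ct_confs[OF q0 assms] pow ..
qed

text \<open>In the product of the adjoint with U the two roots R meet and form R^2 = 1/\<phi>(N), N
  the total of species i. \<open>e_poly_conjugation\<close> then collapses the middle, and
  \<open>sandwich_eq_one\<close> deals with the outer roots S.\<close>

lemma U_mat_orthogonal:
  assumes i: "i < n" and l: "gamma_lambda q g l" and gl: "\<bar>g * l\<bar> < 1"
    and R: "cartan_sqrt n L \<theta> R (e_exp q states (first_arg q n L g l i))"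
    and S: "cartan_sqrt n L \<theta> S (E_exp q states (last_arg q n L g l i))"
  shows "\<exists>u'. adjoint_pair states weight_B (ext_mat 1 states (U_mat q n L \<theta> g l R S i)) u'
      \<and> u' * ext_mat 1 states (U_mat q n L \<theta> g l R S i) = 1"
proof -
  obtain \<rho> \<sigma> where "eq_on states R (diagm (\<lambda>\<xi>. \<rho> (\<lambda>j. total j \<xi>)))" "eq_on states S (diagm (\<lambda>\<xi>. \<sigma> (\<lambda>j. total j \<xi>)))"
    using R S unfolding cartan_sqrt_def by blast
  then have RS: "ext_mat 1 states R = ext_mat 1 states (diagm (\<lambda>\<xi>. \<rho> (\<lambda>j. total j \<xi>)))"
    "ext_mat 1 states S = ext_mat 1 states (diagm (\<lambda>\<xi>. \<sigma> (\<lambda>j. total j \<xi>)))"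
    by (simp_all add: ext_mat_eq_iff[OF finite_confs])
  define r where "r = ext_mat 1 states R"
  define s where "s = ext_mat 1 states S"
  define f0 where "f0 = ext_mat 1 states (diagm (\<lambda>\<xi>. E_fun q (g * l * q ^ (2 * total (i + 1) \<xi>))))"
  define fi where "fi = ext_mat 1 states (diagm (\<lambda>\<xi>. inverse (E_fun q (g * l * q ^ (2 * total (i + 1) \<xi>)))))"
  define g0 where "g0 = ext_mat 1 states (diagm (\<lambda>\<xi>. inverse (E_fun q (g * l * q ^ (2 * total i \<xi>)))))"
  have small: "\<bar>g * l * q ^ (2 * N)\<bar> < 1" for N
  proof -
    have "\<bar>g * l\<bar> * q ^ (2 * N) \<le> \<bar>g * l\<bar> * 1"
      using q by (intro mult_left_mono power_le_one) auto
    then show ?thesis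
      using gl q by (simp add: abs_mult power_abs)
  qed
  have e_inv: "e_fun q (- z) = inverse (E_fun q z)" if "\<bar>z\<bar> < 1" for z
    using e_fun_mult_E_fun[OF q that] by (metis inverse_unique mult.commute)
  have first: "first_arg q n L g l i \<xi> \<eta> = (if \<xi> = \<eta> then - (g * l * q ^ (2 * total i \<xi>)) else 0)"
    and last: "last_arg q n L g l i \<xi> \<eta> = (if \<xi> = \<eta> then g * l * q ^ (2 * total (i + 1) \<xi>) else 0)"
    if "\<xi> \<in> states" "\<eta> \<in> states" for \<xi> \<eta>
    using act_Ct_double[OF that] i by (simp_all add: first_arg_def last_arg_def scale_def)
  have rr: "r * r = g0"
  proof -
    have "r * r = ext_mat 1 states (e_exp q states (first_arg q n L g l i))"
      using R unfolding r_def ext_mat_mmul[OF finite_confs] cartan_sqrt_def by (simp add: ext_mat_eq_iff[OF finite_confs])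
    also have "\<dots> = g0"
      unfolding g0_def ext_mat_eq_iff[OF finite_confs] eq_on_def
      using exp_diag(1)[OF finite_confs first] e_inv[OF small] by (simp add: diagm_def)
    finally show ?thesis .
  qed
  have ss: "s * s = f0"
  proof -
    have "s * s = ext_mat 1 states (E_exp q states (last_arg q n L g l i))"
      using S unfolding s_def ext_mat_mmul[OF finite_confs] cartan_sqrt_def by (simp add: ext_mat_eq_iff[OF finite_confs])
    also have "\<dots> = f0"
      unfolding f0_def ext_mat_eq_iff[OF finite_confs] eq_on_def
      using exp_diag(2)[OF finite_confs last] by (simp add: diagm_def)
    finally show ?thesis .
  qed
  have fi: "f0 * fi = 1"
    unfolding f0_def fi_def diag_mult_diag mult_1 using E_fun_neq_0[OF small] by (intro diag_eq_one) auto
  define a where "a = l *\<^sub>R raising i"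
  define b where "b = l *\<^sub>R lowering i"
  have nil_b: "b ^ nilp = 0"
    unfolding b_def scaleR_power lowering_nilpotent[OF i] by simp
  have ab: "adjoint_pair states weight_B a b"
    unfolding a_def b_def by (rule adjoint_pair_scaleR[OF finite_confs weight_B_pos lowering_adjoint[OF i]])
  have ab': "adjoint_pair states weight_B (- a) (- b)"
    using adjoint_pair_scaleR[OF finite_confs weight_B_pos ab, of "- 1"] by simp
  note adj = adjoint_pair_mult[OF finite_confs weight_B_pos] adjoint_pair_e_poly[OF finite_confs weight_B_pos]
    adjoint_pair_E_poly[OF finite_confs weight_B_pos] adjoint_pair_sym[OF finite_confs weight_B_pos]
  have diag: "adjoint_pair states weight_B r r" "adjoint_pair states weight_B s s"
    unfolding r_def s_def RS by (rule adjoint_pair_diag[OF finite_confs weight_B_pos])+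
  have u: "ext_mat 1 states (U_mat q n L \<theta> g l R S i) = r * e_poly q nilp b * E_poly q nilp (- a) * s"
    unfolding ext_mat_U_mat[OF i l] a_def b_def r_def s_def ..
  let ?u' = "s * (E_poly q nilp (- b) * (e_poly q nilp a * r))"
  have "adjoint_pair states weight_B (r * e_poly q nilp b * E_poly q nilp (- a) * s) ?u'"
    by (rule adj(1)[OF adj(1)[OF adj(1)[OF diag(1) adj(2)[OF adj(4)[OF ab]]] adj(3)[OF ab']] diag(2)])
  moreover have "?u' * (r * e_poly q nilp b * E_poly q nilp (- a) * s) = 1"
  proof -
    define Y where "Y = E_poly q nilp (- b) * (e_poly q nilp a * g0 * e_poly q nilp b * E_poly q nilp (- a))"
    have l': "l = - (g * (1 - q^2)^2)"
      using l by (simp add: gamma_lambda_def power2_eq_square algebra_simps)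
    have "e_poly q nilp a * g0 * e_poly q nilp b * E_poly q nilp (- a) * f0 = e_poly q nilp b"
      unfolding a_def b_def g0_def f0_def by (rule e_poly_conjugation[OF i l' gl])
    then have "Y * (s * s) = E_poly q nilp (- b) * e_poly q nilp b"
      unfolding Y_def ss by (simp only: mult.assoc)
    also have "\<dots> = 1"
      by (rule e_poly_mult_E_poly(2)[OF q nil_b])
    finally have "s * Y * s = 1"
      by (rule sandwich_eq_one[where z = fi]) (simp only: ss fi)
    then show ?thesis
      unfolding Y_def rr[symmetric] by (simp only: mult.assoc)
  qed
  ultimately show ?thesis
    unfolding u by blast
qed

section \<open>The gauged generator commutes with each factor of U\<close>

definition gauged_gen :: "conf rmat" where
  "gauged_gen = ext_mat 0 states (\<lambda>\<xi> \<eta>. Gd q n L \<xi> * gen_mat q n L \<xi> \<eta> * inverse (Gd q n L \<eta>))"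

lemma gauged_gen_raising:
  assumes "i < n"
  shows "gauged_gen * raising i = raising i * gauged_gen"
proof -
  let ?H = "\<lambda>\<xi> \<eta>. Gd q n L \<xi> * gen_mat q n L \<xi> \<eta> * inverse (Gd q n L \<eta>)"
  let ?K = "\<lambda>\<xi> \<eta>. inverse (Gd q n L \<xi>) * raise_mat q L i \<xi> \<eta> * Gd q n L \<eta>"
  have G: "Gd q n L \<xi> \<noteq> 0" for \<xi>
    using Gd_pos[OF q, of n L \<xi>] by simp
  have "(?H \<star>\<^bsub>states\<^esub> raise_mat q L i) \<xi> \<eta> = (raise_mat q L i \<star>\<^bsub>states\<^esub> ?H) \<xi> \<eta>" if "\<xi> \<in> states" "\<eta> \<in> states" for \<xi> \<eta>
  proof -
    have "(?H \<star>\<^bsub>states\<^esub> raise_mat q L i) \<xi> \<eta> = Gd q n L \<xi> * (gen_mat q n L \<star>\<^bsub>states\<^esub> ?K) \<xi> \<eta> * inverse (Gd q n L \<eta>)"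
      unfolding mmul_def sum_distrib_left sum_distrib_right using G by (intro sum.cong refl) simp
    also have "\<dots> = Gd q n L \<xi> * (?K \<star>\<^bsub>states\<^esub> gen_mat q n L) \<xi> \<eta> * inverse (Gd q n L \<eta>)"
      unfolding gen_mat_gauged_raise[OF q that assms] ..
    also have "\<dots> = (raise_mat q L i \<star>\<^bsub>states\<^esub> ?H) \<xi> \<eta>"
      unfolding mmul_def sum_distrib_left sum_distrib_right using G by (intro sum.cong refl) simp
    finally show ?thesis .
  qed
  then show ?thesis
    unfolding gauged_gen_def ext_mat_mmul[OF finite_confs] ext_mat_eq_iff[OF finite_confs] by (simp add: eq_on_def)
qed

text \<open>Detailed balance for G^2 B^(-2): conjugation by G uses up G^2 and leaves the weight
  B^(-2).\<close>

lemma gauged_gen_self_adjoint: "adjoint_pair states weight_B gauged_gen gauged_gen"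
  unfolding gauged_gen_def
proof (rule adjoint_pair_ext_mat[OF finite_confs weight_B_pos])
  fix \<xi> \<eta>
  have pos: "Gd q n L \<xi> > 0" "Gd q n L \<eta> > 0" "weight_B \<xi> > 0" "weight_B \<eta> > 0"
    by (rule Gd_pos[OF q] weight_B_pos)+
  have "x / b * u = y / c * v \<Longrightarrow> x > 0 \<Longrightarrow> y > 0 \<Longrightarrow> b > 0 \<Longrightarrow> c > 0 \<Longrightarrow> x * c * u = y * b * v" for x y b c u v :: real
    by (simp add: field_simps)
  from this[OF gen_mat_balance[OF q, of n L \<xi> \<eta>, unfolded rev_weight_def[OF q] divide_inverse[symmetric]]]
  have "(Gd q n L \<xi>)^2 * weight_B \<eta> * gen_mat q n L \<xi> \<eta> = (Gd q n L \<eta>)^2 * weight_B \<xi> * gen_mat q n L \<eta> \<xi>"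
    using pos by simp
  moreover have "x^2 * c * u = y^2 * b * v \<Longrightarrow> x > 0 \<Longrightarrow> y > 0 \<Longrightarrow> b > 0 \<Longrightarrow> c > 0 \<Longrightarrow>
      x * u * inverse y = b * (y * v * inverse x) * inverse c" for x y b c u v :: real
    by (simp add: field_simps power2_eq_square)
  ultimately show "Gd q n L \<xi> * gen_mat q n L \<xi> \<eta> * inverse (Gd q n L \<eta>) =
      weight_B \<xi> * (Gd q n L \<eta> * gen_mat q n L \<eta> \<xi> * inverse (Gd q n L \<xi>)) * inverse (weight_B \<eta>)"
    using pos by blast
qed

lemma gauged_gen_lowering:
  assumes "i < n"
  shows "gauged_gen * lowering i = lowering i * gauged_gen"
  using adjoint_pair_mult[OF finite_confs weight_B_pos lowering_adjoint[OF assms] gauged_gen_self_adjoint]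
    adjoint_pair_mult[OF finite_confs weight_B_pos gauged_gen_self_adjoint lowering_adjoint[OF assms]]
  unfolding gauged_gen_raising[OF assms] by (rule adjoint_pair_unique[OF finite_confs weight_B_pos])

lemma gauged_gen_diag:
  "gauged_gen * ext_mat 1 states (diagm (\<lambda>\<xi>. \<phi> (\<lambda>j. total j \<xi>))) = ext_mat 1 states (diagm (\<lambda>\<xi>. \<phi> (\<lambda>j. total j \<xi>))) * gauged_gen"
proof (rule rmat_eqI)
  fix \<xi> \<eta>
  show "entry (gauged_gen * ext_mat 1 states (diagm (\<lambda>\<xi>. \<phi> (\<lambda>j. total j \<xi>)))) \<xi> \<eta> =
      entry (ext_mat 1 states (diagm (\<lambda>\<xi>. \<phi> (\<lambda>j. total j \<xi>))) * gauged_gen) \<xi> \<eta>"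
  proof (cases "entry gauged_gen \<xi> \<eta> = 0")
    case False
    then have "\<xi> \<in> states" "\<eta> \<in> states" "gen_mat q n L \<xi> \<eta> \<noteq> 0"
      by (auto simp: gauged_gen_def entry_ext_mat[OF finite_confs] split: if_splits)
    moreover from this have "(\<lambda>j. total j \<xi>) = (\<lambda>j. total j \<eta>)"
      using gen_mat_total by (intro ext)
    ultimately show ?thesis
      by (simp only: entry_mult_diag entry_diag_mult if_True mult.commute)
  qed (simp add: entry_mult_diag entry_diag_mult)
qed

lemma gauged_gen_U_mat:
  assumes i: "i < n" and l: "gamma_lambda q g l"
    and R: "cartan_sqrt n L \<theta> R X" and S: "cartan_sqrt n L \<theta> S Y"
  shows "gauged_gen * ext_mat 1 states (U_mat q n L \<theta> g l R S i) = ext_mat 1 states (U_mat q n L \<theta> g l R S i) * gauged_gen"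
proof -
  obtain \<rho> \<sigma> where "eq_on states R (diagm (\<lambda>\<xi>. \<rho> (\<lambda>j. total j \<xi>)))" "eq_on states S (diagm (\<lambda>\<xi>. \<sigma> (\<lambda>j. total j \<xi>)))"
    using R S unfolding cartan_sqrt_def by blast
  then have RS: "ext_mat 1 states R = ext_mat 1 states (diagm (\<lambda>\<xi>. \<rho> (\<lambda>j. total j \<xi>)))"
    "ext_mat 1 states S = ext_mat 1 states (diagm (\<lambda>\<xi>. \<sigma> (\<lambda>j. total j \<xi>)))"
    by (simp_all add: ext_mat_eq_iff[OF finite_confs])
  have e: "gauged_gen * e_poly q nilp (l *\<^sub>R lowering i) = e_poly q nilp (l *\<^sub>R lowering i) * gauged_gen"
    by (rule commute_e_poly) (simp add: gauged_gen_lowering[OF i])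
  have E: "gauged_gen * E_poly q nilp (- (l *\<^sub>R raising i)) = E_poly q nilp (- (l *\<^sub>R raising i)) * gauged_gen"
    by (rule commute_E_poly) (simp add: gauged_gen_raising[OF i])
  show ?thesis
    unfolding ext_mat_U_mat[OF i l] RS by (intro commute_mult gauged_gen_diag e E)
qed

section \<open>The product of all factors, duality and orthogonality\<close>

context
  fixes \<gamma> \<Lambda> :: "nat \<Rightarrow> real" and R S :: "nat \<Rightarrow> opr"
  assumes l: "\<forall>i<n. gamma_lambda q (\<gamma> i) (\<Lambda> i)"
    and gl: "\<forall>i<n. \<bar>\<gamma> i * \<Lambda> i\<bar> < 1"
    and R: "\<forall>i<n. cartan_sqrt n L \<theta> (R i) (e_exp q states (first_arg q n L (\<gamma> i) (\<Lambda> i) i))"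
    and S: "\<forall>i<n. cartan_sqrt n L \<theta> (S i) (E_exp q states (last_arg q n L (\<gamma> i) (\<Lambda> i) i))"
begin

lemma ext_mat_U_prod_Suc:
  "ext_mat 1 states (U_prod q n L \<theta> \<gamma> \<Lambda> R S (Suc k)) =
     ext_mat 1 states (U_mat q n L \<theta> (\<gamma> k) (\<Lambda> k) (R k) (S k) k) * ext_mat 1 states (U_prod q n L \<theta> \<gamma> \<Lambda> R S k)"
  by (simp add: ext_mat_mmul[OF finite_confs])

lemma U_prod_orthogonal_aux:
  "k \<le> n \<Longrightarrow> \<exists>u'. adjoint_pair states weight_B (ext_mat 1 states (U_prod q n L \<theta> \<gamma> \<Lambda> R S k)) u'
      \<and> u' * ext_mat 1 states (U_prod q n L \<theta> \<gamma> \<Lambda> R S k) = 1"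
proof (induction k)
  case 0
  show ?case
    using adjoint_pair_one[OF finite_confs weight_B_pos] by (intro exI[of _ 1]) (simp add: ext_mat_one[OF finite_confs])
next
  case (Suc k)
  let ?u = "ext_mat 1 states (U_mat q n L \<theta> (\<gamma> k) (\<Lambda> k) (R k) (S k) k)"
  let ?v = "ext_mat 1 states (U_prod q n L \<theta> \<gamma> \<Lambda> R S k)"
  obtain v' where v': "adjoint_pair states weight_B ?v v'" "v' * ?v = 1"
    using Suc by auto
  obtain u' where u': "adjoint_pair states weight_B ?u u'" "u' * ?u = 1"
    using U_mat_orthogonal[of k "\<gamma> k" "\<Lambda> k" "R k" "S k"] Suc.prems l gl R S by auto
  have "v' * u' * (?u * ?v) = v' * (u' * ?u) * ?v"
    by (simp only: mult.assoc)
  then have "v' * u' * (?u * ?v) = 1"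
    using u'(2) v'(2) by simp
  then show ?case
    unfolding ext_mat_U_prod_Suc using adjoint_pair_mult[OF finite_confs weight_B_pos u'(1) v'(1)] by blast
qed

lemma gauged_gen_U_prod:
  "k \<le> n \<Longrightarrow> gauged_gen * ext_mat 1 states (U_prod q n L \<theta> \<gamma> \<Lambda> R S k) = ext_mat 1 states (U_prod q n L \<theta> \<gamma> \<Lambda> R S k) * gauged_gen"
proof (induction k)
  case 0
  show ?case
    by (simp add: ext_mat_one[OF finite_confs])
next
  case (Suc k)
  let ?u = "ext_mat 1 states (U_mat q n L \<theta> (\<gamma> k) (\<Lambda> k) (R k) (S k) k)"
  have "gauged_gen * ?u = ?u * gauged_gen"
  proof (rule gauged_gen_U_mat)
    show "k < n"
      using Suc.prems by simp
    then show "gamma_lambda q (\<gamma> k) (\<Lambda> k)"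
      "cartan_sqrt n L \<theta> (R k) (e_exp q states (first_arg q n L (\<gamma> k) (\<Lambda> k) k))"
      "cartan_sqrt n L \<theta> (S k) (E_exp q states (last_arg q n L (\<gamma> k) (\<Lambda> k) k))"
      using l R S by blast+
  qed
  then show ?case
    unfolding ext_mat_U_prod_Suc using Suc by (intro commute_mult) simp_all
qed

text \<open>The entries of M^T B^(-2) M = B^(-2), obtained by writing out the adjoint in u' u =
  1.\<close>

lemma U_prod_orthogonal:
  assumes "\<xi> \<in> states" "\<eta> \<in> states"
  defines "M \<equiv> U_prod q n L \<theta> \<gamma> \<Lambda> R S n"
  shows "(\<Sum>\<zeta>\<in>states. M \<zeta> \<xi> * inverse (weight_B \<zeta>) * M \<zeta> \<eta>) = (if \<xi> = \<eta> then inverse (weight_B \<xi>) else 0)"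
proof -
  let ?u = "ext_mat 1 states M"
  obtain u' where u': "adjoint_pair states weight_B ?u u'" "u' * ?u = 1"
    using U_prod_orthogonal_aux[of n] by (auto simp: M_def)
  have u'_entry: "entry u' \<xi> \<zeta> = weight_B \<xi> * entry ?u \<zeta> \<xi> * inverse (weight_B \<zeta>)" for \<zeta>
    using u'(1) by (simp add: adjoint_pair_def)
  have "entry (u' * ?u) \<xi> \<eta> = (\<Sum>\<zeta>\<in>states. entry u' \<xi> \<zeta> * entry ?u \<zeta> \<eta>)"
    using assms(1) by (intro entry_times finite_confs) (auto simp: u'_entry entry_ext_mat[OF finite_confs] split: if_splits)
  also have "\<dots> = weight_B \<xi> * (\<Sum>\<zeta>\<in>states. M \<zeta> \<xi> * inverse (weight_B \<zeta>) * M \<zeta> \<eta>)"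
    unfolding sum_distrib_left
    by (intro sum.cong refl) (simp add: u'_entry entry_ext_mat[OF finite_confs] assms(1,2) mult.assoc)
  finally have *: "weight_B \<xi> * (\<Sum>\<zeta>\<in>states. M \<zeta> \<xi> * inverse (weight_B \<zeta>) * M \<zeta> \<eta>) = (if \<xi> = \<eta> then 1 else 0)"
    by (simp add: u'(2) entry_one)
  have "(\<Sum>\<zeta>\<in>states. M \<zeta> \<xi> * inverse (weight_B \<zeta>) * M \<zeta> \<eta>)
      = inverse (weight_B \<xi>) * (weight_B \<xi> * (\<Sum>\<zeta>\<in>states. M \<zeta> \<xi> * inverse (weight_B \<zeta>) * M \<zeta> \<eta>))"
    using weight_B_pos[of \<xi>] by simp
  then show ?thesis
    unfolding * by simp
qed

lemma U_prod_commutes: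
  assumes "\<xi> \<in> states" "\<eta> \<in> states"
  defines "M \<equiv> U_prod q n L \<theta> \<gamma> \<Lambda> R S n"
  shows "(\<Sum>\<zeta>\<in>states. Gd q n L \<xi> * gen_mat q n L \<xi> \<zeta> * inverse (Gd q n L \<zeta>) * M \<zeta> \<eta>)
    = (\<Sum>\<zeta>\<in>states. M \<xi> \<zeta> * (Gd q n L \<zeta> * gen_mat q n L \<zeta> \<eta> * inverse (Gd q n L \<eta>)))"
  using gauged_gen_U_prod[of n] assms(1,2)
  unfolding gauged_gen_def M_def ext_mat_mmul[OF finite_confs] by (simp add: ext_mat_eq_iff[OF finite_confs] eq_on_def mmul_def)

text \<open>Covers D with a = 1 and D_A with a conserved quantity. Applied to the first index, the
  generator passes a and becomes the gauged generator in front of M; commutation moves it behind M,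
  and self-adjointness turns it into the generator on the second index.\<close>

lemma self_duality_of_form:
  assumes a: "\<And>\<xi> \<eta>. \<xi> \<in> states \<Longrightarrow> \<eta> \<in> states \<Longrightarrow> gen_mat q n L \<xi> \<eta> * a \<eta> = a \<xi> * gen_mat q n L \<xi> \<eta>"
    and D: "\<And>\<xi> \<eta>. \<xi> \<in> states \<Longrightarrow> \<eta> \<in> states \<Longrightarrow> D \<xi> \<eta> = a \<xi> * (inverse (Gd q n L \<xi>)
       * U_prod q n L \<theta> \<gamma> \<Lambda> R S n \<xi> \<eta> * inverse (Gd q n L \<eta>) * weight_B \<eta>) * a \<eta>"
  shows "self_duality q n L \<theta> D"
proof (rule self_duality_if_intertwines)
  fix \<xi> \<eta> assume \<xi>: "\<xi> \<in> states" and \<eta>: "\<eta> \<in> states"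
  let ?M = "U_prod q n L \<theta> \<gamma> \<Lambda> R S n" and ?G = "Gd q n L" and ?L = "gen_mat q n L"
  let ?c = "a \<xi> * a \<eta> * inverse (?G \<xi>) * inverse (?G \<eta>) * weight_B \<eta>"
  have G: "?G \<zeta> \<noteq> 0" for \<zeta>
    using Gd_pos[OF q, of n L \<zeta>] by simp
  have "gen q n L (\<lambda>\<zeta>. D \<zeta> \<eta>) \<xi> = ?c * (\<Sum>\<zeta>\<in>states. ?G \<xi> * ?L \<xi> \<zeta> * inverse (?G \<zeta>) * ?M \<zeta> \<eta>)"
    unfolding gen_eq_sum_gen_mat[OF \<xi>] sum_distrib_left
  proof (rule sum.cong[OF refl])
    fix \<zeta> assume \<zeta>: "\<zeta> \<in> states"
    have "?L \<xi> \<zeta> * D \<zeta> \<eta> = (?L \<xi> \<zeta> * a \<zeta>) * (inverse (?G \<zeta>) * ?M \<zeta> \<eta> * inverse (?G \<eta>) * weight_B \<eta>) * a \<eta>"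
      unfolding D[OF \<zeta> \<eta>] by (simp only: mult.assoc)
    then show "?L \<xi> \<zeta> * D \<zeta> \<eta> = ?c * (?G \<xi> * ?L \<xi> \<zeta> * inverse (?G \<zeta>) * ?M \<zeta> \<eta>)"
      unfolding a[OF \<xi> \<zeta>] using G[of \<xi>] by (simp add: field_simps)
  qed
  also have "\<dots> = ?c * (\<Sum>\<zeta>\<in>states. ?M \<xi> \<zeta> * (?G \<zeta> * ?L \<zeta> \<eta> * inverse (?G \<eta>)))"
    unfolding U_prod_commutes[OF \<xi> \<eta>] ..
  also have "\<dots> = gen q n L (\<lambda>\<zeta>. D \<xi> \<zeta>) \<eta>"
    unfolding gen_eq_sum_gen_mat[OF \<eta>] sum_distrib_left
  proof (rule sum.cong[OF refl])
    fix \<zeta> assume \<zeta>: "\<zeta> \<in> states"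
    have bal: "?G \<zeta> * ?L \<zeta> \<eta> * inverse (?G \<eta>) = weight_B \<zeta> * (?G \<eta> * ?L \<eta> \<zeta> * inverse (?G \<zeta>)) * inverse (weight_B \<eta>)"
      using gauged_gen_self_adjoint[unfolded adjoint_pair_def, THEN conjunct2, rule_format, of \<zeta> \<eta>]
      by (simp only: gauged_gen_def entry_ext_mat[OF finite_confs] \<zeta> \<eta> simp_thms if_True)
    have "?L \<eta> \<zeta> * D \<xi> \<zeta> = (?L \<eta> \<zeta> * a \<zeta>) * (inverse (?G \<xi>) * ?M \<xi> \<zeta> * inverse (?G \<zeta>) * weight_B \<zeta>) * a \<xi>"
      unfolding D[OF \<xi> \<zeta>] by (simp only: mult_ac)
    \<comment> \<open>The inserted factors equal to 1 supply the G and B^2 that \<open>bal\<close>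
      needs.\<close>
    also have "\<dots> = (?G \<eta> * inverse (?G \<eta>)) * (weight_B \<eta> * inverse (weight_B \<eta>))
        * ((a \<eta> * ?L \<eta> \<zeta>) * (inverse (?G \<xi>) * ?M \<xi> \<zeta> * inverse (?G \<zeta>) * weight_B \<zeta>) * a \<xi>)"
      unfolding a[OF \<eta> \<zeta>] using G[of \<eta>] Bd_pos[OF q, of n L \<eta>] by simp
    also have "\<dots> = ?c * (?M \<xi> \<zeta> * (?G \<zeta> * ?L \<zeta> \<eta> * inverse (?G \<eta>)))"
      unfolding bal by (simp only: mult_ac)
    finally show "?c * (?M \<xi> \<zeta> * (?G \<zeta> * ?L \<zeta> \<eta> * inverse (?G \<eta>))) = ?L \<eta> \<zeta> * D \<xi> \<zeta>" ..
  qed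
  finally show "gen q n L (\<lambda>\<zeta>. D \<zeta> \<eta>) \<xi> = gen q n L (\<lambda>\<zeta>. D \<xi> \<zeta>) \<eta>" .
qed

text \<open>At the summation index the weight cancels the factors a and G^(-1) of both copies of D
  and leaves B^(-2), so the sum becomes that of \<open>U_prod_orthogonal\<close>.\<close>

lemma orthogonal_of_form:
  assumes a: "\<And>\<xi>. \<xi> \<in> states \<Longrightarrow> a \<xi> \<noteq> 0"
    and D: "\<And>\<xi> \<eta>. \<xi> \<in> states \<Longrightarrow> \<eta> \<in> states \<Longrightarrow> D \<xi> \<eta> = a \<xi> * (inverse (Gd q n L \<xi>)
       * U_prod q n L \<theta> \<gamma> \<Lambda> R S n \<xi> \<eta> * inverse (Gd q n L \<eta>) * weight_B \<eta>) * a \<eta>"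
    and w: "\<And>\<xi>. \<xi> \<in> states \<Longrightarrow> w \<xi> = inverse ((a \<xi>)^2) * ((Gd q n L \<xi>)^2 * inverse (weight_B \<xi>))"
    and d: "\<And>\<xi>. \<xi> \<in> states \<Longrightarrow> d \<xi> = (a \<xi>)^2 * inverse ((Gd q n L \<xi>)^2) * weight_B \<xi>"
  shows "eq_on states (mtransp D \<star>\<^bsub>states\<^esub> diagm w \<star>\<^bsub>states\<^esub> D) (diagm d)"
  unfolding eq_on_def
proof (intro ballI)
  fix \<xi> \<eta> assume \<xi>: "\<xi> \<in> states" and \<eta>: "\<eta> \<in> states"
  let ?M = "U_prod q n L \<theta> \<gamma> \<Lambda> R S n" and ?G = "Gd q n L"
  let ?c = "\<lambda>\<xi>. a \<xi> * inverse (?G \<xi>) * weight_B \<xi>"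
  have "(mtransp D \<star>\<^bsub>states\<^esub> diagm w \<star>\<^bsub>states\<^esub> D) \<xi> \<eta> = (\<Sum>\<zeta>\<in>states. D \<zeta> \<xi> * w \<zeta> * D \<zeta> \<eta>)"
    unfolding mmul_def[of states "mtransp D \<star>\<^bsub>states\<^esub> diagm w"]
    by (intro sum.cong refl) (simp add: mmul_diagm_right[OF finite_confs] mtransp_def)
  also have "\<dots> = ?c \<xi> * ?c \<eta> * (\<Sum>\<zeta>\<in>states. ?M \<zeta> \<xi> * inverse (weight_B \<zeta>) * ?M \<zeta> \<eta>)"
    unfolding sum_distrib_left
  proof (rule sum.cong[OF refl])
    fix \<zeta> assume \<zeta>: "\<zeta> \<in> states"
    have "a \<zeta> \<noteq> 0" "?G \<zeta> \<noteq> 0"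
      using a[OF \<zeta>] Gd_pos[OF q, of n L \<zeta>] by auto
    then have "a \<zeta> * inverse (?G \<zeta>) * w \<zeta> * (a \<zeta> * inverse (?G \<zeta>)) = inverse (weight_B \<zeta>)"
      unfolding w[OF \<zeta>] by (simp add: power2_eq_square divide_simps)
    moreover have "D \<zeta> \<xi> * w \<zeta> * D \<zeta> \<eta> = (a \<zeta> * inverse (?G \<zeta>) * w \<zeta> * (a \<zeta> * inverse (?G \<zeta>))) * (?c \<xi> * ?c \<eta> * (?M \<zeta> \<xi> * ?M \<zeta> \<eta>))"
      unfolding D[OF \<zeta> \<xi>] D[OF \<zeta> \<eta>] by (simp only: mult_ac)
    ultimately show "D \<zeta> \<xi> * w \<zeta> * D \<zeta> \<eta> = ?c \<xi> * ?c \<eta> * (?M \<zeta> \<xi> * inverse (weight_B \<zeta>) * ?M \<zeta> \<eta>)"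
      by (simp only: mult_ac)
  qed
  also have "\<dots> = diagm d \<xi> \<eta>"
    unfolding U_prod_orthogonal[OF \<xi> \<eta>]
    using Bd_pos[OF q, of n L \<xi>] d[OF \<xi>]
    by (cases "\<xi> = \<eta>") (simp_all add: diagm_def power2_eq_square field_simps)
  finally show "(mtransp D \<star>\<^bsub>states\<^esub> diagm w \<star>\<^bsub>states\<^esub> D) \<xi> \<eta> = diagm d \<xi> \<eta>" .
qed

end

text \<open>A conserved quantity takes the same value at both ends of every possible jump, so
  dividing the weight by its square keeps detailed balance.\<close>

lemma reversible_of_form:
  assumes a: "\<And>\<xi> \<eta>. \<xi> \<in> states \<Longrightarrow> \<eta> \<in> states \<Longrightarrow> gen_mat q n L \<xi> \<eta> * a \<eta> = a \<xi> * gen_mat q n L \<xi> \<eta>"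
    and a0: "\<And>\<xi>. \<xi> \<in> states \<Longrightarrow> a \<xi> \<noteq> 0"
    and w: "\<And>\<xi>. \<xi> \<in> states \<Longrightarrow> w \<xi> = inverse ((a \<xi>)^2) * rev_weight q n L \<xi>"
  shows "reversible_measure q n L \<theta> w"
  unfolding reversible_measure_def
proof (intro conjI ballI)
  show "0 < w \<xi>" if "\<xi> \<in> states" for \<xi>
    unfolding w[OF that] using a0[OF that] by (intro mult_pos_pos rev_weight_pos[OF q]) simp
  fix \<xi> \<eta> assume \<xi>: "\<xi> \<in> states" and \<eta>: "\<eta> \<in> states"
  note balance = gen_mat_balance[OF q, of n L \<xi> \<eta>]
  show "w \<xi> * gen_mat q n L \<xi> \<eta> = w \<eta> * gen_mat q n L \<eta> \<xi>"
  proof (cases "gen_mat q n L \<xi> \<eta> = 0")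
    case True
    then show ?thesis
      using balance rev_weight_pos[OF q, of n L \<eta>] by simp
  next
    case False
    then have "a \<xi> = a \<eta>"
      using a[OF \<xi> \<eta>] by simp
    then show ?thesis
      unfolding w[OF \<xi>] w[OF \<eta>] using balance by simp
  qed
qed

end

theorem theorem4p5:
  fixes q :: real and n L :: nat and \<theta> :: "nat \<Rightarrow> nat"
    and \<gamma> \<Lambda> :: "nat \<Rightarrow> real" and R S :: "nat \<Rightarrow> opr"
  assumes "0 < q" and "q < 1" and "n \<ge> 1" and "L \<ge> 1"
    and "\<forall>x\<in>{1..L}. \<theta> x \<ge> 1"
    and "\<forall>i<n. gamma_lambda q (\<gamma> i) (\<Lambda> i)"
    and "\<forall>i<n. \<bar>\<gamma> i * \<Lambda> i\<bar> < 1"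
    and "\<forall>i<n. cartan_sqrt n L \<theta> (R i) (e_exp q (confs n L \<theta>) (first_arg q n L (\<gamma> i) (\<Lambda> i) i))"
    and "\<forall>i<n. cartan_sqrt n L \<theta> (S i) (E_exp q (confs n L \<theta>) (last_arg q n L (\<gamma> i) (\<Lambda> i) i))"
  shows
    "let \<Omega> = confs n L \<theta>;
         M = U_prod q n L \<theta> \<gamma> \<Lambda> R S n;
         Ginv = diagm (\<lambda>\<xi>. inverse (Gd q n L \<xi>));
         B2 = diagm (\<lambda>\<xi>. (Bd q n L \<xi>)^2);
         w = (\<lambda>\<xi>. (Gd q n L \<xi>)^2 * inverse ((Bd q n L \<xi>)^2));
         D = Ginv \<star>\<^bsub>\<Omega>\<^esub> M \<star>\<^bsub>\<Omega>\<^esub> Ginv \<star>\<^bsub>\<Omega>\<^esub> B2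
     in
       (self_duality q n L \<theta> D \<and>
        reversible_measure q n L \<theta> w \<and>
        eq_on \<Omega> (mtransp D \<star>\<^bsub>\<Omega>\<^esub> diagm w \<star>\<^bsub>\<Omega>\<^esub> D)
               (diagm (\<lambda>\<xi>. inverse ((Gd q n L \<xi>)^2) * (Bd q n L \<xi>)^2)))
     \<and> (\<forall>a. conserved q n L \<theta> a \<longrightarrow>
          (let DA = diagm a \<star>\<^bsub>\<Omega>\<^esub> Ginv \<star>\<^bsub>\<Omega>\<^esub> M \<star>\<^bsub>\<Omega>\<^esub> Ginv \<star>\<^bsub>\<Omega>\<^esub> B2 \<star>\<^bsub>\<Omega>\<^esub> diagm a;
               wA = (\<lambda>\<xi>. inverse ((a \<xi>)^2) * w \<xi>)
           in
             self_duality q n L \<theta> DA \<and>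
             ((\<forall>\<xi>\<in>\<Omega>. a \<xi> \<noteq> 0) \<longrightarrow>
                reversible_measure q n L \<theta> wA \<and>
                eq_on \<Omega> (mtransp DA \<star>\<^bsub>\<Omega>\<^esub> diagm wA \<star>\<^bsub>\<Omega>\<^esub> DA)
                       (diagm (\<lambda>\<xi>. (a \<xi>)^2 * inverse ((Gd q n L \<xi>)^2) * (Bd q n L \<xi>)^2)))))"
proof -
  let ?\<Omega> = "confs n L \<theta>"
  let ?M = "U_prod q n L \<theta> \<gamma> \<Lambda> R S n"
  let ?G = "Gd q n L"
  let ?w = "\<lambda>\<xi>. (?G \<xi>)^2 * inverse ((Bd q n L \<xi>)^2)"
  let ?D = "diagm (\<lambda>\<xi>. inverse (?G \<xi>)) \<star>\<^bsub>?\<Omega>\<^esub> ?M \<star>\<^bsub>?\<Omega>\<^esub> diagm (\<lambda>\<xi>. inverse (?G \<xi>)) \<star>\<^bsub>?\<Omega>\<^esub> diagm (\<lambda>\<xi>. (Bd q n L \<xi>)^2)"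
  let ?DA = "\<lambda>a. diagm a \<star>\<^bsub>?\<Omega>\<^esub> diagm (\<lambda>\<xi>. inverse (?G \<xi>)) \<star>\<^bsub>?\<Omega>\<^esub> ?M \<star>\<^bsub>?\<Omega>\<^esub> diagm (\<lambda>\<xi>. inverse (?G \<xi>)) \<star>\<^bsub>?\<Omega>\<^esub> diagm (\<lambda>\<xi>. (Bd q n L \<xi>)^2) \<star>\<^bsub>?\<Omega>\<^esub> diagm a"
  note q = assms(1,2) and params = assms(6-9)
  note fin = finite_confs[of n L \<theta>]
  \<comment> \<open>The factors 1 give D the shape of the general form with a = 1.\<close>
  have D: "?D \<xi> \<eta> = 1 * (inverse (?G \<xi>) * ?M \<xi> \<eta> * inverse (?G \<eta>) * (Bd q n L \<eta>)^2) * 1" if "\<xi> \<in> ?\<Omega>" "\<eta> \<in> ?\<Omega>" for \<xi> \<eta>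
    using that by (simp add: mmul_diagm_left mmul_diagm_right fin)
  have DA: "?DA a \<xi> \<eta> = a \<xi> * (inverse (?G \<xi>) * ?M \<xi> \<eta> * inverse (?G \<eta>) * (Bd q n L \<eta>)^2) * a \<eta>" if "\<xi> \<in> ?\<Omega>" "\<eta> \<in> ?\<Omega>" for a \<xi> \<eta>
  proof -
    have "(diagm a \<star>\<^bsub>?\<Omega>\<^esub> diagm (\<lambda>\<xi>. inverse (?G \<xi>)) \<star>\<^bsub>?\<Omega>\<^esub> ?M) \<xi> \<eta> = a \<xi> * inverse (?G \<xi>) * ?M \<xi> \<eta>"
      using that by (intro mmul_diag_left fin) (auto simp: mmul_diagm_left fin, auto simp: diagm_def)
    then show ?thesis
      using that by (simp add: mmul_diagm_right fin)
  qed
  have conserved: "gen_mat q n L \<xi> \<eta> * a \<eta> = a \<xi> * gen_mat q n L \<xi> \<eta>"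
    if "conserved q n L \<theta> a" "\<xi> \<in> ?\<Omega>" "\<eta> \<in> ?\<Omega>" for a \<xi> \<eta>
    using that by (simp add: conserved_def eq_on_def mmul_diagm_left mmul_diagm_right fin)
  show ?thesis
    unfolding Let_def
  proof (intro conjI allI impI)
    show "self_duality q n L \<theta> ?D"
      by (rule self_duality_of_form[OF q params _ D]) simp_all
    show "reversible_measure q n L \<theta> ?w"
      by (rule reversible_of_form[OF q, where a = "\<lambda>_. 1"]) (simp_all add: rev_weight_def[OF q])
    show "eq_on ?\<Omega> (mtransp ?D \<star>\<^bsub>?\<Omega>\<^esub> diagm ?w \<star>\<^bsub>?\<Omega>\<^esub> ?D) (diagm (\<lambda>\<xi>. inverse ((?G \<xi>)^2) * (Bd q n L \<xi>)^2))"
      by (rule orthogonal_of_form[OF q params _ D]) simp_all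
    fix a assume a: "conserved q n L \<theta> a"
    show "self_duality q n L \<theta> (?DA a)"
      by (rule self_duality_of_form[OF q params conserved[OF a] DA])
    assume a0: "\<forall>\<xi>\<in>?\<Omega>. a \<xi> \<noteq> 0"
    show "reversible_measure q n L \<theta> (\<lambda>\<xi>. inverse ((a \<xi>)^2) * ?w \<xi>)"
      by (rule reversible_of_form[OF q conserved[OF a]]) (use a0 in \<open>simp_all add: rev_weight_def[OF q]\<close>)
    show "eq_on ?\<Omega> (mtransp (?DA a) \<star>\<^bsub>?\<Omega>\<^esub> diagm (\<lambda>\<xi>. inverse ((a \<xi>)^2) * ?w \<xi>) \<star>\<^bsub>?\<Omega>\<^esub> ?DA a)
        (diagm (\<lambda>\<xi>. (a \<xi>)^2 * inverse ((?G \<xi>)^2) * (Bd q n L \<xi>)^2))"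
      by (rule orthogonal_of_form[OF q params _ DA]) (use a0 in auto)
  qed
qed

end
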